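(* Let $K$ be a field and let $\mathcal{C}$ be a small $K$-linear category. If $\mathcal{C}$ is separable, then every left $\mathcal{C}$-module $M$ is projective (i.e. a projective object in the category of left $\mathcal{C}$-modules).
   Context: Write $\mathcal{C}_0$ for the set of objects and $\mathcal{C}(x,y)$ for $\mathrm{Hom}_{\mathcal{C}}(x,y)$. A category is $K$-linear if each $\mathcal{C}(x,y)$ is a $K$-vector space and composition is $K$-bilinear; a functor between $K$-linear categories is $K$-linear if it is $K$-linear on each Hom space. Tensor products are over $K$. A left $\mathcal{C}$-module is a $K$-linear functor $M:\mathcal{C}\to K\text{-}\mathrm{Mod}$; morphisms of left $\mathcal{C}$-modules are natural transformations. The category of left $\mathcal{C}$-modules is abelian. Bimodules: $\mathcal{C}\boxtimes_K\mathcal{C}^{op}$ is the $K$-linear category whose objects are pairs $(x,y)\in\mathcal{C}_0\times\mathcal{C}_0$, with morphisms from $(x,y)$ to $(x',y')$ given by $\mathcal{C}(x,x')\otimes\mathcal{C}(y',y)$ and the evident composition. A $\mathcal{C}$-bimodule is a $K$-linear functor $M:\mathcal{C}\boxtimes_K\mathcal{C}^{op}\to K\text{-}\mathrm{Mod}$, with value ${}_xM_y$ at $(x,y)$; morphisms are natural transformations. The category of $\mathcal{C}$-bimodules is abelian with enough projectives and injectives. $\mathcal{C}$ itself is a bimodule by ${}_x\mathcal{C}_y=\mathcal{C}(y,x)$, with actions given by composition. Hochschild-Mitchell cohomology: $H^{n}(\mathcal{C},M):=\mathrm{Ext}^{n}_{\mathcal{C}-\mathcal{C}}(\mathcal{C},M)$,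 with $\mathrm{Ext}$ computed in the category of $\mathcal{C}$-bimodules. $\mathcal{C}$ is called separable if $H^{1}(\mathcal{C},M)=0$ for every $\mathcal{C}$-bimodule $M$. *)

theory Defs
  imports "HOL-Algebra.Module" "HOL-Algebra.AbelCoset" "HOL-Algebra.Elementary_Groups" "HOL-Library.Equipollence"
begin

section \<open>Linear maps and tensor products\<close>

text \<open>
  A \<open>K\<close>-vector space is a module, in the sense of the locale \<^locale>\<open>module\<close>, over a field \<open>K\<close>.
  The fields \<open>mult\<close> and \<open>one\<close>, which the record type of modules inherits from rings, play no role.
\<close>

definition linear_maps ::
  "('k, 'r) ring_scheme \<Rightarrow> ('k, 'a) module \<Rightarrow> ('k, 'b) module \<Rightarrow> ('a \<Rightarrow> 'b) set" where
  "linear_maps K V W = {f \<in> carrier V \<rightarrow> carrier W.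
     (\<forall>v\<in>carrier V. \<forall>v'\<in>carrier V. f (v \<oplus>\<^bsub>V\<^esub> v') = f v \<oplus>\<^bsub>W\<^esub> f v') \<and>
     (\<forall>a\<in>carrier K. \<forall>v\<in>carrier V. f (a \<odot>\<^bsub>V\<^esub> v) = a \<odot>\<^bsub>W\<^esub> f v)}"

definition free_module :: "('k, 'r) ring_scheme \<Rightarrow> 's set \<Rightarrow> ('k, 's \<Rightarrow> 'k) module" where
  "free_module K S =
    \<lparr>carrier = {\<phi>. (\<forall>s\<in>S. \<phi> s \<in> carrier K) \<and> (\<forall>s. s \<notin> S \<longrightarrow> \<phi> s = \<zero>\<^bsub>K\<^esub>) \<and> finite {s. \<phi> s \<noteq> \<zero>\<^bsub>K\<^esub>}},
     monoid.mult = undefined, one = undefined,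
     ring.zero = (\<lambda>s. \<zero>\<^bsub>K\<^esub>),
     ring.add = (\<lambda>\<phi> \<psi> s. \<phi> s \<oplus>\<^bsub>K\<^esub> \<psi> s),
     module.smult = (\<lambda>a \<phi> s. a \<otimes>\<^bsub>K\<^esub> \<phi> s)\<rparr>"

definition basis_vector :: "('k, 'r) ring_scheme \<Rightarrow> 's \<Rightarrow> 's \<Rightarrow> 'k" where
  "basis_vector K s = (\<lambda>t. if t = s then \<one>\<^bsub>K\<^esub> else \<zero>\<^bsub>K\<^esub>)"

definition submodule_span ::
  "('k, 'r) ring_scheme \<Rightarrow> ('k, 'a) module \<Rightarrow> 'a set \<Rightarrow> 'a set" where
  "submodule_span K V S = \<Inter>{H. submodule H K V \<and> S \<subseteq> H}"

definition quotient_module ::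
  "('k, 'r) ring_scheme \<Rightarrow> ('k, 'a) module \<Rightarrow> 'a set \<Rightarrow> ('k, 'a set) module" where
  "quotient_module K V H =
    \<lparr>carrier = a_rcosets\<^bsub>V\<^esub> H,
     monoid.mult = undefined, one = undefined,
     ring.zero = H,
     ring.add = (\<lambda>X Y. X <+>\<^bsub>V\<^esub> Y),
     module.smult = (\<lambda>a X. \<Union>x\<in>X. H +>\<^bsub>V\<^esub> (a \<odot>\<^bsub>V\<^esub> x))\<rparr>"

text \<open>The tensor product is the quotient of the free module on pairs by the bilinearity relations.\<close>

definition tensor_relators ::
  "('k, 'r) ring_scheme \<Rightarrow> ('k, 'a) module \<Rightarrow> ('k, 'b) module \<Rightarrow> ('a \<times> 'b \<Rightarrow> 'k) set" where
  "tensor_relators K V W =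
    (let F = free_module K (carrier V \<times> carrier W); b = (\<lambda>v w. basis_vector K (v, w)) in
      {b (v \<oplus>\<^bsub>V\<^esub> v') w \<ominus>\<^bsub>F\<^esub> (b v w \<oplus>\<^bsub>F\<^esub> b v' w) | v v' w.
         v \<in> carrier V \<and> v' \<in> carrier V \<and> w \<in> carrier W} \<union>
      {b v (w \<oplus>\<^bsub>W\<^esub> w') \<ominus>\<^bsub>F\<^esub> (b v w \<oplus>\<^bsub>F\<^esub> b v w') | v w w'.
         v \<in> carrier V \<and> w \<in> carrier W \<and> w' \<in> carrier W} \<union>
      {b (a \<odot>\<^bsub>V\<^esub> v) w \<ominus>\<^bsub>F\<^esub> (a \<odot>\<^bsub>F\<^esub> b v w) | a v w.
         a \<in> carrier K \<and> v \<in> carrier V \<and> w \<in> carrier W} \<union>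
      {b v (a \<odot>\<^bsub>W\<^esub> w) \<ominus>\<^bsub>F\<^esub> (a \<odot>\<^bsub>F\<^esub> b v w) | a v w.
         a \<in> carrier K \<and> v \<in> carrier V \<and> w \<in> carrier W})"

definition tensor_kernel ::
  "('k, 'r) ring_scheme \<Rightarrow> ('k, 'a) module \<Rightarrow> ('k, 'b) module \<Rightarrow> ('a \<times> 'b \<Rightarrow> 'k) set" where
  "tensor_kernel K V W =
    submodule_span K (free_module K (carrier V \<times> carrier W)) (tensor_relators K V W)"

definition tensor_product ::
  "('k, 'r) ring_scheme \<Rightarrow> ('k, 'a) module \<Rightarrow> ('k, 'b) module \<Rightarrow> ('k, ('a \<times> 'b \<Rightarrow> 'k) set) module" where
  "tensor_product K V W =
    quotient_module K (free_module K (carrier V \<times> carrier W)) (tensor_kernel K V W)"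

definition pure_tensor ::
  "('k, 'r) ring_scheme \<Rightarrow> ('k, 'a) module \<Rightarrow> ('k, 'b) module \<Rightarrow> 'a \<Rightarrow> 'b \<Rightarrow> ('a \<times> 'b \<Rightarrow> 'k) set" where
  "pure_tensor K V W v w =
    tensor_kernel K V W +>\<^bsub>free_module K (carrier V \<times> carrier W)\<^esub> basis_vector K (v, w)"

text \<open>
  The linear map \<open>V \<otimes> W \<rightarrow> U\<close> induced by a bilinear map \<open>\<beta>\<close>, that is, the one sending each
  pure tensor \<open>v \<otimes> w\<close> to \<open>\<beta> v w\<close>. When \<open>\<beta>\<close> is bilinear, the value at a coset \<open>t\<close> does not depend
  on the chosen representative.
\<close>

definition tensor_lift ::
  "('k, 'r) ring_scheme \<Rightarrow> ('k, 'c) module \<Rightarrow> ('a \<Rightarrow> 'b \<Rightarrow> 'c) \<Rightarrow> ('a \<times> 'b \<Rightarrow> 'k) set \<Rightarrow> 'c" where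
  "tensor_lift K U \<beta> t =
    (let \<phi> = (SOME \<phi>. \<phi> \<in> t) in
      (\<Oplus>\<^bsub>U\<^esub>p\<in>{p. \<phi> p \<noteq> \<zero>\<^bsub>K\<^esub>}. \<phi> p \<odot>\<^bsub>U\<^esub> \<beta> (fst p) (snd p)))"


section \<open>Linear categories\<close>

text \<open>
  \<open>Comp C x y z g f\<close> is the composite of \<open>f : x \<rightarrow> y\<close> and \<open>g : y \<rightarrow> z\<close>. Hom spaces of different pairs
  of objects need not be disjoint, so composition takes the objects as arguments.
\<close>

record ('o, 'k, 'a) lincat =
  Obj :: "'o set"
  Hom :: "'o \<Rightarrow> 'o \<Rightarrow> ('k, 'a) module"
  Id :: "'o \<Rightarrow> 'a"
  Comp :: "'o \<Rightarrow> 'o \<Rightarrow> 'o \<Rightarrow> 'a \<Rightarrow> 'a \<Rightarrow> 'a"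

locale linear_category =
  fixes K :: "('k, 'r) ring_scheme" and C :: "('o, 'k, 'a) lincat"
  assumes Hom_module: "\<lbrakk>x \<in> Obj C; y \<in> Obj C\<rbrakk> \<Longrightarrow> module K (Hom C x y)"
    and Id_closed: "x \<in> Obj C \<Longrightarrow> Id C x \<in> carrier (Hom C x x)"
    and Comp_linear_left:
      "\<lbrakk>x \<in> Obj C; y \<in> Obj C; z \<in> Obj C; f \<in> carrier (Hom C x y)\<rbrakk> \<Longrightarrow>
       (\<lambda>g. Comp C x y z g f) \<in> linear_maps K (Hom C y z) (Hom C x z)"
    and Comp_linear_right:
      "\<lbrakk>x \<in> Obj C; y \<in> Obj C; z \<in> Obj C; g \<in> carrier (Hom C y z)\<rbrakk> \<Longrightarrow>
       (\<lambda>f. Comp C x y z g f) \<in> linear_maps K (Hom C x y) (Hom C x z)"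
    and Comp_Id_left:
      "\<lbrakk>x \<in> Obj C; y \<in> Obj C; f \<in> carrier (Hom C x y)\<rbrakk> \<Longrightarrow> Comp C x y y (Id C y) f = f"
    and Comp_Id_right:
      "\<lbrakk>x \<in> Obj C; y \<in> Obj C; f \<in> carrier (Hom C x y)\<rbrakk> \<Longrightarrow> Comp C x x y f (Id C x) = f"
    and Comp_assoc:
      "\<lbrakk>w \<in> Obj C; x \<in> Obj C; y \<in> Obj C; z \<in> Obj C;
        f \<in> carrier (Hom C w x); g \<in> carrier (Hom C x y); h \<in> carrier (Hom C y z)\<rbrakk> \<Longrightarrow>
       Comp C w x z (Comp C x y z h g) f = Comp C w y z h (Comp C w x y g f)"

definition opposite :: "('o, 'k, 'a) lincat \<Rightarrow> ('o, 'k, 'a) lincat" where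
  "opposite C =
    \<lparr>Obj = Obj C,
     Hom = (\<lambda>x y. Hom C y x),
     Id = Id C,
     Comp = (\<lambda>x y z g f. Comp C z y x f g)\<rparr>"

text \<open>Composition is determined by \<open>(g \<otimes> g') \<circ> (f \<otimes> f') = (g \<circ> f) \<otimes> (g' \<circ> f')\<close> and bilinearity.\<close>

definition tensor_category ::
  "('k, 'r) ring_scheme \<Rightarrow> ('o, 'k, 'a) lincat \<Rightarrow> ('p, 'k, 'b) lincat
    \<Rightarrow> ('o \<times> 'p, 'k, ('a \<times> 'b \<Rightarrow> 'k) set) lincat" where
  "tensor_category K C D =
    (let H = (\<lambda>(x, x') (y, y'). tensor_product K (Hom C x y) (Hom D x' y')) in
    \<lparr>Obj = Obj C \<times> Obj D,
     Hom = H,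
     Id = (\<lambda>(x, x'). pure_tensor K (Hom C x x) (Hom D x' x') (Id C x) (Id D x')),
     Comp = (\<lambda>(x, x') (y, y') (z, z') s t.
       tensor_lift K (H (x, x') (z, z'))
         (\<lambda>g g'. tensor_lift K (H (x, x') (z, z'))
           (\<lambda>f f'. pure_tensor K (Hom C x z) (Hom D x' z')
              (Comp C x y z g f) (Comp D x' y' z' g' f')) t) s)\<rparr>)"

record ('o, 'p, 'a, 'b) cfunctor =
  fobj :: "'o \<Rightarrow> 'p"
  farr :: "'o \<Rightarrow> 'o \<Rightarrow> 'a \<Rightarrow> 'b"

locale linear_functor =
  fixes K :: "('k, 'r) ring_scheme" and C :: "('o, 'k, 'a) lincat" and D :: "('p, 'k, 'b) lincat"
    and F :: "('o, 'p, 'a, 'b) cfunctor"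
  assumes fobj_closed: "x \<in> Obj C \<Longrightarrow> fobj F x \<in> Obj D"
    and farr_linear:
      "\<lbrakk>x \<in> Obj C; y \<in> Obj C\<rbrakk> \<Longrightarrow>
       farr F x y \<in> linear_maps K (Hom C x y) (Hom D (fobj F x) (fobj F y))"
    and farr_Id: "x \<in> Obj C \<Longrightarrow> farr F x x (Id C x) = Id D (fobj F x)"
    and farr_Comp:
      "\<lbrakk>x \<in> Obj C; y \<in> Obj C; z \<in> Obj C; f \<in> carrier (Hom C x y); g \<in> carrier (Hom C y z)\<rbrakk> \<Longrightarrow>
       farr F x z (Comp C x y z g f) =
         Comp D (fobj F x) (fobj F y) (fobj F z) (farr F y z g) (farr F x y f)"

definition natural_transformations ::
  "('o, 'k, 'a) lincat \<Rightarrow> ('p, 'k, 'b) lincat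
    \<Rightarrow> ('o, 'p, 'a, 'b) cfunctor \<Rightarrow> ('o, 'p, 'a, 'b) cfunctor \<Rightarrow> ('o \<Rightarrow> 'b) set" where
  "natural_transformations C D F G =
    {\<eta> \<in> (\<Pi>\<^sub>E x\<in>Obj C. carrier (Hom D (fobj F x) (fobj G x))).
      \<forall>x\<in>Obj C. \<forall>y\<in>Obj C. \<forall>f\<in>carrier (Hom C x y).
        Comp D (fobj F x) (fobj F y) (fobj G y) (\<eta> y) (farr F x y f) =
        Comp D (fobj F x) (fobj G x) (fobj G y) (farr G x y f) (\<eta> x)}"

definition functor_category ::
  "('k, 'r) ring_scheme \<Rightarrow> ('o, 'k, 'a) lincat \<Rightarrow> ('p, 'k, 'b) lincat
    \<Rightarrow> (('o, 'p, 'a, 'b) cfunctor, 'k, 'o \<Rightarrow> 'b) lincat" where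
  "functor_category K C D =
    \<lparr>Obj = {F. linear_functor K C D F},
     Hom = (\<lambda>F G.
       \<lparr>carrier = natural_transformations C D F G,
        monoid.mult = undefined, one = undefined,
        ring.zero = (\<lambda>x\<in>Obj C. \<zero>\<^bsub>Hom D (fobj F x) (fobj G x)\<^esub>),
        ring.add = (\<lambda>\<eta> \<theta>. \<lambda>x\<in>Obj C. \<eta> x \<oplus>\<^bsub>Hom D (fobj F x) (fobj G x)\<^esub> \<theta> x),
        module.smult = (\<lambda>a \<eta>. \<lambda>x\<in>Obj C. a \<odot>\<^bsub>Hom D (fobj F x) (fobj G x)\<^esub> \<eta> x)\<rparr>),
     Id = (\<lambda>F. \<lambda>x\<in>Obj C. Id D (fobj F x)),
     Comp = (\<lambda>F G H \<theta> \<eta>. \<lambda>x\<in>Obj C. Comp D (fobj F x) (fobj G x) (fobj H x) (\<theta> x) (\<eta> x))\<rparr>"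

text \<open>
  The category of all \<open>K\<close>-vector spaces whose elements are drawn from the type \<open>'u\<close>, which plays the
  role of the universe of sets. Linear maps are made extensional so that equality of morphisms is
  equality in HOL.
\<close>

definition vect :: "('k, 'r) ring_scheme \<Rightarrow> (('k, 'u) module, 'k, 'u \<Rightarrow> 'u) lincat" where
  "vect K =
    \<lparr>Obj = {V. module K V},
     Hom = (\<lambda>V W.
       \<lparr>carrier = linear_maps K V W \<inter> extensional (carrier V),
        monoid.mult = undefined, one = undefined,
        ring.zero = (\<lambda>v\<in>carrier V. \<zero>\<^bsub>W\<^esub>),
        ring.add = (\<lambda>f g. \<lambda>v\<in>carrier V. f v \<oplus>\<^bsub>W\<^esub> g v),
        module.smult = (\<lambda>a f. \<lambda>v\<in>carrier V. a \<odot>\<^bsub>W\<^esub> f v)\<rparr>),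
     Id = (\<lambda>V. \<lambda>v\<in>carrier V. v),
     Comp = (\<lambda>U V W g f. compose (carrier U) g f)\<rparr>"

text \<open>
  Smallness with respect to the universe \<open>'u\<close>: the Hom spaces have their elements in \<open>'u\<close> by typing,
  so what remains is that \<open>'u\<close> is infinite and the objects form a set no larger than \<open>'u\<close>.
\<close>

definition small_category :: "('o, 'k, 'u) lincat \<Rightarrow> bool" where
  "small_category C \<longleftrightarrow> infinite (UNIV :: 'u set) \<and> Obj C \<lesssim> (UNIV :: 'u set)"


section \<open>Modules and bimodules\<close>

type_synonym ('o, 'k, 'a, 'v) left_module = "('o, ('k, 'v) module, 'a, 'v \<Rightarrow> 'v) cfunctor"

definition left_modules ::
  "('k, 'r) ring_scheme \<Rightarrow> ('o, 'k, 'a) lincat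
    \<Rightarrow> (('o, 'k, 'a, 'v) left_module, 'k, 'o \<Rightarrow> 'v \<Rightarrow> 'v) lincat" where
  "left_modules K C = functor_category K C (vect K)"

definition enveloping_category ::
  "('k, 'r) ring_scheme \<Rightarrow> ('o, 'k, 'a) lincat \<Rightarrow> ('o \<times> 'o, 'k, ('a \<times> 'a \<Rightarrow> 'k) set) lincat" where
  "enveloping_category K C = tensor_category K C (opposite C)"

type_synonym ('o, 'k, 'a, 'v) bimodule =
  "('o \<times> 'o, 'k, ('a \<times> 'a \<Rightarrow> 'k) set, 'v) left_module"

definition bimodules ::
  "('k, 'r) ring_scheme \<Rightarrow> ('o, 'k, 'a) lincat
    \<Rightarrow> (('o, 'k, 'a, 'v) bimodule, 'k, 'o \<times> 'o \<Rightarrow> 'v \<Rightarrow> 'v) lincat" where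
  "bimodules K C = left_modules K (enveloping_category K C)"

text \<open>The value at \<open>(x, y)\<close> is \<open>C(y, x)\<close>, and \<open>f \<otimes> g\<close> acts by \<open>h \<mapsto> f \<circ> h \<circ> g\<close>.\<close>

definition regular_bimodule ::
  "('k, 'r) ring_scheme \<Rightarrow> ('o, 'k, 'u) lincat \<Rightarrow> ('o, 'k, 'u, 'u) bimodule" where
  "regular_bimodule K C =
    \<lparr>fobj = (\<lambda>(x, y). Hom C y x),
     farr = (\<lambda>(x, y) (x', y') t. \<lambda>h\<in>carrier (Hom C y x).
       tensor_lift K (Hom C y' x') (\<lambda>f g. Comp C y' x x' f (Comp C y' y x h g)) t)\<rparr>"


section \<open>Projective objects and Ext\<close>

definition epimorphism :: "('o, 'k, 'a) lincat \<Rightarrow> 'o \<Rightarrow> 'o \<Rightarrow> 'a \<Rightarrow> bool" where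
  "epimorphism A x y e \<longleftrightarrow> e \<in> carrier (Hom A x y) \<and>
    (\<forall>z\<in>Obj A. \<forall>g\<in>carrier (Hom A y z). \<forall>h\<in>carrier (Hom A y z).
      Comp A x y z g e = Comp A x y z h e \<longrightarrow> g = h)"

definition projective_object :: "('o, 'k, 'a) lincat \<Rightarrow> 'o \<Rightarrow> bool" where
  "projective_object A p \<longleftrightarrow> p \<in> Obj A \<and>
    (\<forall>x\<in>Obj A. \<forall>y\<in>Obj A. \<forall>e. epimorphism A x y e \<longrightarrow>
      (\<forall>f\<in>carrier (Hom A p y). \<exists>g\<in>carrier (Hom A p x). Comp A p x y e g = f))"

text \<open>
  A projective resolution
  \<open>\<dots> \<rightarrow> P 2 \<rightarrow> P 1 \<rightarrow> P 0 \<rightarrow> X \<rightarrow> 0\<close> with \<open>d n : P (n + 1) \<rightarrow> P n\<close> and augmentation \<open>\<epsilon> : P 0 \<rightarrow> X\<close>.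
  Exactness in a category of modules is exactness at every object.
\<close>

definition projective_resolution ::
  "('k, 'r) ring_scheme \<Rightarrow> ('o, 'k, 'a) lincat \<Rightarrow> ('o, 'k, 'a, 'v) left_module
    \<Rightarrow> (nat \<Rightarrow> ('o, 'k, 'a, 'v) left_module) \<Rightarrow> (nat \<Rightarrow> 'o \<Rightarrow> 'v \<Rightarrow> 'v) \<Rightarrow> ('o \<Rightarrow> 'v \<Rightarrow> 'v) \<Rightarrow> bool" where
  "projective_resolution K C X P d \<epsilon> \<longleftrightarrow>
    (\<forall>n. projective_object (left_modules K C) (P n)) \<and>
    (\<forall>n. d n \<in> carrier (Hom (left_modules K C) (P (Suc n)) (P n))) \<and>
    \<epsilon> \<in> carrier (Hom (left_modules K C) (P 0) X) \<and>
    (\<forall>x\<in>Obj C.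
      \<epsilon> x ` carrier (fobj (P 0) x) = carrier (fobj X x) \<and>
      d 0 x ` carrier (fobj (P 1) x) =
        {v \<in> carrier (fobj (P 0) x). \<epsilon> x v = \<zero>\<^bsub>fobj X x\<^esub>} \<and>
      (\<forall>n. d (Suc n) x ` carrier (fobj (P (Suc (Suc n))) x) =
        {v \<in> carrier (fobj (P (Suc n)) x). d n x v = \<zero>\<^bsub>fobj (P n) x\<^esub>}))"

text \<open>Cocycles and coboundaries of the complex \<open>Hom (P n, Y)\<close> in a category \<open>A\<close>.\<close>

definition Hom_cocycles ::
  "('o, 'k, 'a) lincat \<Rightarrow> (nat \<Rightarrow> 'o) \<Rightarrow> (nat \<Rightarrow> 'a) \<Rightarrow> 'o \<Rightarrow> nat \<Rightarrow> 'a set" where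
  "Hom_cocycles A P d Y n =
    {\<eta> \<in> carrier (Hom A (P n) Y). Comp A (P (Suc n)) (P n) Y \<eta> (d n) = \<zero>\<^bsub>Hom A (P (Suc n)) Y\<^esub>}"

definition Hom_coboundaries ::
  "('o, 'k, 'a) lincat \<Rightarrow> (nat \<Rightarrow> 'o) \<Rightarrow> (nat \<Rightarrow> 'a) \<Rightarrow> 'o \<Rightarrow> nat \<Rightarrow> 'a set" where
  "Hom_coboundaries A P d Y n =
    (case n of
      0 \<Rightarrow> {\<zero>\<^bsub>Hom A (P 0) Y\<^esub>}
    | Suc m \<Rightarrow> (\<lambda>\<theta>. Comp A (P (Suc m)) (P m) Y \<theta> (d m)) ` carrier (Hom A (P m) Y))"

text \<open>
  The cohomology of \<open>Hom (P n, Y)\<close> for a chosen projective resolution \<open>P\<close> of \<open>X\<close>. The choice is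
  harmless up to isomorphism as soon as a resolution exists within the universe \<open>'v\<close>, which is the
  case for bimodules over a small category (cf. \<^const>\<open>small_category\<close>).
\<close>

definition Ext ::
  "('k, 'r) ring_scheme \<Rightarrow> ('o, 'k, 'a) lincat \<Rightarrow> nat
    \<Rightarrow> ('o, 'k, 'a, 'v) left_module \<Rightarrow> ('o, 'k, 'a, 'v) left_module \<Rightarrow> ('o \<Rightarrow> 'v \<Rightarrow> 'v) set monoid" where
  "Ext K C n X Y =
    (let A = left_modules K C;
         (P, d) = (SOME (P, d). \<exists>\<epsilon>. projective_resolution K C X P d \<epsilon>)
     in (Hom A (P n) Y)\<lparr>carrier := Hom_cocycles A P d Y n\<rparr> A_Mod Hom_coboundaries A P d Y n)"

text \<open>
  The universe of the bimodules is the type \<open>'u\<close> in which the Hom spaces of \<open>C\<close> live, so that \<open>C\<close>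
  is itself one of them.
\<close>

definition Hochschild_Mitchell ::
  "('k, 'r) ring_scheme \<Rightarrow> ('o, 'k, 'u) lincat \<Rightarrow> nat \<Rightarrow> ('o, 'k, 'u, 'u) bimodule
    \<Rightarrow> ('o \<times> 'o \<Rightarrow> 'u \<Rightarrow> 'u) set monoid" where
  "Hochschild_Mitchell K C n M = Ext K (enveloping_category K C) n (regular_bimodule K C) M"

definition separable_category :: "('k, 'r) ring_scheme \<Rightarrow> ('o, 'k, 'u) lincat \<Rightarrow> bool" where
  "separable_category K C \<longleftrightarrow>
    (\<forall>M\<in>Obj (bimodules K C). trivial_group (Hochschild_Mitchell K C 1 M))"

end

theory Submission
  imports Defs
begin

text \<open>
  Applying separability to the kernel of the augmentation \<open>P 0 \<rightarrow> C\<close> of a projective resolution splits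
  this augmentation: \<open>d 0\<close> is a cocycle with values in the kernel, and a cochain of which it is the
  coboundary is a retraction. So the bimodule \<open>C\<close> is a retract of a free bimodule.

  Given an epimorphism \<open>e : N \<rightarrow> L\<close> and a map \<open>f : M \<rightarrow> L\<close> of left modules, \<open>c \<mapsto> f \<circ> M c\<close> is a map of
  bimodules from \<open>C\<close> to \<open>Hom K (M, L)\<close>. Over a field, composition with \<open>e\<close> is a surjection from
  \<open>Hom K (M, N)\<close> onto \<open>Hom K (M, L)\<close>, so the map lifts to \<open>Hom K (M, N)\<close>; the images of the identities
  are the components of a lift of \<open>f\<close>. As these bimodules lie outside the universe of the Ext groups,
  the lift is made along the free bimodule, which has the lifting property in every universe.
\<close>

section \<open>Modules and linear maps\<close>

text \<open>The classical argument tensors a splitting of bimodules with \<open>M\<close>,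
  exhibiting \<open>M\<close> as a retract of a free left module. Maps into
  \<open>Hom K (M, N)\<close> use the same splitting through the adjunction between tensoring with
  \<open>M\<close> and \<open>Hom K (M, -)\<close>, so bimodules never have to be tensored with
  modules. Size shapes the rest. \<open>Ext\<close> evaluates a resolution picked by
  \<open>SOME\<close>, so separability yields nothing usable until a resolution with all its
  elements in \<open>'u\<close> is shown to exist; free bimodules, which are functions with cosets
  as values, have to be counted and copied into \<open>'u\<close>. The resolution picked stays
  unknown, hence the splitting is proved for every bimodule mapping onto \<open>C\<close>, and only
  then taken for a free one. \<open>M\<close> has its elements in an unrelated type
  \<open>'v\<close>. Projectivity speaks of categorical epimorphisms there; turning one into a
  surjection requires a cokernel with elements again in \<open>'v\<close>, and linear complements
  over the field \<open>K\<close> provide it. The same complements make \<open>Hom K (M, -)\<close>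
  preserve surjections.\<close>

lemma linear_mapsI:
  assumes "\<And>v. v \<in> carrier V \<Longrightarrow> f v \<in> carrier W"
    and "\<And>v v'. v \<in> carrier V \<Longrightarrow> v' \<in> carrier V \<Longrightarrow> f (v \<oplus>\<^bsub>V\<^esub> v') = f v \<oplus>\<^bsub>W\<^esub> f v'"
    and "\<And>a v. a \<in> carrier K \<Longrightarrow> v \<in> carrier V \<Longrightarrow> f (a \<odot>\<^bsub>V\<^esub> v) = a \<odot>\<^bsub>W\<^esub> f v"
  shows "f \<in> linear_maps K V W"
  using assms by (auto simp: linear_maps_def)

lemma linear_maps_closed: "f \<in> linear_maps K V W \<Longrightarrow> v \<in> carrier V \<Longrightarrow> f v \<in> carrier W"
  by (auto simp: linear_maps_def)

lemma linear_maps_add: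
  "f \<in> linear_maps K V W \<Longrightarrow> v \<in> carrier V \<Longrightarrow> v' \<in> carrier V \<Longrightarrow>
    f (v \<oplus>\<^bsub>V\<^esub> v') = f v \<oplus>\<^bsub>W\<^esub> f v'"
  by (auto simp: linear_maps_def)

lemma linear_maps_smult:
  "f \<in> linear_maps K V W \<Longrightarrow> a \<in> carrier K \<Longrightarrow> v \<in> carrier V \<Longrightarrow>
    f (a \<odot>\<^bsub>V\<^esub> v) = a \<odot>\<^bsub>W\<^esub> f v"
  by (auto simp: linear_maps_def)

lemma module_add_closed:
  "module K V \<Longrightarrow> v \<in> carrier V \<Longrightarrow> w \<in> carrier V \<Longrightarrow> v \<oplus>\<^bsub>V\<^esub> w \<in> carrier V"
  by (meson abelian_group_def abelian_monoid.a_closed module_def)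

lemma module_zero_closed: "module K V \<Longrightarrow> \<zero>\<^bsub>V\<^esub> \<in> carrier V"
  by (meson abelian_group_def abelian_monoid.zero_closed module_def)

lemma module_diff_closed:
  "module K V \<Longrightarrow> v \<in> carrier V \<Longrightarrow> w \<in> carrier V \<Longrightarrow> v \<ominus>\<^bsub>V\<^esub> w \<in> carrier V"
  by (meson abelian_group.minus_closed module_def)

lemma module_abelian_group: "module K V \<Longrightarrow> abelian_group V"
  by (simp add: module_def)

lemma module_abelian_monoid: "module K V \<Longrightarrow> abelian_monoid V"
  by (simp add: module_def abelian_group_def)

lemma module_cring: "module K V \<Longrightarrow> cring K"
  by (simp add: module_def)

lemma linear_maps_zero:
  assumes "module K V" "module K W" "f \<in> linear_maps K V W"
  shows "f \<zero>\<^bsub>V\<^esub> = \<zero>\<^bsub>W\<^esub>"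
proof -
  interpret V: module K V by fact
  interpret W: module K W by fact
  have "f (\<zero>\<^bsub>K\<^esub> \<odot>\<^bsub>V\<^esub> \<zero>\<^bsub>V\<^esub>) = \<zero>\<^bsub>K\<^esub> \<odot>\<^bsub>W\<^esub> f \<zero>\<^bsub>V\<^esub>"
    using assms(3) by (rule linear_maps_smult) auto
  then show ?thesis
    using linear_maps_closed[OF assms(3)] by simp
qed

lemma linear_maps_diff:
  assumes "module K V" "module K W" "f \<in> linear_maps K V W" "v \<in> carrier V" "w \<in> carrier V"
  shows "f (v \<ominus>\<^bsub>V\<^esub> w) = f v \<ominus>\<^bsub>W\<^esub> f w"
proof -
  interpret V: module K V by fact
  interpret W: module K W by fact
  have "\<ominus>\<^bsub>V\<^esub> w = (\<ominus>\<^bsub>K\<^esub> \<one>\<^bsub>K\<^esub>) \<odot>\<^bsub>V\<^esub> w"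
    using assms(5) by (simp add: V.smult_l_minus)
  then have "f (\<ominus>\<^bsub>V\<^esub> w) = (\<ominus>\<^bsub>K\<^esub> \<one>\<^bsub>K\<^esub>) \<odot>\<^bsub>W\<^esub> f w"
    using assms(5) by (simp add: linear_maps_smult[OF assms(3)])
  also have "\<dots> = \<ominus>\<^bsub>W\<^esub> f w"
    using linear_maps_closed[OF assms(3,5)] by (simp add: W.smult_l_minus)
  finally show ?thesis
    using assms by (simp add: V.M.minus_eq W.M.minus_eq linear_maps_add[OF assms(3)])
qed

lemma module_diff_eq_zero:
  assumes "module K V" "v \<in> carrier V" "w \<in> carrier V"
  shows "v \<ominus>\<^bsub>V\<^esub> w = \<zero>\<^bsub>V\<^esub> \<longleftrightarrow> v = w"
proof -
  interpret V: module K V by fact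
  show ?thesis using assms
    by (metis V.M.add.inv_closed V.M.minus_equality V.M.minus_eq V.M.minus_minus V.M.r_neg)
qed

lemma module_diff_add:
  assumes "module K V" "v \<in> carrier V" "w \<in> carrier V"
  shows "(v \<ominus>\<^bsub>V\<^esub> w) \<oplus>\<^bsub>V\<^esub> w = v"
proof -
  interpret V: module K V by fact
  show ?thesis using assms by (simp add: V.M.minus_eq V.M.a_assoc V.M.l_neg)
qed

lemma module_smult_closed:
  "module K V \<Longrightarrow> a \<in> carrier K \<Longrightarrow> v \<in> carrier V \<Longrightarrow> a \<odot>\<^bsub>V\<^esub> v \<in> carrier V"
  by (rule module.smult_closed)

lemma linear_maps_comp:
  assumes "f \<in> linear_maps K U V" "g \<in> linear_maps K V W"
  shows "(\<lambda>u. g (f u)) \<in> linear_maps K U W"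
  using assms by (auto simp: linear_maps_def Pi_def)

lemma linear_maps_cong:
  assumes "module K V" "f \<in> linear_maps K V W" "\<And>v. v \<in> carrier V \<Longrightarrow> g v = f v"
  shows "g \<in> linear_maps K V W"
  using assms by (intro linear_mapsI)
    (auto simp: linear_maps_closed linear_maps_add linear_maps_smult module_add_closed module_smult_closed)

lemma linear_maps_restrict:
  "module K V \<Longrightarrow> f \<in> linear_maps K V W \<Longrightarrow> restrict f (carrier V) \<in> linear_maps K V W"
  by (erule linear_maps_cong) auto

lemma linear_maps_plus:
  assumes "module K W" "f \<in> linear_maps K V W" "g \<in> linear_maps K V W"
  shows "(\<lambda>v. f v \<oplus>\<^bsub>W\<^esub> g v) \<in> linear_maps K V W"
proof -
  interpret W: module K W by fact
  show ?thesis
    using linear_maps_closed[OF assms(2)] linear_maps_closed[OF assms(3)]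
    by (intro linear_mapsI) (auto simp: linear_maps_add[OF assms(2)] linear_maps_add[OF assms(3)]
      linear_maps_smult[OF assms(2)] linear_maps_smult[OF assms(3)] W.smult_r_distr W.M.add.m_ac)
qed

lemma linear_maps_diff_fun:
  assumes "module K W" "f \<in> linear_maps K V W" "g \<in> linear_maps K V W"
  shows "(\<lambda>v. f v \<ominus>\<^bsub>W\<^esub> g v) \<in> linear_maps K V W"
proof -
  interpret W: module K W by fact
  show ?thesis
    using linear_maps_closed[OF assms(2)] linear_maps_closed[OF assms(3)]
    by (intro linear_mapsI) (auto simp: linear_maps_add[OF assms(2)] linear_maps_add[OF assms(3)]
      linear_maps_smult[OF assms(2)] linear_maps_smult[OF assms(3)] W.smult_r_distr W.M.minus_eq
      W.smult_r_minus W.M.minus_add W.M.add.m_ac)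
qed

lemma linear_maps_scale:
  assumes "module K W" "f \<in> linear_maps K V W" "a \<in> carrier K"
  shows "(\<lambda>v. a \<odot>\<^bsub>W\<^esub> f v) \<in> linear_maps K V W"
proof -
  interpret W: module K W by fact
  show ?thesis
    using linear_maps_closed[OF assms(2)] assms(3)
    by (intro linear_mapsI) (auto simp: linear_maps_add[OF assms(2)]
      linear_maps_smult[OF assms(2)] W.smult_r_distr W.smult_assoc1[symmetric] W.R.m_comm)
qed

text \<open>The equation \<open>0 x = 0\<close> among the hypotheses stands in for additive
  inverses: by distributivity \<open>(-1) x + x = 0 x = 0\<close>. A concrete module can then be
  checked without naming its negation.\<close>

lemma module_if_smult_zero:
  fixes K (structure) and V (structure)
  assumes "cring K"
    and "\<And>x y. x \<in> carrier V \<Longrightarrow> y \<in> carrier V \<Longrightarrow> x \<oplus>\<^bsub>V\<^esub> y \<in> carrier V"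
    and "\<And>a x. a \<in> carrier K \<Longrightarrow> x \<in> carrier V \<Longrightarrow> a \<odot>\<^bsub>V\<^esub> x \<in> carrier V"
    and "\<zero>\<^bsub>V\<^esub> \<in> carrier V"
    and "\<And>x y z. x \<in> carrier V \<Longrightarrow> y \<in> carrier V \<Longrightarrow> z \<in> carrier V \<Longrightarrow>
      x \<oplus>\<^bsub>V\<^esub> y \<oplus>\<^bsub>V\<^esub> z = x \<oplus>\<^bsub>V\<^esub> (y \<oplus>\<^bsub>V\<^esub> z)"
    and "\<And>x y. x \<in> carrier V \<Longrightarrow> y \<in> carrier V \<Longrightarrow> x \<oplus>\<^bsub>V\<^esub> y = y \<oplus>\<^bsub>V\<^esub> x"
    and "\<And>x. x \<in> carrier V \<Longrightarrow> \<zero>\<^bsub>V\<^esub> \<oplus>\<^bsub>V\<^esub> x = x"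
    and "\<And>a b x. a \<in> carrier K \<Longrightarrow> b \<in> carrier K \<Longrightarrow> x \<in> carrier V \<Longrightarrow>
      (a \<oplus>\<^bsub>K\<^esub> b) \<odot>\<^bsub>V\<^esub> x = a \<odot>\<^bsub>V\<^esub> x \<oplus>\<^bsub>V\<^esub> b \<odot>\<^bsub>V\<^esub> x"
    and "\<And>a x y. a \<in> carrier K \<Longrightarrow> x \<in> carrier V \<Longrightarrow> y \<in> carrier V \<Longrightarrow>
      a \<odot>\<^bsub>V\<^esub> (x \<oplus>\<^bsub>V\<^esub> y) = a \<odot>\<^bsub>V\<^esub> x \<oplus>\<^bsub>V\<^esub> a \<odot>\<^bsub>V\<^esub> y"
    and "\<And>a b x. a \<in> carrier K \<Longrightarrow> b \<in> carrier K \<Longrightarrow> x \<in> carrier V \<Longrightarrow>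
      (a \<otimes>\<^bsub>K\<^esub> b) \<odot>\<^bsub>V\<^esub> x = a \<odot>\<^bsub>V\<^esub> (b \<odot>\<^bsub>V\<^esub> x)"
    and "\<And>x. x \<in> carrier V \<Longrightarrow> \<one>\<^bsub>K\<^esub> \<odot>\<^bsub>V\<^esub> x = x"
    and "\<And>x. x \<in> carrier V \<Longrightarrow> \<zero>\<^bsub>K\<^esub> \<odot>\<^bsub>V\<^esub> x = \<zero>\<^bsub>V\<^esub>"
  shows "module K V"
proof -
  interpret K: cring K by fact
  have "\<exists>y\<in>carrier V. y \<oplus>\<^bsub>V\<^esub> x = \<zero>\<^bsub>V\<^esub>" if x: "x \<in> carrier V" for x
  proof
    show "(\<ominus>\<^bsub>K\<^esub> \<one>\<^bsub>K\<^esub>) \<odot>\<^bsub>V\<^esub> x \<in> carrier V" using x assms(3) by simp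
    have "((\<ominus>\<^bsub>K\<^esub> \<one>\<^bsub>K\<^esub>) \<oplus>\<^bsub>K\<^esub> \<one>\<^bsub>K\<^esub>) \<odot>\<^bsub>V\<^esub> x = (\<ominus>\<^bsub>K\<^esub> \<one>\<^bsub>K\<^esub>) \<odot>\<^bsub>V\<^esub> x \<oplus>\<^bsub>V\<^esub> \<one>\<^bsub>K\<^esub> \<odot>\<^bsub>V\<^esub> x"
      using x by (intro assms(8)) auto
    then show "(\<ominus>\<^bsub>K\<^esub> \<one>\<^bsub>K\<^esub>) \<odot>\<^bsub>V\<^esub> x \<oplus>\<^bsub>V\<^esub> x = \<zero>\<^bsub>V\<^esub>"
      using x assms(11,12) by (simp add: K.l_neg)
  qed
  then have "abelian_group V"
    using assms(2-7) by (intro abelian_groupI) auto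
  then show ?thesis
    using assms by (intro moduleI) auto
qed

text \<open>The axioms to be checked are closure conditions and equations, so they pass from
  \<open>V\<close> to a surjective image. \<open>W\<close> starts as a bare record, hence its zero
  has to be matched by hypothesis. Quotients, copies in another type and the cokernel on a
  complement all get their structure in this way.\<close>

lemma module_image:
  assumes "module K V" "f \<in> linear_maps K V W" "f ` carrier V = carrier W" "\<zero>\<^bsub>W\<^esub> = f \<zero>\<^bsub>V\<^esub>"
  shows "module K W"
proof -
  interpret V: module K V by fact
  have add: "f v \<oplus>\<^bsub>W\<^esub> f v' = f (v \<oplus>\<^bsub>V\<^esub> v')" if "v \<in> carrier V" "v' \<in> carrier V" for v v'
    using that by (simp add: linear_maps_add[OF assms(2)])
  have smult: "a \<odot>\<^bsub>W\<^esub> f v = f (a \<odot>\<^bsub>V\<^esub> v)" if "a \<in> carrier K" "v \<in> carrier V" for a v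
    using that by (simp add: linear_maps_smult[OF assms(2)])
  show ?thesis
    by (rule module_if_smult_zero)
      (auto simp: assms(3)[symmetric] assms(4) add smult V.R.is_cring V.M.add.m_ac
        V.smult_l_distr V.smult_r_distr V.smult_assoc1)
qed

section \<open>Submodules, complements and splittings over a field\<close>

lemma submodule_if_closed:
  assumes "module K V" "H \<subseteq> carrier V" "\<zero>\<^bsub>V\<^esub> \<in> H"
    and "\<And>a b. a \<in> H \<Longrightarrow> b \<in> H \<Longrightarrow> a \<oplus>\<^bsub>V\<^esub> b \<in> H"
    and smult: "\<And>a x. a \<in> carrier K \<Longrightarrow> x \<in> H \<Longrightarrow> a \<odot>\<^bsub>V\<^esub> x \<in> H"
  shows "submodule H K V"
proof -
  interpret V: module K V by fact
  have "\<ominus>\<^bsub>V\<^esub> a \<in> H" if "a \<in> H" for a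
  proof -
    have "\<ominus>\<^bsub>V\<^esub> a = (\<ominus>\<^bsub>K\<^esub> \<one>\<^bsub>K\<^esub>) \<odot>\<^bsub>V\<^esub> a"
      using that assms(2) by (auto simp: V.smult_l_minus)
    then show ?thesis using smult[of "\<ominus>\<^bsub>K\<^esub> \<one>\<^bsub>K\<^esub>" a] that by simp
  qed
  then show ?thesis using assms by (intro V.submoduleI) auto
qed

lemma submodule_zero: "submodule H K V \<Longrightarrow> \<zero>\<^bsub>V\<^esub> \<in> H"
  by (drule submodule.axioms(1)) (auto dest: subgroup.one_closed)

lemma submodule_kernel:
  assumes "module K V" "module K W" "f \<in> linear_maps K V W"
  shows "submodule {v \<in> carrier V. f v = \<zero>\<^bsub>W\<^esub>} K V"
proof -
  interpret V: module K V by fact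
  interpret W: module K W by fact
  show ?thesis
    by (rule submodule_if_closed)
      (auto simp: linear_maps_zero[OF assms] assms(1) linear_maps_add[OF assms(3)] linear_maps_smult[OF assms(3)])
qed

lemma submodule_image:
  assumes "module K V" "module K W" "f \<in> linear_maps K V W"
  shows "submodule (f ` carrier V) K W"
proof -
  interpret V: module K V by fact
  interpret W: module K W by fact
  show ?thesis
  proof (rule submodule_if_closed)
    show "\<zero>\<^bsub>W\<^esub> \<in> f ` carrier V"
      using linear_maps_zero[OF assms] by (metis V.M.zero_closed image_eqI)
  qed (use assms in \<open>auto simp: linear_maps_closed linear_maps_add[OF assms(3), symmetric]
      linear_maps_smult[OF assms(3), symmetric]\<close>)
qed

text \<open>Zorn's lemma on the submodules that meet \<open>U\<close> trivially: a maximal one,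
  \<open>S\<close>, already satisfies \<open>U + S = V\<close>, since otherwise a vector outside the
  sum could be adjoined to \<open>S\<close>.\<close>

lemma submodule_complement:
  assumes "field K" "module K V" "submodule U K V"
  obtains S where "submodule S K V" "U \<inter> S = {\<zero>\<^bsub>V\<^esub>}"
    "\<And>v. v \<in> carrier V \<Longrightarrow> \<exists>u\<in>U. \<exists>s\<in>S. v = u \<oplus>\<^bsub>V\<^esub> s"
proof -
  interpret K: field K by fact
  interpret V: module K V by fact
  note U = V.submoduleE[OF assms(3)] submodule_zero[OF assms(3)]
  define A where "A = {S. submodule S K V \<and> U \<inter> S = {\<zero>\<^bsub>V\<^esub>}}"
  have "\<exists>S\<in>A. \<forall>X\<in>A. S \<subseteq> X \<longrightarrow> X = S"
  proof (rule subset_Zorn_nonempty)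
    have "submodule {\<zero>\<^bsub>V\<^esub>} K V"
      by (rule submodule_if_closed) (auto simp: assms)
    then show "A \<noteq> {}" using U(7) by (auto simp: A_def)
  next
    fix \<C> assume ne: "\<C> \<noteq> {}" and ch: "subset.chain A \<C>"
    then have sub: "submodule S K V" "U \<inter> S = {\<zero>\<^bsub>V\<^esub>}" if "S \<in> \<C>" for S
      using that by (auto simp: A_def subset_chain_def)
    have "submodule (\<Union>\<C>) K V"
    proof (rule submodule_if_closed)
      fix a b assume "a \<in> \<Union>\<C>" "b \<in> \<Union>\<C>"
      then obtain S T where "S \<in> \<C>" "T \<in> \<C>" "a \<in> S" "b \<in> T" by auto
      moreover have "S \<subseteq> T \<or> T \<subseteq> S"
        using ch calculation by (auto simp: subset_chain_def)
      ultimately obtain S where "S \<in> \<C>" "a \<in> S" "b \<in> S" by blast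
      then show "a \<oplus>\<^bsub>V\<^esub> b \<in> \<Union>\<C>" using V.submoduleE(5)[OF sub(1)] by blast
    next
      show "\<Union>\<C> \<subseteq> carrier V" using V.submoduleE(1)[OF sub(1)] by blast
      show "\<zero>\<^bsub>V\<^esub> \<in> \<Union>\<C>" using ne submodule_zero[OF sub(1)] by blast
      show "a \<odot>\<^bsub>V\<^esub> x \<in> \<Union>\<C>" if "a \<in> carrier K" "x \<in> \<Union>\<C>" for a x
        using that V.submoduleE(4)[OF sub(1)] by blast
    qed (fact assms)
    then show "\<Union>\<C> \<in> A" using ne sub by (auto simp: A_def)
  qed
  then obtain S where S: "submodule S K V" "U \<inter> S = {\<zero>\<^bsub>V\<^esub>}"
    and max: "\<And>X. X \<in> A \<Longrightarrow> S \<subseteq> X \<Longrightarrow> X = S" by (auto simp: A_def)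
  note S' = V.submoduleE[OF S(1)] submodule_zero[OF S(1)]
  have "\<exists>u\<in>U. \<exists>s\<in>S. v = u \<oplus>\<^bsub>V\<^esub> s" if v: "v \<in> carrier V" for v
  proof (rule ccontr)
    assume neg: "\<not> ?thesis"
    \<comment> \<open>\<open>T\<close> is \<open>S + K v\<close>. It will be seen to meet
      \<open>U\<close> trivially, so maximality forces \<open>T = S\<close>, which puts
      \<open>v\<close> into \<open>S\<close>.\<close>
    define T where "T = {s \<oplus>\<^bsub>V\<^esub> a \<odot>\<^bsub>V\<^esub> v | s a. s \<in> S \<and> a \<in> carrier K}"
    have T: "submodule T K V"
    proof (rule submodule_if_closed)
      show "T \<subseteq> carrier V" using S'(1) v by (auto simp: T_def)
      have "\<zero>\<^bsub>V\<^esub> = \<zero>\<^bsub>V\<^esub> \<oplus>\<^bsub>V\<^esub> \<zero>\<^bsub>K\<^esub> \<odot>\<^bsub>V\<^esub> v" using v by simp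
      then show "\<zero>\<^bsub>V\<^esub> \<in> T" unfolding T_def using S'(7) by blast
    next
      fix x y assume "x \<in> T" "y \<in> T"
      then obtain s a t b where *: "s \<in> S" "a \<in> carrier K" "t \<in> S" "b \<in> carrier K"
        "x = s \<oplus>\<^bsub>V\<^esub> a \<odot>\<^bsub>V\<^esub> v" "y = t \<oplus>\<^bsub>V\<^esub> b \<odot>\<^bsub>V\<^esub> v" unfolding T_def by blast
      then have "x \<oplus>\<^bsub>V\<^esub> y = (s \<oplus>\<^bsub>V\<^esub> t) \<oplus>\<^bsub>V\<^esub> (a \<oplus>\<^bsub>K\<^esub> b) \<odot>\<^bsub>V\<^esub> v"
        using v S'(1) by (simp add: V.smult_l_distr V.M.add.m_ac subset_iff)
      then show "x \<oplus>\<^bsub>V\<^esub> y \<in> T" unfolding T_def using * S'(5) by blast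
    next
      fix c x assume c: "c \<in> carrier K" and "x \<in> T"
      then obtain s a where *: "s \<in> S" "a \<in> carrier K"
        "x = s \<oplus>\<^bsub>V\<^esub> a \<odot>\<^bsub>V\<^esub> v" unfolding T_def by blast
      then have "c \<odot>\<^bsub>V\<^esub> x = c \<odot>\<^bsub>V\<^esub> s \<oplus>\<^bsub>V\<^esub> (c \<otimes>\<^bsub>K\<^esub> a) \<odot>\<^bsub>V\<^esub> v"
        using v c S'(1) by (simp add: V.smult_r_distr V.smult_assoc1 subset_iff)
      then show "c \<odot>\<^bsub>V\<^esub> x \<in> T" unfolding T_def using * c S'(4) by blast
    qed (fact assms)
    have ST: "S \<subseteq> T"
    proof
      fix s assume s: "s \<in> S"
      then have "s = s \<oplus>\<^bsub>V\<^esub> \<zero>\<^bsub>K\<^esub> \<odot>\<^bsub>V\<^esub> v" using v S'(1) by auto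
      then show "s \<in> T" unfolding T_def using s by blast
    qed
    have "u = \<zero>\<^bsub>V\<^esub>" if u: "u \<in> U" "u \<in> T" for u
    proof -
      obtain s a where *: "s \<in> S" "a \<in> carrier K" "u = s \<oplus>\<^bsub>V\<^esub> a \<odot>\<^bsub>V\<^esub> v"
        using u unfolding T_def by blast
      have cl: "u \<in> carrier V" "s \<in> carrier V" using U(1) S'(1) u * by auto
      show ?thesis
      proof (cases "a = \<zero>\<^bsub>K\<^esub>")
        case True
        then have "u = s" using * v cl by simp
        then show ?thesis using S(2) u * by auto
      next
        case False
        \<comment> \<open>Division by \<open>a\<close> is where the field enters:
          \<open>u = s + a v\<close> turns into \<open>v = b u - b s\<close>, a decomposition that
          \<open>neg\<close> excludes.\<close>
        define b where "b = inv\<^bsub>K\<^esub> a"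
        have b: "b \<in> carrier K" "b \<otimes>\<^bsub>K\<^esub> a = \<one>\<^bsub>K\<^esub>"
          using False * K.field_Units by (auto simp: b_def)
        have "b \<odot>\<^bsub>V\<^esub> u = v \<oplus>\<^bsub>V\<^esub> b \<odot>\<^bsub>V\<^esub> s"
          using * cl b v by (simp add: V.smult_r_distr V.smult_assoc1[symmetric] V.M.a_comm)
        then have "v = b \<odot>\<^bsub>V\<^esub> u \<oplus>\<^bsub>V\<^esub> \<ominus>\<^bsub>V\<^esub> (b \<odot>\<^bsub>V\<^esub> s)"
          using cl b v by (simp add: V.M.a_assoc V.M.r_neg)
        moreover have "b \<odot>\<^bsub>V\<^esub> u \<in> U" "\<ominus>\<^bsub>V\<^esub> (b \<odot>\<^bsub>V\<^esub> s) \<in> S"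
          using U(4) S'(3,4) b u * by auto
        ultimately show ?thesis using neg by blast
      qed
    qed
    then have "U \<inter> T = {\<zero>\<^bsub>V\<^esub>}" using U(7) submodule_zero[OF T] by blast
    then have "T \<in> A" using T by (simp add: A_def)
    then have "T = S" using max ST by blast
    moreover have "v \<in> T"
    proof -
      have "v = \<zero>\<^bsub>V\<^esub> \<oplus>\<^bsub>V\<^esub> \<one>\<^bsub>K\<^esub> \<odot>\<^bsub>V\<^esub> v" using v by simp
      then show ?thesis unfolding T_def using S'(7) by blast
    qed
    moreover have "v = \<zero>\<^bsub>V\<^esub> \<oplus>\<^bsub>V\<^esub> v" using v by simp
    ultimately show False using neg U(7) by metis
  qed
  then show thesis using that S by blast
qed

text \<open>\<open>r\<close> projects onto a complement of \<open>U\<close> along \<open>U\<close>.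
  Its image is a copy of the quotient \<open>V / U\<close> made of elements of \<open>V\<close>, so
  quotients can be formed without leaving the element type.\<close>

lemma linear_projection:
  assumes "field K" "module K V" "submodule U K V"
  obtains r where "r \<in> linear_maps K V V" "\<And>v. v \<in> carrier V \<Longrightarrow> r (r v) = r v"
    "\<And>v. v \<in> carrier V \<Longrightarrow> r v = \<zero>\<^bsub>V\<^esub> \<longleftrightarrow> v \<in> U"
proof -
  interpret V: module K V by fact
  note U = V.submoduleE[OF assms(3)] submodule_zero[OF assms(3)]
  obtain S where S: "submodule S K V" "U \<inter> S = {\<zero>\<^bsub>V\<^esub>}"
    and dec: "\<And>v. v \<in> carrier V \<Longrightarrow> \<exists>u\<in>U. \<exists>s\<in>S. v = u \<oplus>\<^bsub>V\<^esub> s"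
    using submodule_complement[OF assms] by blast
  note S' = V.submoduleE[OF S(1)] submodule_zero[OF S(1)]
  \<comment> \<open>The difference \<open>s - s'\<close> equals \<open>u' - u\<close>, hence lies in
    both \<open>S\<close> and \<open>U\<close>, which meet only in zero.\<close>
  have uniq: "s = s'" if "u \<in> U" "u' \<in> U" "s \<in> S" "s' \<in> S" "u \<oplus>\<^bsub>V\<^esub> s = u' \<oplus>\<^bsub>V\<^esub> s'" for u u' s s'
  proof -
    have cl: "u \<in> carrier V" "u' \<in> carrier V" "s \<in> carrier V" "s' \<in> carrier V"
      using that U(1) S'(1) by auto
    have "s \<oplus>\<^bsub>V\<^esub> \<ominus>\<^bsub>V\<^esub> s' = \<ominus>\<^bsub>V\<^esub> u \<oplus>\<^bsub>V\<^esub> (u \<oplus>\<^bsub>V\<^esub> s) \<oplus>\<^bsub>V\<^esub> \<ominus>\<^bsub>V\<^esub> s'"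
      using cl by (simp add: V.M.r_neg1)
    also have "\<dots> = \<ominus>\<^bsub>V\<^esub> u \<oplus>\<^bsub>V\<^esub> u'"
      unfolding that(5) using cl by (simp add: V.M.a_assoc V.M.r_neg)
    finally have eq: "s \<oplus>\<^bsub>V\<^esub> \<ominus>\<^bsub>V\<^esub> s' = \<ominus>\<^bsub>V\<^esub> u \<oplus>\<^bsub>V\<^esub> u'" .
    have "s \<oplus>\<^bsub>V\<^esub> \<ominus>\<^bsub>V\<^esub> s' \<in> S" using that S'(3,5) by auto
    moreover have "\<ominus>\<^bsub>V\<^esub> u \<oplus>\<^bsub>V\<^esub> u' \<in> U" using that U(3,5) by auto
    ultimately have "s \<oplus>\<^bsub>V\<^esub> \<ominus>\<^bsub>V\<^esub> s' = \<zero>\<^bsub>V\<^esub>" using S(2) eq by auto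
    then show ?thesis using cl module_diff_eq_zero[OF assms(2)] by (simp add: V.M.minus_eq)
  qed
  define r where "r v = (SOME s. s \<in> S \<and> (\<exists>u\<in>U. v = u \<oplus>\<^bsub>V\<^esub> s))" for v
  have r: "r v \<in> S" "\<exists>u\<in>U. v = u \<oplus>\<^bsub>V\<^esub> r v" if "v \<in> carrier V" for v
  proof -
    have "r v \<in> S \<and> (\<exists>u\<in>U. v = u \<oplus>\<^bsub>V\<^esub> r v)"
      unfolding r_def by (rule someI_ex) (use dec[OF that] in blast)
    then show "r v \<in> S" "\<exists>u\<in>U. v = u \<oplus>\<^bsub>V\<^esub> r v" by auto
  qed
  have r_eq: "r (u \<oplus>\<^bsub>V\<^esub> s) = s" if "u \<in> U" "s \<in> S" for u s
  proof -
    have "u \<oplus>\<^bsub>V\<^esub> s \<in> carrier V" using that U(1) S'(1) by auto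
    from r[OF this] show ?thesis using uniq that by metis
  qed
  show thesis
  proof
    show "r \<in> linear_maps K V V"
    proof (rule linear_mapsI)
      fix v assume "v \<in> carrier V" then show "r v \<in> carrier V" using r(1) S'(1) by auto
    next
      fix v w assume vw: "v \<in> carrier V" "w \<in> carrier V"
      obtain u u' where *: "u \<in> U" "u' \<in> U" "v = u \<oplus>\<^bsub>V\<^esub> r v" "w = u' \<oplus>\<^bsub>V\<^esub> r w"
        using r(2) vw by blast
      have cl: "u \<in> carrier V" "u' \<in> carrier V" "r v \<in> carrier V" "r w \<in> carrier V"
        using * r(1) vw U(1) S'(1) by auto
      have "v \<oplus>\<^bsub>V\<^esub> w = (u \<oplus>\<^bsub>V\<^esub> r v) \<oplus>\<^bsub>V\<^esub> (u' \<oplus>\<^bsub>V\<^esub> r w)" using *(3,4) by simp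
      also have "\<dots> = (u \<oplus>\<^bsub>V\<^esub> u') \<oplus>\<^bsub>V\<^esub> (r v \<oplus>\<^bsub>V\<^esub> r w)"
        using cl by (simp add: V.M.add.m_ac)
      finally show "r (v \<oplus>\<^bsub>V\<^esub> w) = r v \<oplus>\<^bsub>V\<^esub> r w"
        using r_eq U(5) S'(5) * r(1) vw by simp
    next
      fix a v assume av: "a \<in> carrier K" "v \<in> carrier V"
      obtain u where *: "u \<in> U" "v = u \<oplus>\<^bsub>V\<^esub> r v" using r(2) av by blast
      have cl: "u \<in> carrier V" "r v \<in> carrier V" using * r(1) av U(1) S'(1) by auto
      have "a \<odot>\<^bsub>V\<^esub> v = a \<odot>\<^bsub>V\<^esub> (u \<oplus>\<^bsub>V\<^esub> r v)" using *(2) by simp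
      also have "\<dots> = a \<odot>\<^bsub>V\<^esub> u \<oplus>\<^bsub>V\<^esub> a \<odot>\<^bsub>V\<^esub> r v"
        using cl av by (simp add: V.smult_r_distr)
      finally show "r (a \<odot>\<^bsub>V\<^esub> v) = a \<odot>\<^bsub>V\<^esub> r v"
        using r_eq U(4) S'(4) * r(1) av by simp
    qed
  next
    fix v assume v: "v \<in> carrier V"
    have "r v = \<zero>\<^bsub>V\<^esub> \<oplus>\<^bsub>V\<^esub> r v" using r(1)[OF v] S'(1) by auto
    then show "r (r v) = r v" using r_eq[OF U(7) r(1)[OF v]] by simp
    show "r v = \<zero>\<^bsub>V\<^esub> \<longleftrightarrow> v \<in> U"
    proof
      assume "r v = \<zero>\<^bsub>V\<^esub>"
      then obtain u where "u \<in> U" "v = u \<oplus>\<^bsub>V\<^esub> \<zero>\<^bsub>V\<^esub>" using r(2)[OF v] by auto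
      then show "v \<in> U" using U(1) by auto
    next
      assume "v \<in> U"
      then have "r (v \<oplus>\<^bsub>V\<^esub> \<zero>\<^bsub>V\<^esub>) = \<zero>\<^bsub>V\<^esub>" using r_eq S'(7) by blast
      then show "r v = \<zero>\<^bsub>V\<^esub>" using v by simp
    qed
  qed
qed

text \<open>Any preimage under \<open>e\<close> may be used to define \<open>s\<close>: two
  preimages differ by an element of the kernel of \<open>e\<close>, which \<open>m\<close>
  kills.\<close>

lemma linear_factor:
  assumes "module K P" "module K X" "module K Q"
    and e: "e \<in> linear_maps K P X" "e ` carrier P = carrier X" and m: "m \<in> linear_maps K P Q"
    and ker: "\<And>p. p \<in> carrier P \<Longrightarrow> e p = \<zero>\<^bsub>X\<^esub> \<Longrightarrow> m p = \<zero>\<^bsub>Q\<^esub>"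
  obtains s where "s \<in> linear_maps K X Q" "\<And>p. p \<in> carrier P \<Longrightarrow> s (e p) = m p"
proof -
  interpret P: module K P by fact
  have eq: "m p = m p'" if "p \<in> carrier P" "p' \<in> carrier P" "e p = e p'" for p p'
    using ker[of "p \<ominus>\<^bsub>P\<^esub> p'"] that assms linear_maps_closed[OF m] linear_maps_closed[OF e(1)]
    by (simp add: linear_maps_diff[of K P] module_diff_eq_zero)
  define s where "s x = m (inv_into (carrier P) e x)" for x
  have s: "s (e p) = m p" if "p \<in> carrier P" for p
    unfolding s_def by (rule eq) (use that in \<open>auto simp: inv_into_into f_inv_into_f\<close>)
  show thesis
  proof (rule that[OF _ s])
    show "s \<in> linear_maps K X Q"
      by (rule linear_mapsI) (auto simp: e(2)[symmetric] s linear_maps_closed[OF m]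
         linear_maps_add[OF e(1), symmetric] linear_maps_smult[OF e(1), symmetric]
         linear_maps_add[OF m] linear_maps_smult[OF m])
  qed auto
qed

text \<open>Compose \<open>f\<close> with a linear section of \<open>e\<close>. The section comes
  from the projection \<open>r\<close> along the kernel of \<open>e\<close>: it factors through
  \<open>e\<close> as \<open>s\<close>, and \<open>e (r v) = e v\<close> then gives
  \<open>e (s w) = w\<close>.\<close>

lemma linear_lift:
  assumes "field K" "module K V" "module K W"
    and e: "e \<in> linear_maps K V W" "e ` carrier V = carrier W" and f: "f \<in> linear_maps K X W"
  obtains g where "g \<in> linear_maps K X V" "\<And>x. x \<in> carrier X \<Longrightarrow> e (g x) = f x"
proof -
  interpret V: module K V by fact
  obtain r where r: "r \<in> linear_maps K V V" "\<And>v. v \<in> carrier V \<Longrightarrow> r (r v) = r v"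
    "\<And>v. v \<in> carrier V \<Longrightarrow> r v = \<zero>\<^bsub>V\<^esub> \<longleftrightarrow> v \<in> {v \<in> carrier V. e v = \<zero>\<^bsub>W\<^esub>}"
    using linear_projection[OF assms(1,2) submodule_kernel[OF assms(2,3) e(1)]] by blast
  \<comment> \<open>The idempotent \<open>r\<close> kills \<open>v - r v\<close>, so this difference
    lies in the kernel of \<open>e\<close>.\<close>
  have er: "e (r v) = e v" if v: "v \<in> carrier V" for v
  proof -
    note rv = linear_maps_closed[OF r(1) v]
    have "r (v \<ominus>\<^bsub>V\<^esub> r v) = \<zero>\<^bsub>V\<^esub>"
      using v rv by (simp add: linear_maps_diff[OF assms(2,2) r(1)] r(2) module_diff_eq_zero[OF assms(2)])
    then have "e (v \<ominus>\<^bsub>V\<^esub> r v) = \<zero>\<^bsub>W\<^esub>" using r(3)[of "v \<ominus>\<^bsub>V\<^esub> r v"] v rv by auto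
    then show ?thesis using v rv linear_maps_closed[OF e(1)]
      by (simp add: linear_maps_diff[OF assms(2,3) e(1)] module_diff_eq_zero[OF assms(3)])
  qed
  obtain s where s: "s \<in> linear_maps K W V" "\<And>v. v \<in> carrier V \<Longrightarrow> s (e v) = r v"
    using linear_factor[OF assms(2,3,2) e r(1)] r(3) by blast
  have "e (s w) = w" if "w \<in> carrier W" for w
    using that er s(2) unfolding e(2)[symmetric] by auto
  then show thesis
    using that[OF linear_maps_comp[OF f s(1)]] linear_maps_closed[OF f] by blast
qed

section \<open>Direct sums\<close>

text \<open>Families vanishing outside \<open>S\<close> are stored as total functions, so equality
  of elements is equality in HOL. Two uses share this definition: with constant summand
  \<open>K\<close> it is the free module behind the tensor product, with Hom spaces as summands it
  gives the free modules over a category.\<close>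

definition direct_sum ::
  "('k, 'r) ring_scheme \<Rightarrow> 's set \<Rightarrow> ('s \<Rightarrow> ('k, 'a) module) \<Rightarrow> ('k, 's \<Rightarrow> 'a) module" where
  "direct_sum K S V =
    \<lparr>carrier = {\<phi>. (\<forall>s\<in>S. \<phi> s \<in> carrier (V s)) \<and> (\<forall>s. s \<notin> S \<longrightarrow> \<phi> s = \<zero>\<^bsub>V s\<^esub>) \<and>
       finite {s. \<phi> s \<noteq> \<zero>\<^bsub>V s\<^esub>}},
     monoid.mult = undefined, one = undefined,
     ring.zero = (\<lambda>s. \<zero>\<^bsub>V s\<^esub>),
     ring.add = (\<lambda>\<phi> \<psi> s. \<phi> s \<oplus>\<^bsub>V s\<^esub> \<psi> s),
     module.smult = (\<lambda>a \<phi> s. a \<odot>\<^bsub>V s\<^esub> \<phi> s)\<rparr>"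

definition single :: "('s \<Rightarrow> ('k, 'a) module) \<Rightarrow> 's \<Rightarrow> 'a \<Rightarrow> 's \<Rightarrow> 'a" where
  "single V s v = (\<lambda>t. if t = s then v else \<zero>\<^bsub>V t\<^esub>)"

definition sum_map ::
  "('s \<Rightarrow> ('k, 'a) module) \<Rightarrow> ('k, 'b) module \<Rightarrow> ('s \<Rightarrow> 'a \<Rightarrow> 'b) \<Rightarrow> ('s \<Rightarrow> 'a) \<Rightarrow> 'b" where
  "sum_map V U \<beta> \<phi> = (\<Oplus>\<^bsub>U\<^esub>s\<in>{s. \<phi> s \<noteq> \<zero>\<^bsub>V s\<^esub>}. \<beta> s (\<phi> s))"

text \<open>The module assumption covers every index, also those outside \<open>S\<close>, so that
  an element satisfies \<open>\<phi> s \<in> carrier (V s)\<close> for all \<open>s\<close>. Since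
  \<open>S\<close> occurs in no assumption, the locale predicate takes only \<open>K\<close> and
  \<open>V\<close> as arguments.\<close>

locale module_family =
  fixes K :: "('k, 'r) ring_scheme" and S :: "'s set" and V :: "'s \<Rightarrow> ('k, 'a) module"
  assumes cring_K: "cring K" and module_V: "module K (V s)"
begin

lemma mem_direct_sum:
  "\<phi> \<in> carrier (direct_sum K S V) \<longleftrightarrow> (\<forall>s. \<phi> s \<in> carrier (V s)) \<and>
     (\<forall>s. s \<notin> S \<longrightarrow> \<phi> s = \<zero>\<^bsub>V s\<^esub>) \<and> finite {s. \<phi> s \<noteq> \<zero>\<^bsub>V s\<^esub>}"
  using module_zero_closed[OF module_V] by (auto simp: direct_sum_def)

lemma direct_sum_simps [simp]:
  "\<zero>\<^bsub>direct_sum K S V\<^esub> = (\<lambda>s. \<zero>\<^bsub>V s\<^esub>)"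
  "\<phi> \<oplus>\<^bsub>direct_sum K S V\<^esub> \<psi> = (\<lambda>s. \<phi> s \<oplus>\<^bsub>V s\<^esub> \<psi> s)"
  "a \<odot>\<^bsub>direct_sum K S V\<^esub> \<phi> = (\<lambda>s. a \<odot>\<^bsub>V s\<^esub> \<phi> s)"
  by (simp_all add: direct_sum_def)

lemma zero_plus_zero [simp]: "\<zero>\<^bsub>V s\<^esub> \<oplus>\<^bsub>V s\<^esub> \<zero>\<^bsub>V s\<^esub> = \<zero>\<^bsub>V s\<^esub>"
proof -
  interpret V: module K "V s" by (rule module_V)
  show ?thesis by simp
qed

lemma smult_zero_vector [simp]: "a \<in> carrier K \<Longrightarrow> a \<odot>\<^bsub>V s\<^esub> \<zero>\<^bsub>V s\<^esub> = \<zero>\<^bsub>V s\<^esub>"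
proof -
  interpret V: module K "V s" by (rule module_V)
  show "a \<in> carrier K \<Longrightarrow> ?thesis" by simp
qed

lemma module_direct_sum: "module K (direct_sum K S V)"
proof (rule module_if_smult_zero, unfold direct_sum_simps)
  fix \<phi> \<psi> assume *: "\<phi> \<in> carrier (direct_sum K S V)" "\<psi> \<in> carrier (direct_sum K S V)"
  have "finite ({s. \<phi> s \<noteq> \<zero>\<^bsub>V s\<^esub>} \<union> {s. \<psi> s \<noteq> \<zero>\<^bsub>V s\<^esub>})"
    using * by (auto simp: mem_direct_sum)
  then have "finite {s. \<phi> s \<oplus>\<^bsub>V s\<^esub> \<psi> s \<noteq> \<zero>\<^bsub>V s\<^esub>}"
    by (rule rev_finite_subset) auto
  then show "(\<lambda>s. \<phi> s \<oplus>\<^bsub>V s\<^esub> \<psi> s) \<in> carrier (direct_sum K S V)"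
    using * by (auto simp: mem_direct_sum module_add_closed[OF module_V])
next
  fix a \<phi> assume *: "a \<in> carrier K" "\<phi> \<in> carrier (direct_sum K S V)"
  have "finite {s. \<phi> s \<noteq> \<zero>\<^bsub>V s\<^esub>}"
    using * by (auto simp: mem_direct_sum)
  then have "finite {s. a \<odot>\<^bsub>V s\<^esub> \<phi> s \<noteq> \<zero>\<^bsub>V s\<^esub>}"
    by (rule rev_finite_subset) (use * in auto)
  then show "(\<lambda>s. a \<odot>\<^bsub>V s\<^esub> \<phi> s) \<in> carrier (direct_sum K S V)"
    using * by (auto simp: mem_direct_sum module_smult_closed[OF module_V])
next
  show "(\<lambda>s. \<zero>\<^bsub>V s\<^esub>) \<in> carrier (direct_sum K S V)"
    by (auto simp: mem_direct_sum module_zero_closed[OF module_V])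
qed (use cring_K module_V in \<open>auto simp: mem_direct_sum fun_eq_iff
    module.smult_l_distr[OF module_V] module.smult_r_distr[OF module_V] module.smult_assoc1[OF module_V]
    module.smult_one[OF module_V] module.smult_l_null[OF module_V]
    abelian_monoid.a_assoc[OF module_abelian_monoid[OF module_V]]
    abelian_monoid.l_zero[OF module_abelian_monoid[OF module_V]]
    intro: abelian_monoid.a_comm[OF module_abelian_monoid[OF module_V]]\<close>)

lemma single_closed: "s \<in> S \<Longrightarrow> v \<in> carrier (V s) \<Longrightarrow> single V s v \<in> carrier (direct_sum K S V)"
  by (auto simp: mem_direct_sum single_def module_zero_closed[OF module_V])

text \<open>Induction on the finite support. Clearing one coordinate \<open>s\<close> of
  \<open>\<phi>\<close> gives a \<open>\<psi>\<close> with smaller support, and adding back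
  \<open>single V s (\<phi> s)\<close> restores \<open>\<phi>\<close>.\<close>

lemma direct_sum_induct [consumes 1, case_names zero add]:
  assumes "\<phi> \<in> carrier (direct_sum K S V)"
    and zero: "P \<zero>\<^bsub>direct_sum K S V\<^esub>"
    and add: "\<And>s v \<psi>. s \<in> S \<Longrightarrow> v \<in> carrier (V s) \<Longrightarrow> \<psi> \<in> carrier (direct_sum K S V) \<Longrightarrow>
      P \<psi> \<Longrightarrow> P (single V s v \<oplus>\<^bsub>direct_sum K S V\<^esub> \<psi>)"
  shows "P \<phi>"
proof -
  have "P \<phi>" if "finite A" "{s. \<phi> s \<noteq> \<zero>\<^bsub>V s\<^esub>} = A" "\<phi> \<in> carrier (direct_sum K S V)" for A \<phi>
    using that
  proof (induction A arbitrary: \<phi> rule: finite_induct)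
    case empty
    then have "\<phi> = \<zero>\<^bsub>direct_sum K S V\<^esub>" by auto
    then show ?case using zero by simp
  next
    case (insert s A)
    define \<psi> where "\<psi> = \<phi>(s := \<zero>\<^bsub>V s\<^esub>)"
    have A: "{s. \<psi> s \<noteq> \<zero>\<^bsub>V s\<^esub>} = A"
      using insert.hyps insert.prems(1) by (auto simp: \<psi>_def)
    then have \<psi>: "\<psi> \<in> carrier (direct_sum K S V)"
      using insert.prems(2) insert.hyps(1)
      by (auto simp: mem_direct_sum \<psi>_def module_zero_closed[OF module_V])
    have s: "s \<in> S" "\<phi> s \<in> carrier (V s)"
      using insert.prems by (auto simp: mem_direct_sum)
    have "\<phi> = single V s (\<phi> s) \<oplus>\<^bsub>direct_sum K S V\<^esub> \<psi>"
      using insert.prems(2) module_V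
      by (auto simp: single_def \<psi>_def fun_eq_iff mem_direct_sum module_def abelian_group_def
        abelian_monoid.l_zero abelian_monoid.r_zero)
    then show ?case using add[OF s \<psi> insert.IH[OF A \<psi>]] by simp
  qed
  then show ?thesis using assms(1) by (auto simp: mem_direct_sum)
qed

context
  fixes U :: "('k, 'b) module" and \<beta> :: "'s \<Rightarrow> 'a \<Rightarrow> 'b"
  assumes module_U: "module K U" and linear_\<beta>: "\<And>s. s \<in> S \<Longrightarrow> \<beta> s \<in> linear_maps K (V s) U"
begin

text \<open>Coordinates outside the support contribute \<open>\<beta> s 0 = 0\<close>. Two elements
  and their sum have different supports, and this puts all three sums over one common index
  set.\<close>

lemma sum_map_superset:
  assumes "\<phi> \<in> carrier (direct_sum K S V)" "finite A" "{s. \<phi> s \<noteq> \<zero>\<^bsub>V s\<^esub>} \<subseteq> A" "A \<subseteq> S"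
  shows "sum_map V U \<beta> \<phi> = (\<Oplus>\<^bsub>U\<^esub>s\<in>A. \<beta> s (\<phi> s))"
proof -
  interpret U: module K U by (rule module_U)
  show ?thesis unfolding sum_map_def
    using assms linear_maps_zero[OF module_V module_U linear_\<beta>] linear_maps_closed[OF linear_\<beta>]
    by (intro U.M.add.finprod_mono_neutral_cong_left) (auto simp: mem_direct_sum Pi_def subset_iff)
qed

lemma sum_map_linear: "sum_map V U \<beta> \<in> linear_maps K (direct_sum K S V) U"
proof -
  interpret U: module K U by (rule module_U)
  have supp: "finite {s. \<phi> s \<noteq> \<zero>\<^bsub>V s\<^esub>}" "{s. \<phi> s \<noteq> \<zero>\<^bsub>V s\<^esub>} \<subseteq> S" "\<phi> s \<in> carrier (V s)"
    if "\<phi> \<in> carrier (direct_sum K S V)" for \<phi> s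
    using that by (auto simp: mem_direct_sum)
  note D = module_direct_sum
  show ?thesis
  proof (rule linear_mapsI)
    fix \<phi> assume "\<phi> \<in> carrier (direct_sum K S V)"
    then show "sum_map V U \<beta> \<phi> \<in> carrier U" unfolding sum_map_def
      using supp[of \<phi>] linear_maps_closed[OF linear_\<beta>] by (intro U.M.finsum_closed) auto
  next
    fix \<phi> \<psi> assume *: "\<phi> \<in> carrier (direct_sum K S V)" "\<psi> \<in> carrier (direct_sum K S V)"
    define A where "A = {s. \<phi> s \<noteq> \<zero>\<^bsub>V s\<^esub>} \<union> {s. \<psi> s \<noteq> \<zero>\<^bsub>V s\<^esub>}"
    have A: "finite A" "A \<subseteq> S" unfolding A_def using supp * by auto
    have "sum_map V U \<beta> (\<phi> \<oplus>\<^bsub>direct_sum K S V\<^esub> \<psi>) = (\<Oplus>\<^bsub>U\<^esub>s\<in>A. \<beta> s ((\<phi> \<oplus>\<^bsub>direct_sum K S V\<^esub> \<psi>) s))"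
      by (rule sum_map_superset) (use A in \<open>auto simp: module_add_closed[OF D] * simp del: direct_sum_simps,
        auto simp: A_def\<close>)
    also have "\<dots> = (\<Oplus>\<^bsub>U\<^esub>s\<in>A. \<beta> s (\<phi> s) \<oplus>\<^bsub>U\<^esub> \<beta> s (\<psi> s))"
      using A supp(3)[OF *(1)] supp(3)[OF *(2)] linear_maps_closed[OF linear_\<beta>]
      by (intro U.M.finsum_cong') (auto simp: linear_maps_add[OF linear_\<beta>] subset_iff)
    also have "\<dots> = (\<Oplus>\<^bsub>U\<^esub>s\<in>A. \<beta> s (\<phi> s)) \<oplus>\<^bsub>U\<^esub> (\<Oplus>\<^bsub>U\<^esub>s\<in>A. \<beta> s (\<psi> s))"
      using A supp(3)[OF *(1)] supp(3)[OF *(2)] linear_maps_closed[OF linear_\<beta>]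
      by (intro U.M.finsum_addf) auto
    also have "\<dots> = sum_map V U \<beta> \<phi> \<oplus>\<^bsub>U\<^esub> sum_map V U \<beta> \<psi>"
      using sum_map_superset[OF *(1) A(1) _ A(2)] sum_map_superset[OF *(2) A(1) _ A(2)]
      by (simp add: A_def)
    finally show "sum_map V U \<beta> (\<phi> \<oplus>\<^bsub>direct_sum K S V\<^esub> \<psi>) = sum_map V U \<beta> \<phi> \<oplus>\<^bsub>U\<^esub> sum_map V U \<beta> \<psi>" .
  next
    fix a \<phi> assume *: "a \<in> carrier K" "\<phi> \<in> carrier (direct_sum K S V)"
    define A where "A = {s. \<phi> s \<noteq> \<zero>\<^bsub>V s\<^esub>}"
    have A: "finite A" "A \<subseteq> S" unfolding A_def using supp * by auto
    have "sum_map V U \<beta> (a \<odot>\<^bsub>direct_sum K S V\<^esub> \<phi>) = (\<Oplus>\<^bsub>U\<^esub>s\<in>A. \<beta> s ((a \<odot>\<^bsub>direct_sum K S V\<^esub> \<phi>) s))"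
      by (rule sum_map_superset) (use A in \<open>auto simp: module_smult_closed[OF D] * simp del: direct_sum_simps,
        auto simp: A_def *\<close>)
    also have "\<dots> = (\<Oplus>\<^bsub>U\<^esub>s\<in>A. a \<odot>\<^bsub>U\<^esub> \<beta> s (\<phi> s))"
      using A supp(3)[OF *(2)] linear_maps_closed[OF linear_\<beta>] *(1)
      by (intro U.M.finsum_cong') (auto simp: linear_maps_smult[OF linear_\<beta>] subset_iff)
    also have "\<dots> = a \<odot>\<^bsub>U\<^esub> (\<Oplus>\<^bsub>U\<^esub>s\<in>A. \<beta> s (\<phi> s))"
      using A supp(3)[OF *(2)] linear_maps_closed[OF linear_\<beta>] *(1)
      by (intro U.finsum_smult_ldistr[symmetric]) auto
    finally show "sum_map V U \<beta> (a \<odot>\<^bsub>direct_sum K S V\<^esub> \<phi>) = a \<odot>\<^bsub>U\<^esub> sum_map V U \<beta> \<phi>"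
      by (simp add: sum_map_def A_def)
  qed
qed

lemma sum_map_single:
  assumes "s \<in> S" "v \<in> carrier (V s)"
  shows "sum_map V U \<beta> (single V s v) = \<beta> s v"
proof -
  interpret U: module K U by (rule module_U)
  have "sum_map V U \<beta> (single V s v) = (\<Oplus>\<^bsub>U\<^esub>t\<in>{s}. \<beta> t (single V s v t))"
    using assms by (intro sum_map_superset single_closed) (auto simp: single_def)
  also have "\<dots> = \<beta> s v"
    using linear_maps_closed[OF linear_\<beta>] assms by (simp add: single_def)
  finally show ?thesis .
qed

end

end


section \<open>Tensor products\<close>

definition ring_module :: "('k, 'r) ring_scheme \<Rightarrow> ('k, 'k) module" where
  "ring_module K =
    \<lparr>carrier = carrier K, monoid.mult = undefined, one = undefined, ring.zero = \<zero>\<^bsub>K\<^esub>,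
     ring.add = (\<oplus>\<^bsub>K\<^esub>), module.smult = (\<otimes>\<^bsub>K\<^esub>)\<rparr>"

lemma module_ring_module: "cring K \<Longrightarrow> module K (ring_module K)"
proof -
  assume "cring K"
  then interpret K: cring K .
  show ?thesis
    by (rule module_if_smult_zero) (auto simp: ring_module_def K.is_cring K.add.m_ac
      K.l_distr K.r_distr K.m_assoc)
qed

lemma module_family_ring_module: "cring K \<Longrightarrow> module_family K (\<lambda>_. ring_module K)"
  by (simp add: module_family_def module_ring_module)

text \<open>The two records coincide, so induction over singles and extension by
  \<open>sum_map\<close> become available for the free module in the construction of the tensor
  product.\<close>

lemma free_module_eq_direct_sum: "free_module K S = direct_sum K S (\<lambda>_. ring_module K)"
  by (simp add: free_module_def direct_sum_def ring_module_def)

lemma basis_vector_eq_single: "basis_vector K s = single (\<lambda>_. ring_module K) s \<one>\<^bsub>K\<^esub>"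
  by (auto simp: basis_vector_def single_def ring_module_def)

definition bilinear_maps ::
  "('k, 'r) ring_scheme \<Rightarrow> ('k, 'a) module \<Rightarrow> ('k, 'b) module \<Rightarrow> ('k, 'c) module \<Rightarrow> ('a \<Rightarrow> 'b \<Rightarrow> 'c) set" where
  "bilinear_maps K V W U = {\<beta>. (\<forall>v\<in>carrier V. \<beta> v \<in> linear_maps K W U) \<and>
     (\<forall>w\<in>carrier W. (\<lambda>v. \<beta> v w) \<in> linear_maps K V U)}"

lemma bilinear_mapsI:
  assumes "\<And>v. v \<in> carrier V \<Longrightarrow> \<beta> v \<in> linear_maps K W U"
    and "\<And>w. w \<in> carrier W \<Longrightarrow> (\<lambda>v. \<beta> v w) \<in> linear_maps K V U"
  shows "\<beta> \<in> bilinear_maps K V W U"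
  using assms by (auto simp: bilinear_maps_def)

lemma bilinear_mapsD:
  assumes "\<beta> \<in> bilinear_maps K V W U"
  shows "v \<in> carrier V \<Longrightarrow> \<beta> v \<in> linear_maps K W U"
    and "w \<in> carrier W \<Longrightarrow> (\<lambda>v. \<beta> v w) \<in> linear_maps K V U"
  using assms by (auto simp: bilinear_maps_def)

lemma bilinear_maps_simps:
  assumes "\<beta> \<in> bilinear_maps K V W U" "v \<in> carrier V" "w \<in> carrier W"
  shows "\<beta> v w \<in> carrier U"
    and "v' \<in> carrier V \<Longrightarrow> \<beta> (v \<oplus>\<^bsub>V\<^esub> v') w = \<beta> v w \<oplus>\<^bsub>U\<^esub> \<beta> v' w"
    and "w' \<in> carrier W \<Longrightarrow> \<beta> v (w \<oplus>\<^bsub>W\<^esub> w') = \<beta> v w \<oplus>\<^bsub>U\<^esub> \<beta> v w'"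
    and "a \<in> carrier K \<Longrightarrow> \<beta> (a \<odot>\<^bsub>V\<^esub> v) w = a \<odot>\<^bsub>U\<^esub> \<beta> v w"
    and "a \<in> carrier K \<Longrightarrow> \<beta> v (a \<odot>\<^bsub>W\<^esub> w) = a \<odot>\<^bsub>U\<^esub> \<beta> v w"
  using linear_maps_closed[OF bilinear_mapsD(1)[OF assms(1,2)] assms(3)]
    linear_maps_add[OF bilinear_mapsD(2)[OF assms(1,3)] assms(2)]
    linear_maps_add[OF bilinear_mapsD(1)[OF assms(1,2)] assms(3)]
    linear_maps_smult[OF bilinear_mapsD(2)[OF assms(1,3)] _ assms(2)]
    linear_maps_smult[OF bilinear_mapsD(1)[OF assms(1,2)] _ assms(3)]
  by auto

section \<open>Quotient modules and generated submodules\<close>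

lemma module_quotient:
  assumes "module K V" "submodule H K V"
  shows "module K (quotient_module K V H)"
    and "(\<lambda>v. H +>\<^bsub>V\<^esub> v) \<in> linear_maps K V (quotient_module K V H)"
proof -
  interpret V: module K V by fact
  have sub: "additive_subgroup H V"
    using submodule.axioms(1)[OF assms(2)] by (rule additive_subgroupI)
  interpret abelian_subgroup H V
    by (rule abelian_subgroupI3[OF sub module_abelian_group[OF assms(1)]])
  have H: "H \<subseteq> carrier V" by (rule a_subset)
  \<comment> \<open>Scalar multiplication of a coset is a union over its representatives. All
    members of the union coincide, because \<open>a h\<close> stays in \<open>H\<close> for
    \<open>h\<close> in \<open>H\<close>.\<close>
  have smult: "(\<Union>x\<in>H +>\<^bsub>V\<^esub> v. H +>\<^bsub>V\<^esub> (a \<odot>\<^bsub>V\<^esub> x)) = H +>\<^bsub>V\<^esub> (a \<odot>\<^bsub>V\<^esub> v)"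
    if "a \<in> carrier K" "v \<in> carrier V" for a v
  proof -
    have "H +>\<^bsub>V\<^esub> (a \<odot>\<^bsub>V\<^esub> x) = H +>\<^bsub>V\<^esub> (a \<odot>\<^bsub>V\<^esub> v)" if x: "x \<in> H +>\<^bsub>V\<^esub> v" for x
    proof -
      obtain h where h: "h \<in> H" "x = h \<oplus>\<^bsub>V\<^esub> v" using x by (auto simp: a_r_coset_def')
      have "a \<odot>\<^bsub>V\<^esub> x = a \<odot>\<^bsub>V\<^esub> h \<oplus>\<^bsub>V\<^esub> a \<odot>\<^bsub>V\<^esub> v"
        using h H \<open>a \<in> carrier K\<close> \<open>v \<in> carrier V\<close> by (auto simp: V.smult_r_distr)
      moreover have "a \<odot>\<^bsub>V\<^esub> h \<in> H" using V.submoduleE(4)[OF assms(2)] h \<open>a \<in> carrier K\<close> by auto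
      ultimately have "a \<odot>\<^bsub>V\<^esub> x \<in> H +>\<^bsub>V\<^esub> (a \<odot>\<^bsub>V\<^esub> v)" by (auto simp: a_r_coset_def')
      then show ?thesis
        using V.M.a_repr_independence[of "a \<odot>\<^bsub>V\<^esub> x" H "a \<odot>\<^bsub>V\<^esub> v"] a_subgroup
          \<open>a \<in> carrier K\<close> \<open>v \<in> carrier V\<close> by simp
    qed
    then show ?thesis using a_rcos_self[OF \<open>v \<in> carrier V\<close>] by blast
  qed
  show lin: "(\<lambda>v. H +>\<^bsub>V\<^esub> v) \<in> linear_maps K V (quotient_module K V H)"
    by (rule linear_mapsI) (auto simp: quotient_module_def a_rcos_sum smult A_RCOSETS_def')
  show "module K (quotient_module K V H)"
  proof (rule module_image[OF assms(1) lin])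
    show "(\<lambda>v. H +>\<^bsub>V\<^esub> v) ` carrier V = carrier (quotient_module K V H)"
      by (auto simp: quotient_module_def A_RCOSETS_def')
    show "\<zero>\<^bsub>quotient_module K V H\<^esub> = H +>\<^bsub>V\<^esub> \<zero>\<^bsub>V\<^esub>"
      using V.M.a_coset_add_zero[OF H] by (simp add: quotient_module_def)
  qed
qed

lemma quotient_coset_eq:
  assumes "module K V" "submodule H K V" "v \<in> carrier V" "w \<in> H +>\<^bsub>V\<^esub> v"
  shows "w \<in> carrier V" "w \<ominus>\<^bsub>V\<^esub> v \<in> H"
proof -
  interpret V: module K V by fact
  have H: "H \<subseteq> carrier V" using V.submoduleE(1)[OF assms(2)] .
  obtain h where "h \<in> H" "w = h \<oplus>\<^bsub>V\<^esub> v" using assms(4) by (auto simp: a_r_coset_def')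
  with H assms(3) show "w \<in> carrier V" "w \<ominus>\<^bsub>V\<^esub> v \<in> H"
    by (auto simp: V.M.minus_eq V.M.a_assoc V.M.r_neg subset_iff)
qed

lemma submodule_submodule_span:
  assumes "module K V" "S \<subseteq> carrier V"
  shows "submodule (submodule_span K V S) K V" "S \<subseteq> submodule_span K V S"
proof -
  interpret V: module K V by fact
  have *: "carrier V \<in> {H. submodule H K V \<and> S \<subseteq> H}"
    using V.carrier_is_submodule assms(2) by simp
  show "submodule (submodule_span K V S) K V" unfolding submodule_span_def
  proof (rule submodule_if_closed[OF assms(1)])
    show "\<Inter> {H. submodule H K V \<and> S \<subseteq> H} \<subseteq> carrier V" using * by blast
  qed (use V.submoduleE submodule_zero in auto)
  show "S \<subseteq> submodule_span K V S" unfolding submodule_span_def by auto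
qed

section \<open>The tensor product and its universal property\<close>

locale tensor =
  fixes K :: "('k, 'r) ring_scheme" and V :: "('k, 'a) module" and W :: "('k, 'b) module"
  assumes module_V: "module K V" and module_W: "module K W"
begin

abbreviation "T \<equiv> tensor_product K V W"
abbreviation "F \<equiv> free_module K (carrier V \<times> carrier W)"
abbreviation "N \<equiv> tensor_kernel K V W"
abbreviation pt (infixl \<open>\<otimes>\<^sub>T\<close> 70) where "pt \<equiv> pure_tensor K V W"

sublocale V: module K V by (rule module_V)
sublocale W: module K W by (rule module_W)
sublocale F: module_family K "carrier V \<times> carrier W" "\<lambda>_. ring_module K"
  by (rule module_family_ring_module) (rule V.R.is_cring)

lemma module_F: "module K F"
  using F.module_direct_sum by (simp add: free_module_eq_direct_sum)

lemma basis_vector_closed: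
  "v \<in> carrier V \<Longrightarrow> w \<in> carrier W \<Longrightarrow> basis_vector K (v, w) \<in> carrier F"
  unfolding basis_vector_eq_single free_module_eq_direct_sum
  by (rule F.single_closed) (auto simp: ring_module_def)

lemma relators_closed: "tensor_relators K V W \<subseteq> carrier F"
  unfolding tensor_relators_def Let_def
  by (auto simp: basis_vector_closed module_diff_closed[OF module_F] module_add_closed[OF module_F]
    module_smult_closed[OF module_F])

lemma submodule_N: "submodule N K F" and relators_N: "tensor_relators K V W \<subseteq> N"
  using submodule_submodule_span[OF module_F relators_closed] by (simp_all add: tensor_kernel_def)

lemma module_T: "module K T" and coset_linear: "(\<lambda>\<phi>. N +>\<^bsub>F\<^esub> \<phi>) \<in> linear_maps K F T"
  using module_quotient[OF module_F submodule_N] by (simp_all add: tensor_product_def)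

lemma carrier_T: "carrier T = (\<lambda>\<phi>. N +>\<^bsub>F\<^esub> \<phi>) ` carrier F"
  by (auto simp: tensor_product_def quotient_module_def A_RCOSETS_def')

text \<open>This is the sum that \<open>tensor_lift\<close> forms once a representative is fixed.
  Separated from the choice, it is a linear map on the free module.\<close>

definition lin_ext :: "('k, 'c) module \<Rightarrow> ('a \<Rightarrow> 'b \<Rightarrow> 'c) \<Rightarrow> ('a \<times> 'b \<Rightarrow> 'k) \<Rightarrow> 'c" where
  "lin_ext U \<beta> = sum_map (\<lambda>_. ring_module K) U (\<lambda>p a. a \<odot>\<^bsub>U\<^esub> \<beta> (fst p) (snd p))"

context
  fixes U :: "('k, 'c) module" and \<beta> :: "'a \<Rightarrow> 'b \<Rightarrow> 'c"
  assumes module_U: "module K U" and bilin: "\<beta> \<in> bilinear_maps K V W U"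
begin

lemma scale_linear:
  "p \<in> carrier V \<times> carrier W \<Longrightarrow>
    (\<lambda>a. a \<odot>\<^bsub>U\<^esub> \<beta> (fst p) (snd p)) \<in> linear_maps K (ring_module K) U"
  using bilinear_maps_simps(1)[OF bilin] module_U
  by (intro linear_mapsI) (auto simp: ring_module_def module.smult_l_distr module.smult_assoc1 module.smult_closed)

lemma lin_ext_linear: "lin_ext U \<beta> \<in> linear_maps K F U"
  unfolding lin_ext_def free_module_eq_direct_sum
  by (rule F.sum_map_linear[OF module_U]) (rule scale_linear)

lemma lin_ext_basis:
  "v \<in> carrier V \<Longrightarrow> w \<in> carrier W \<Longrightarrow> lin_ext U \<beta> (basis_vector K (v, w)) = \<beta> v w"
  unfolding lin_ext_def basis_vector_eq_single
  by (subst F.sum_map_single[OF module_U scale_linear])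
    (auto simp: ring_module_def module.smult_one[OF module_U] bilinear_maps_simps(1)[OF bilin])

text \<open>The kernel of \<open>lin_ext U \<beta>\<close> is a submodule, and bilinearity of
  \<open>\<beta>\<close> places every relator in it, while \<open>N\<close> is the least submodule
  containing the relators.\<close>

lemma lin_ext_N:
  assumes "\<phi> \<in> N"
  shows "lin_ext U \<beta> \<phi> = \<zero>\<^bsub>U\<^esub>"
proof -
  interpret U: module K U by (rule module_U)
  let ?k = "{\<phi> \<in> carrier F. lin_ext U \<beta> \<phi> = \<zero>\<^bsub>U\<^esub>}"
  note cl = module_diff_closed[OF module_F] module_add_closed[OF module_F] module_smult_closed[OF module_F]
    basis_vector_closed
  note l = lin_ext_linear
  have "submodule ?k K F" by (rule submodule_kernel[OF module_F module_U l])
  moreover have "tensor_relators K V W \<subseteq> ?k"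
  proof -
    have "lin_ext U \<beta> (x \<ominus>\<^bsub>F\<^esub> y) = \<zero>\<^bsub>U\<^esub>"
      if "x \<in> carrier F" "y \<in> carrier F" "lin_ext U \<beta> x = lin_ext U \<beta> y" for x y
      using that linear_maps_closed[OF l] by (simp add: linear_maps_diff[OF module_F module_U l] module_diff_eq_zero[OF module_U])
    then show ?thesis
      unfolding tensor_relators_def Let_def
      by (auto simp: cl linear_maps_add[OF l] linear_maps_smult[OF l] lin_ext_basis bilinear_maps_simps[OF bilin])
  qed
  ultimately have "N \<subseteq> ?k" unfolding tensor_kernel_def submodule_span_def by blast
  then show ?thesis using assms by blast
qed

text \<open>The representative taken by \<open>SOME\<close> differs from \<open>\<phi>\<close> by an
  element of \<open>N\<close>, where \<open>lin_ext\<close> vanishes. From here on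
  \<open>tensor_lift\<close> can be computed on any representative.\<close>

lemma tensor_lift_coset:
  assumes "\<phi> \<in> carrier F"
  shows "tensor_lift K U \<beta> (N +>\<^bsub>F\<^esub> \<phi>) = lin_ext U \<beta> \<phi>"
proof -
  interpret F': module K F by (rule module_F)
  define \<psi> where "\<psi> = (SOME \<psi>. \<psi> \<in> N +>\<^bsub>F\<^esub> \<phi>)"
  have "\<phi> \<in> N +>\<^bsub>F\<^esub> \<phi>"
    using assms submodule_zero[OF submodule_N] F'.M.l_zero[OF assms]
    by (force simp: a_r_coset_def')
  then have "\<psi> \<in> N +>\<^bsub>F\<^esub> \<phi>" unfolding \<psi>_def by (rule someI[where P = "\<lambda>\<psi>. \<psi> \<in> N +>\<^bsub>F\<^esub> \<phi>"])
  from quotient_coset_eq[OF module_F submodule_N assms this]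
  have *: "\<psi> \<in> carrier F" "\<psi> \<ominus>\<^bsub>F\<^esub> \<phi> \<in> N" .
  have "lin_ext U \<beta> \<psi> \<ominus>\<^bsub>U\<^esub> lin_ext U \<beta> \<phi> = \<zero>\<^bsub>U\<^esub>"
    using lin_ext_N[OF *(2)] linear_maps_diff[OF module_F module_U lin_ext_linear *(1) assms] by simp
  then have "lin_ext U \<beta> \<psi> = lin_ext U \<beta> \<phi>"
    using * assms linear_maps_closed[OF lin_ext_linear] by (simp add: module_diff_eq_zero[OF module_U])
  moreover have "tensor_lift K U \<beta> (N +>\<^bsub>F\<^esub> \<phi>) = lin_ext U \<beta> \<psi>"
    by (simp add: tensor_lift_def Let_def lin_ext_def sum_map_def \<psi>_def ring_module_def)
  ultimately show ?thesis by simp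
qed

lemma tensor_lift_linear: "tensor_lift K U \<beta> \<in> linear_maps K T U"
proof (rule linear_mapsI)
  show "tensor_lift K U \<beta> t \<in> carrier U" if "t \<in> carrier T" for t
    using that unfolding carrier_T by (auto simp: tensor_lift_coset linear_maps_closed[OF lin_ext_linear])
  fix s t assume "s \<in> carrier T" "t \<in> carrier T"
  then obtain \<phi> \<psi> where *: "\<phi> \<in> carrier F" "\<psi> \<in> carrier F" "s = N +>\<^bsub>F\<^esub> \<phi>" "t = N +>\<^bsub>F\<^esub> \<psi>"
    unfolding carrier_T by blast
  then have "s \<oplus>\<^bsub>T\<^esub> t = N +>\<^bsub>F\<^esub> (\<phi> \<oplus>\<^bsub>F\<^esub> \<psi>)" by (simp add: linear_maps_add[OF coset_linear])
  then show "tensor_lift K U \<beta> (s \<oplus>\<^bsub>T\<^esub> t) = tensor_lift K U \<beta> s \<oplus>\<^bsub>U\<^esub> tensor_lift K U \<beta> t"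
    using * by (simp add: tensor_lift_coset module_add_closed[OF module_F] linear_maps_add[OF lin_ext_linear])
next
  fix a t assume "a \<in> carrier K" "t \<in> carrier T"
  then obtain \<phi> where *: "a \<in> carrier K" "\<phi> \<in> carrier F" "t = N +>\<^bsub>F\<^esub> \<phi>"
    unfolding carrier_T by blast
  then have "a \<odot>\<^bsub>T\<^esub> t = N +>\<^bsub>F\<^esub> (a \<odot>\<^bsub>F\<^esub> \<phi>)" by (simp add: linear_maps_smult[OF coset_linear])
  then show "tensor_lift K U \<beta> (a \<odot>\<^bsub>T\<^esub> t) = a \<odot>\<^bsub>U\<^esub> tensor_lift K U \<beta> t"
    using * by (simp add: tensor_lift_coset module_smult_closed[OF module_F] linear_maps_smult[OF lin_ext_linear])
qed

lemma tensor_lift_pure: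
  "v \<in> carrier V \<Longrightarrow> w \<in> carrier W \<Longrightarrow> tensor_lift K U \<beta> (v \<otimes>\<^sub>T w) = \<beta> v w"
  by (simp add: pure_tensor_def tensor_lift_coset basis_vector_closed lin_ext_basis)

end

lemma pure_closed: "v \<in> carrier V \<Longrightarrow> w \<in> carrier W \<Longrightarrow> v \<otimes>\<^sub>T w \<in> carrier T"
  unfolding carrier_T pure_tensor_def by (simp add: basis_vector_closed)

text \<open>Each bilinearity law says that two combinations of basis vectors have the same coset;
  their difference is a relator, hence in \<open>N\<close>.\<close>

lemma pure_bilinear: "pure_tensor K V W \<in> bilinear_maps K V W T"
proof -
  interpret F': module K F by (rule module_F)
  have eq: "N +>\<^bsub>F\<^esub> x = N +>\<^bsub>F\<^esub> y" if "x \<in> carrier F" "y \<in> carrier F" "x \<ominus>\<^bsub>F\<^esub> y \<in> N" for x y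
  proof -
    have "N +>\<^bsub>F\<^esub> x = N +>\<^bsub>F\<^esub> ((x \<ominus>\<^bsub>F\<^esub> y) \<oplus>\<^bsub>F\<^esub> y)"
      using that by (simp add: module_diff_add[OF module_F])
    also have "\<dots> = (N +>\<^bsub>F\<^esub> (x \<ominus>\<^bsub>F\<^esub> y)) \<oplus>\<^bsub>T\<^esub> (N +>\<^bsub>F\<^esub> y)"
      using that by (simp add: linear_maps_add[OF coset_linear] module_diff_closed[OF module_F])
    also have "N +>\<^bsub>F\<^esub> (x \<ominus>\<^bsub>F\<^esub> y) = \<zero>\<^bsub>T\<^esub>"
      using F'.M.a_coset_join2[of "x \<ominus>\<^bsub>F\<^esub> y" N] that submodule.axioms(1)[OF submodule_N]
      by (simp add: tensor_product_def quotient_module_def)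
    also have "\<zero>\<^bsub>T\<^esub> \<oplus>\<^bsub>T\<^esub> (N +>\<^bsub>F\<^esub> y) = N +>\<^bsub>F\<^esub> y"
      using module_T linear_maps_closed[OF coset_linear that(2)]
      by (simp add: module_def abelian_group_def abelian_monoid.l_zero)
    finally show ?thesis .
  qed
  note cl = module_add_closed[OF module_F] module_smult_closed[OF module_F] basis_vector_closed
  note l = linear_maps_add[OF coset_linear] linear_maps_smult[OF coset_linear]
  have R: "r \<in> tensor_relators K V W \<Longrightarrow> r \<in> N" for r using relators_N by blast
  have "(v \<oplus>\<^bsub>V\<^esub> v') \<otimes>\<^sub>T w = v \<otimes>\<^sub>T w \<oplus>\<^bsub>T\<^esub> v' \<otimes>\<^sub>T w"
    if "v \<in> carrier V" "v' \<in> carrier V" "w \<in> carrier W" for v v' w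
    unfolding pure_tensor_def using that
    by (subst l(1)[symmetric], simp_all add: cl, intro eq R)
      (simp_all add: cl, unfold tensor_relators_def Let_def, blast)
  moreover have "v \<otimes>\<^sub>T (w \<oplus>\<^bsub>W\<^esub> w') = v \<otimes>\<^sub>T w \<oplus>\<^bsub>T\<^esub> v \<otimes>\<^sub>T w'"
    if "v \<in> carrier V" "w \<in> carrier W" "w' \<in> carrier W" for v w w'
    unfolding pure_tensor_def using that
    by (subst l(1)[symmetric], simp_all add: cl, intro eq R)
      (simp_all add: cl, unfold tensor_relators_def Let_def, blast)
  moreover have "(a \<odot>\<^bsub>V\<^esub> v) \<otimes>\<^sub>T w = a \<odot>\<^bsub>T\<^esub> (v \<otimes>\<^sub>T w)" "v \<otimes>\<^sub>T (a \<odot>\<^bsub>W\<^esub> w) = a \<odot>\<^bsub>T\<^esub> (v \<otimes>\<^sub>T w)"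
    if "a \<in> carrier K" "v \<in> carrier V" "w \<in> carrier W" for a v w
    unfolding pure_tensor_def using that
    by (subst l(2)[symmetric], simp_all add: cl, intro eq R,
      simp_all add: cl, unfold tensor_relators_def Let_def, blast)+
  ultimately show ?thesis by (intro bilinear_mapsI linear_mapsI) (auto intro: pure_closed)
qed

text \<open>Pure tensors suffice without coefficients, because the scalar in
  \<open>a (v \<otimes> w)\<close> moves into the first factor.\<close>

lemma tensor_induct [consumes 1, case_names zero add]:
  assumes "t \<in> carrier T"
    and zero: "P \<zero>\<^bsub>T\<^esub>"
    and add: "\<And>v w t. v \<in> carrier V \<Longrightarrow> w \<in> carrier W \<Longrightarrow> t \<in> carrier T \<Longrightarrow> P t \<Longrightarrow>
      P (v \<otimes>\<^sub>T w \<oplus>\<^bsub>T\<^esub> t)"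
  shows "P t"
proof -
  obtain \<phi> where \<phi>: "\<phi> \<in> carrier F" "t = N +>\<^bsub>F\<^esub> \<phi>"
    using assms(1) unfolding carrier_T by blast
  have "P (N +>\<^bsub>F\<^esub> \<phi>)"
    using \<phi>(1) unfolding free_module_eq_direct_sum
  proof (induction \<phi> rule: F.direct_sum_induct)
    case zero
    show ?case
      using assms(2) linear_maps_zero[OF module_F module_T coset_linear]
      by (simp add: free_module_eq_direct_sum)
  next
    case (add p a \<psi>)
    obtain v w where p: "p = (v, w)" "v \<in> carrier V" "w \<in> carrier W" using add(1) by auto
    have a: "a \<in> carrier K" using add(2) by (simp add: ring_module_def)
    have "single (\<lambda>_. ring_module K) p a = a \<odot>\<^bsub>F\<^esub> basis_vector K (v, w)"
      using a unfolding free_module_eq_direct_sum F.direct_sum_simps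
      by (auto simp: single_def basis_vector_def ring_module_def p)
    then have "N +>\<^bsub>F\<^esub> (single (\<lambda>_. ring_module K) p a \<oplus>\<^bsub>F\<^esub> \<psi>) =
        a \<odot>\<^bsub>T\<^esub> (v \<otimes>\<^sub>T w) \<oplus>\<^bsub>T\<^esub> (N +>\<^bsub>F\<^esub> \<psi>)"
      using p a add(3) by (simp add: linear_maps_add[OF coset_linear] linear_maps_smult[OF coset_linear]
        basis_vector_closed module_smult_closed[OF module_F] pure_tensor_def free_module_eq_direct_sum[symmetric])
    also have "a \<odot>\<^bsub>T\<^esub> (v \<otimes>\<^sub>T w) = (a \<odot>\<^bsub>V\<^esub> v) \<otimes>\<^sub>T w"
      using bilinear_maps_simps(4)[OF pure_bilinear] p a by simp
    finally show ?case
      using assms(3)[of "a \<odot>\<^bsub>V\<^esub> v" w "N +>\<^bsub>F\<^esub> \<psi>"] p a add linear_maps_closed[OF coset_linear]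
      by (simp add: free_module_eq_direct_sum)
  qed
  then show ?thesis using \<phi> by simp
qed

lemma linear_maps_eq_on_pure:
  assumes "module K U" "f \<in> linear_maps K T U" "g \<in> linear_maps K T U"
    and "\<And>v w. v \<in> carrier V \<Longrightarrow> w \<in> carrier W \<Longrightarrow> f (v \<otimes>\<^sub>T w) = g (v \<otimes>\<^sub>T w)"
    and "t \<in> carrier T"
  shows "f t = g t"
  using assms(5)
  by (induction t rule: tensor_induct)
    (auto simp: linear_maps_zero[OF module_T assms(1)] assms(2-4) linear_maps_add[OF assms(2)]
      linear_maps_add[OF assms(3)] pure_closed)

text \<open>Both sides of each linearity law in \<open>a\<close> are linear in \<open>t\<close>, so
  they need only be compared on pure tensors, where the lift is \<open>\<beta> a v w\<close>.
  Composition of tensors is a lift inside a lift, and such parameters occur at both levels.\<close>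

lemma tensor_lift_linear_parameter:
  assumes U: "module K U" and A: "module K A"
    and b: "\<And>a. a \<in> carrier A \<Longrightarrow> \<beta> a \<in> bilinear_maps K V W U"
    and l: "\<And>v w. v \<in> carrier V \<Longrightarrow> w \<in> carrier W \<Longrightarrow> (\<lambda>a. \<beta> a v w) \<in> linear_maps K A U"
    and t: "t \<in> carrier T"
  shows "(\<lambda>a. tensor_lift K U (\<beta> a) t) \<in> linear_maps K A U"
proof (rule linear_mapsI)
  note L = tensor_lift_linear[OF U b] and P = tensor_lift_pure[OF U b]
  show "tensor_lift K U (\<beta> a) t \<in> carrier U" if "a \<in> carrier A" for a
    using linear_maps_closed[OF L t] that .
  show "tensor_lift K U (\<beta> (a \<oplus>\<^bsub>A\<^esub> a')) t = tensor_lift K U (\<beta> a) t \<oplus>\<^bsub>U\<^esub> tensor_lift K U (\<beta> a') t"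
    if "a \<in> carrier A" "a' \<in> carrier A" for a a'
    by (rule linear_maps_eq_on_pure[OF U _ linear_maps_plus[OF U]])
      (use that in \<open>auto simp: L P t module_add_closed[OF A] linear_maps_add[OF l]\<close>)
  show "tensor_lift K U (\<beta> (c \<odot>\<^bsub>A\<^esub> a)) t = c \<odot>\<^bsub>U\<^esub> tensor_lift K U (\<beta> a) t"
    if "c \<in> carrier K" "a \<in> carrier A" for c a
    by (rule linear_maps_eq_on_pure[OF U _ linear_maps_scale[OF U]])
      (use that in \<open>auto simp: L P t module_smult_closed[OF A] linear_maps_smult[OF l]\<close>)
qed

end

section \<open>Tensor products of linear categories\<close>

context linear_category
begin

lemma Comp_bilinear:
  "\<lbrakk>x \<in> Obj C; y \<in> Obj C; z \<in> Obj C\<rbrakk> \<Longrightarrow>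
    Comp C x y z \<in> bilinear_maps K (Hom C y z) (Hom C x y) (Hom C x z)"
  using Comp_linear_left Comp_linear_right by (intro bilinear_mapsI) auto

lemma Comp_closed:
  "\<lbrakk>x \<in> Obj C; y \<in> Obj C; z \<in> Obj C; g \<in> carrier (Hom C y z); f \<in> carrier (Hom C x y)\<rbrakk> \<Longrightarrow>
    Comp C x y z g f \<in> carrier (Hom C x z)"
  by (rule bilinear_maps_simps(1)[OF Comp_bilinear])

end

lemma opposite_simps [simp]:
  "Obj (opposite C) = Obj C" "Hom (opposite C) x y = Hom C y x" "Id (opposite C) = Id C"
  "Comp (opposite C) x y z g f = Comp C z y x f g"
  by (simp_all add: opposite_def)

lemma linear_category_opposite:
  assumes "linear_category K C"
  shows "linear_category K (opposite C)"
proof -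
  interpret linear_category K C by fact
  show ?thesis
    by (rule linear_category.intro)
      (simp_all add: Hom_module Id_closed Comp_linear_left Comp_linear_right Comp_Id_left Comp_Id_right Comp_assoc)
qed

locale two_linear_categories = C: linear_category K C + D: linear_category K D
  for K :: "('k, 'r) ring_scheme" and C :: "('o, 'k, 'a) lincat" and D :: "('p, 'k, 'b) lincat"
begin

abbreviation "E \<equiv> tensor_category K C D"

lemma E_simps [simp]:
  "Obj E = Obj C \<times> Obj D"
  "Hom E (x, x') (y, y') = tensor_product K (Hom C x y) (Hom D x' y')"
  "Id E (x, x') = pure_tensor K (Hom C x x) (Hom D x' x') (Id C x) (Id D x')"
  by (simp_all add: tensor_category_def Let_def)

lemma Comp_E:
  "Comp E (x, x') (y, y') (z, z') s t =
     tensor_lift K (tensor_product K (Hom C x z) (Hom D x' z'))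
       (\<lambda>g g'. tensor_lift K (tensor_product K (Hom C x z) (Hom D x' z'))
         (\<lambda>f f'. pure_tensor K (Hom C x z) (Hom D x' z')
            (Comp C x y z g f) (Comp D x' y' z' g' f')) t) s"
  by (simp_all add: tensor_category_def Let_def)

lemma tensor: "\<lbrakk>x \<in> Obj C; y \<in> Obj C; x' \<in> Obj D; y' \<in> Obj D\<rbrakk> \<Longrightarrow> tensor K (Hom C x y) (Hom D x' y')"
  by (simp add: tensor_def C.Hom_module D.Hom_module)

context
  fixes x y z x' y' z'
  assumes obj: "x \<in> Obj C" "y \<in> Obj C" "z \<in> Obj C" "x' \<in> Obj D" "y' \<in> Obj D" "z' \<in> Obj D"
begin

lemma pure_comp_linear:
  defines "P \<equiv> pure_tensor K (Hom C x z) (Hom D x' z')" and "T \<equiv> tensor_product K (Hom C x z) (Hom D x' z')"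
  shows "g \<in> carrier (Hom C y z) \<Longrightarrow> g' \<in> carrier (Hom D y' z') \<Longrightarrow> f' \<in> carrier (Hom D x' y') \<Longrightarrow>
      (\<lambda>f. P (Comp C x y z g f) (Comp D x' y' z' g' f')) \<in> linear_maps K (Hom C x y) T"
    and "g \<in> carrier (Hom C y z) \<Longrightarrow> f \<in> carrier (Hom C x y) \<Longrightarrow> g' \<in> carrier (Hom D y' z') \<Longrightarrow>
      (\<lambda>f'. P (Comp C x y z g f) (Comp D x' y' z' g' f')) \<in> linear_maps K (Hom D x' y') T"
    and "f \<in> carrier (Hom C x y) \<Longrightarrow> g' \<in> carrier (Hom D y' z') \<Longrightarrow> f' \<in> carrier (Hom D x' y') \<Longrightarrow>
      (\<lambda>g. P (Comp C x y z g f) (Comp D x' y' z' g' f')) \<in> linear_maps K (Hom C y z) T"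
    and "g \<in> carrier (Hom C y z) \<Longrightarrow> f \<in> carrier (Hom C x y) \<Longrightarrow> f' \<in> carrier (Hom D x' y') \<Longrightarrow>
      (\<lambda>g'. P (Comp C x y z g f) (Comp D x' y' z' g' f')) \<in> linear_maps K (Hom D y' z') T"
  unfolding P_def T_def
  using bilinear_mapsD[OF tensor.pure_bilinear[OF tensor[OF obj(1,3,4,6)]]]
    C.Comp_closed[OF obj(1-3)] D.Comp_closed[OF obj(4-6)]
  by (auto intro: linear_maps_comp[OF C.Comp_linear_right[OF obj(1-3)]]
    linear_maps_comp[OF D.Comp_linear_right[OF obj(4-6)]]
    linear_maps_comp[OF C.Comp_linear_left[OF obj(1-3)]]
    linear_maps_comp[OF D.Comp_linear_left[OF obj(4-6)]])

lemmas tensor_xy = tensor[OF obj(1,2,4,5)]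
lemmas tensor_yz = tensor[OF obj(2,3,5,6)]
lemmas tensor_xz = tensor[OF obj(1,3,4,6)]
lemmas module_xz = tensor.module_T[OF tensor_xz]

lemma pure_comp_bilinear:
  "g \<in> carrier (Hom C y z) \<Longrightarrow> g' \<in> carrier (Hom D y' z') \<Longrightarrow>
    (\<lambda>f f'. pure_tensor K (Hom C x z) (Hom D x' z') (Comp C x y z g f) (Comp D x' y' z' g' f'))
    \<in> bilinear_maps K (Hom C x y) (Hom D x' y') (tensor_product K (Hom C x z) (Hom D x' z'))"
  by (intro bilinear_mapsI pure_comp_linear)

text \<open>The inner lift has to be bilinear in \<open>g\<close> and \<open>g'\<close> before the
  outer lift in \<open>Comp\<close> means anything. After that, linearity in the left factor is
  linearity of a lift, and linearity in the right factor is dependence on a parameter.\<close>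

lemma lift_comp_bilinear:
  assumes "t \<in> carrier (tensor_product K (Hom C x y) (Hom D x' y'))"
  shows "(\<lambda>g g'. tensor_lift K (tensor_product K (Hom C x z) (Hom D x' z'))
         (\<lambda>f f'. pure_tensor K (Hom C x z) (Hom D x' z')
            (Comp C x y z g f) (Comp D x' y' z' g' f')) t)
    \<in> bilinear_maps K (Hom C y z) (Hom D y' z') (tensor_product K (Hom C x z) (Hom D x' z'))"
  by (intro bilinear_mapsI tensor.tensor_lift_linear_parameter[OF tensor_xy module_xz] assms
      pure_comp_linear pure_comp_bilinear C.Hom_module D.Hom_module obj)

lemma Comp_E_linear_left:
  assumes "t \<in> carrier (Hom E (x, x') (y, y'))"
  shows "(\<lambda>s. Comp E (x, x') (y, y') (z, z') s t) \<in> linear_maps K (Hom E (y, y') (z, z')) (Hom E (x, x') (z, z'))"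
  using tensor.tensor_lift_linear[OF tensor_yz module_xz lift_comp_bilinear] assms by (simp add: Comp_E)

lemma Comp_E_linear_right:
  assumes "s \<in> carrier (Hom E (y, y') (z, z'))"
  shows "(\<lambda>t. Comp E (x, x') (y, y') (z, z') s t) \<in> linear_maps K (Hom E (x, x') (y, y')) (Hom E (x, x') (z, z'))"
  unfolding E_simps Comp_E
  by (rule tensor.tensor_lift_linear_parameter[OF tensor_yz module_xz])
    (use assms in \<open>simp_all add: tensor.module_T tensor_xy lift_comp_bilinear
      tensor.tensor_lift_linear[OF tensor_xy module_xz] pure_comp_bilinear\<close>)

lemma Comp_E_pure:
  assumes "g \<in> carrier (Hom C y z)" "f \<in> carrier (Hom C x y)"
    "g' \<in> carrier (Hom D y' z')" "f' \<in> carrier (Hom D x' y')"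
  shows "Comp E (x, x') (y, y') (z, z')
      (pure_tensor K (Hom C y z) (Hom D y' z') g g') (pure_tensor K (Hom C x y) (Hom D x' y') f f') =
    pure_tensor K (Hom C x z) (Hom D x' z') (Comp C x y z g f) (Comp D x' y' z' g' f')"
  using assms unfolding E_simps Comp_E
  by (subst tensor.tensor_lift_pure[OF tensor_yz module_xz lift_comp_bilinear])
    (simp_all add: tensor.pure_closed[OF tensor_xy] tensor.tensor_lift_pure[OF tensor_xy module_xz] pure_comp_bilinear)

end

text \<open>The unit and associativity laws equate maps that are linear in each tensor, so they
  reduce to pure tensors, where they are the law of \<open>C\<close> paired with that of
  \<open>D\<close>. For associativity the three arguments cease to be pure one at a time:
  \<open>f\<close>, then \<open>g\<close>, then \<open>h\<close>.\<close>

lemma E_linear_category: "linear_category K E"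
proof (rule linear_category.intro)
  fix p q assume "p \<in> Obj E" "q \<in> Obj E"
  then show "module K (Hom E p q)" using tensor.module_T[OF tensor] by (cases p; cases q) auto
next
  fix p assume "p \<in> Obj E"
  then show "Id E p \<in> carrier (Hom E p p)"
    by (cases p) (auto intro!: tensor.pure_closed tensor C.Id_closed D.Id_closed)
next
  fix p q r t assume "p \<in> Obj E" "q \<in> Obj E" "r \<in> Obj E" "t \<in> carrier (Hom E p q)"
  then show "(\<lambda>s. Comp E p q r s t) \<in> linear_maps K (Hom E q r) (Hom E p r)"
    by (cases p; cases q; cases r) (simp only: E_simps(1) mem_Sigma_iff Comp_E_linear_left)
next
  fix p q r s assume "p \<in> Obj E" "q \<in> Obj E" "r \<in> Obj E" "s \<in> carrier (Hom E q r)"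
  then show "(\<lambda>t. Comp E p q r s t) \<in> linear_maps K (Hom E p q) (Hom E p r)"
    by (cases p; cases q; cases r) (simp only: E_simps(1) mem_Sigma_iff Comp_E_linear_right)
next
  fix p q t assume *: "p \<in> Obj E" "q \<in> Obj E" "t \<in> carrier (Hom E p q)"
  obtain x x' y y' where [simp]: "p = (x, x')" "q = (y, y')" by (cases p; cases q) auto
  have obj: "x \<in> Obj C" "y \<in> Obj C" "x' \<in> Obj D" "y' \<in> Obj D" using * by auto
  interpret xy: tensor K "Hom C x y" "Hom D x' y'" by (rule tensor[OF obj])
  note id = tensor.pure_closed[OF tensor] C.Id_closed D.Id_closed
  have "Comp E (x, x') (y, y') (y, y') (Id E (y, y')) t = t"
    by (rule xy.linear_maps_eq_on_pure[OF xy.module_T, where g = "\<lambda>t. t"])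
      (use * obj Comp_E_linear_right[of x y y x' y' y' "Id E (y, y')"] id in
       \<open>simp_all add: Comp_E_pure C.Comp_Id_left D.Comp_Id_left linear_mapsI\<close>)
  then show "Comp E p q q (Id E q) t = t" by (simp del: E_simps)
  have "Comp E (x, x') (x, x') (y, y') t (Id E (x, x')) = t"
    by (rule xy.linear_maps_eq_on_pure[OF xy.module_T, where g = "\<lambda>t. t"])
      (use * obj Comp_E_linear_left[of x x y x' x' y' "Id E (x, x')"] id in
       \<open>simp_all add: Comp_E_pure C.Comp_Id_right D.Comp_Id_right linear_mapsI\<close>)
  then show "Comp E p p q t (Id E p) = t" by (simp del: E_simps)
next
  fix e p q r f g h
  assume *: "e \<in> Obj E" "p \<in> Obj E" "q \<in> Obj E" "r \<in> Obj E"
    and h: "f \<in> carrier (Hom E e p)" "g \<in> carrier (Hom E p q)" "h \<in> carrier (Hom E q r)"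
  obtain w x y z w' x' y' z' where [simp]: "e = (w, w')" "p = (x, x')" "q = (y, y')" "r = (z, z')"
    by (cases e; cases p; cases q; cases r) auto
  have obj: "w \<in> Obj C" "x \<in> Obj C" "y \<in> Obj C" "z \<in> Obj C"
    "w' \<in> Obj D" "x' \<in> Obj D" "y' \<in> Obj D" "z' \<in> Obj D" using * by auto
  interpret wx: tensor K "Hom C w x" "Hom D w' x'" by (rule tensor) (use obj in auto)
  interpret xy: tensor K "Hom C x y" "Hom D x' y'" by (rule tensor) (use obj in auto)
  interpret yz: tensor K "Hom C y z" "Hom D y' z'" by (rule tensor) (use obj in auto)
  interpret wz: tensor K "Hom C w z" "Hom D w' z'" by (rule tensor) (use obj in auto)
  note pc = wx.pure_closed xy.pure_closed yz.pure_closed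
  note L = Comp_E_linear_left[unfolded E_simps(2)] and R = Comp_E_linear_right[unfolded E_simps(2)]
  note cl = linear_maps_closed[OF R]
  let ?W = "(w, w')" and ?X = "(x, x')" and ?Y = "(y, y')" and ?Z = "(z, z')"
  let ?l = "\<lambda>h g f. Comp E ?W ?X ?Z (Comp E ?X ?Y ?Z h g) f"
  let ?r = "\<lambda>h g f. Comp E ?W ?Y ?Z h (Comp E ?W ?X ?Y g f)"
  have lf: "?l h g \<in> linear_maps K wx.T wz.T" "?r h g \<in> linear_maps K wx.T wz.T"
    if "g \<in> carrier xy.T" "h \<in> carrier yz.T" for g h
    using that obj by (auto intro!: R linear_maps_comp[OF R R] cl)
  have lg: "(\<lambda>g. ?l h g f) \<in> linear_maps K xy.T wz.T" "(\<lambda>g. ?r h g f) \<in> linear_maps K xy.T wz.T"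
    if "f \<in> carrier wx.T" "h \<in> carrier yz.T" for f h
    using that obj by (auto intro!: linear_maps_comp[OF R L] linear_maps_comp[OF L R])
  have lh: "(\<lambda>h. ?l h g f) \<in> linear_maps K yz.T wz.T" "(\<lambda>h. ?r h g f) \<in> linear_maps K yz.T wz.T"
    if "f \<in> carrier wx.T" "g \<in> carrier xy.T" for f g
    using that obj by (auto intro!: linear_maps_comp[OF L L] L cl)
  have 1: "?l (pure_tensor K (Hom C y z) (Hom D y' z') c c') (pure_tensor K (Hom C x y) (Hom D x' y') b b')
       (pure_tensor K (Hom C w x) (Hom D w' x') a a') =
     ?r (pure_tensor K (Hom C y z) (Hom D y' z') c c') (pure_tensor K (Hom C x y) (Hom D x' y') b b')
       (pure_tensor K (Hom C w x) (Hom D w' x') a a')"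
    if "a \<in> carrier (Hom C w x)" "a' \<in> carrier (Hom D w' x')" "b \<in> carrier (Hom C x y)"
      "b' \<in> carrier (Hom D x' y')" "c \<in> carrier (Hom C y z)" "c' \<in> carrier (Hom D y' z')" for a a' b b' c c'
    using that obj by (simp add: Comp_E_pure C.Comp_closed D.Comp_closed C.Comp_assoc D.Comp_assoc del: E_simps)
  have 2: "?l (pure_tensor K (Hom C y z) (Hom D y' z') c c') (pure_tensor K (Hom C x y) (Hom D x' y') b b') f =
     ?r (pure_tensor K (Hom C y z) (Hom D y' z') c c') (pure_tensor K (Hom C x y) (Hom D x' y') b b') f"
    if "b \<in> carrier (Hom C x y)"
      "b' \<in> carrier (Hom D x' y')" "c \<in> carrier (Hom C y z)" "c' \<in> carrier (Hom D y' z')"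
      "f \<in> carrier wx.T" for b b' c c' f
    by (rule wx.linear_maps_eq_on_pure[OF wz.module_T lf]) (use that 1 pc in auto)
  have 3: "?l (pure_tensor K (Hom C y z) (Hom D y' z') c c') g f =
     ?r (pure_tensor K (Hom C y z) (Hom D y' z') c c') g f"
    if "c \<in> carrier (Hom C y z)" "c' \<in> carrier (Hom D y' z')"
      "f \<in> carrier wx.T" "g \<in> carrier xy.T" for c c' f g
    by (rule xy.linear_maps_eq_on_pure[OF wz.module_T lg]) (use that 2 pc in auto)
  have "?l h g f = ?r h g f"
    by (rule yz.linear_maps_eq_on_pure[OF wz.module_T lh]) (use h 3 in auto)
  then show "Comp E e p r (Comp E p q r h g) f = Comp E e q r h (Comp E e p q g f)"
    by (simp del: E_simps)
qed

end

section \<open>Left modules\<close>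

lemma vect_simps [simp]:
  "V \<in> Obj (vect K) \<longleftrightarrow> module K V"
  "carrier (Hom (vect K) V W) = linear_maps K V W \<inter> extensional (carrier V)"
  "\<zero>\<^bsub>Hom (vect K) V W\<^esub> = (\<lambda>v\<in>carrier V. \<zero>\<^bsub>W\<^esub>)"
  "f \<oplus>\<^bsub>Hom (vect K) V W\<^esub> g = (\<lambda>v\<in>carrier V. f v \<oplus>\<^bsub>W\<^esub> g v)"
  "a \<odot>\<^bsub>Hom (vect K) V W\<^esub> f = (\<lambda>v\<in>carrier V. a \<odot>\<^bsub>W\<^esub> f v)"
  "Id (vect K) V = (\<lambda>v\<in>carrier V. v)"
  "Comp (vect K) U V W g f = compose (carrier U) g f"
  by (simp_all add: vect_def)

lemma Obj_left_modules: "X \<in> Obj (left_modules K C) \<longleftrightarrow> linear_functor K C (vect K) X"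
  by (simp add: left_modules_def functor_category_def)

text \<open>Unlike morphisms of \<^const>\<open>left_modules\<close>, these may connect modules in different universes.\<close>

definition module_maps ::
  "('k, 'r) ring_scheme \<Rightarrow> ('o, 'k, 'a) lincat \<Rightarrow> ('o, 'k, 'a, 'v) left_module
    \<Rightarrow> ('o, 'k, 'a, 'w) left_module \<Rightarrow> ('o \<Rightarrow> 'v \<Rightarrow> 'w) set" where
  "module_maps K C X Y = {\<eta>. (\<forall>x\<in>Obj C. \<eta> x \<in> linear_maps K (fobj X x) (fobj Y x)) \<and>
     (\<forall>x\<in>Obj C. \<forall>y\<in>Obj C. \<forall>f\<in>carrier (Hom C x y). \<forall>v\<in>carrier (fobj X x).
        \<eta> y (farr X x y f v) = farr Y x y f (\<eta> x v))}"

definition pointwise_surj ::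
  "('o, 'k, 'a) lincat \<Rightarrow> ('o, 'k, 'a, 'v) left_module \<Rightarrow> ('o, 'k, 'a, 'w) left_module
    \<Rightarrow> ('o \<Rightarrow> 'v \<Rightarrow> 'w) \<Rightarrow> bool" where
  "pointwise_surj C X Y \<eta> \<longleftrightarrow> (\<forall>x\<in>Obj C. \<eta> x ` carrier (fobj X x) = carrier (fobj Y x))"

lemma module_mapsI:
  assumes "\<And>x. x \<in> Obj C \<Longrightarrow> \<eta> x \<in> linear_maps K (fobj X x) (fobj Y x)"
    and "\<And>x y f v. \<lbrakk>x \<in> Obj C; y \<in> Obj C; f \<in> carrier (Hom C x y); v \<in> carrier (fobj X x)\<rbrakk> \<Longrightarrow>
      \<eta> y (farr X x y f v) = farr Y x y f (\<eta> x v)"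
  shows "\<eta> \<in> module_maps K C X Y"
  using assms by (auto simp: module_maps_def)

lemma module_maps_linear: "\<eta> \<in> module_maps K C X Y \<Longrightarrow> x \<in> Obj C \<Longrightarrow> \<eta> x \<in> linear_maps K (fobj X x) (fobj Y x)"
  by (auto simp: module_maps_def)

lemma module_maps_closed:
  "\<eta> \<in> module_maps K C X Y \<Longrightarrow> x \<in> Obj C \<Longrightarrow> v \<in> carrier (fobj X x) \<Longrightarrow> \<eta> x v \<in> carrier (fobj Y x)"
  by (rule linear_maps_closed[OF module_maps_linear])

lemma module_maps_natural:
  "\<lbrakk>\<eta> \<in> module_maps K C X Y; x \<in> Obj C; y \<in> Obj C; f \<in> carrier (Hom C x y); v \<in> carrier (fobj X x)\<rbrakk> \<Longrightarrow>
      \<eta> y (farr X x y f v) = farr Y x y f (\<eta> x v)"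
  by (auto simp: module_maps_def)

lemma module_maps_comp:
  assumes "\<eta> \<in> module_maps K C X Y" "\<theta> \<in> module_maps K C Y Z"
  shows "(\<lambda>x v. \<theta> x (\<eta> x v)) \<in> module_maps K C X Z"
proof (rule module_mapsI)
  show "(\<lambda>v. \<theta> x (\<eta> x v)) \<in> linear_maps K (fobj X x) (fobj Z x)" if "x \<in> Obj C" for x
    by (rule linear_maps_comp[OF module_maps_linear[OF assms(1) that] module_maps_linear[OF assms(2) that]])
qed (simp add: module_maps_natural[OF assms(1)] module_maps_natural[OF assms(2)] module_maps_closed[OF assms(1)])

locale left_module = C: linear_category K C + linear_functor K C "vect K" X
  for K :: "('k, 'r) ring_scheme" and C :: "('o, 'k, 'a) lincat" and X :: "('o, 'k, 'a, 'v) left_module"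
begin

lemma module_fobj: "x \<in> Obj C \<Longrightarrow> module K (fobj X x)"
  using fobj_closed by simp

lemma farr_map:
  "\<lbrakk>x \<in> Obj C; y \<in> Obj C; f \<in> carrier (Hom C x y)\<rbrakk> \<Longrightarrow> farr X x y f \<in> linear_maps K (fobj X x) (fobj X y)"
  "\<lbrakk>x \<in> Obj C; y \<in> Obj C; f \<in> carrier (Hom C x y)\<rbrakk> \<Longrightarrow> farr X x y f \<in> extensional (carrier (fobj X x))"
  using linear_maps_closed[OF farr_linear] by auto

lemma farr_closed:
  "\<lbrakk>x \<in> Obj C; y \<in> Obj C; f \<in> carrier (Hom C x y); v \<in> carrier (fobj X x)\<rbrakk> \<Longrightarrow>
    farr X x y f v \<in> carrier (fobj X y)"
  by (rule linear_maps_closed[OF farr_map(1)])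

lemma farr_linear_arrow:
  assumes "x \<in> Obj C" "y \<in> Obj C" "v \<in> carrier (fobj X x)"
  shows "(\<lambda>f. farr X x y f v) \<in> linear_maps K (Hom C x y) (fobj X y)"
  using assms by (intro linear_mapsI)
    (auto simp: farr_closed linear_maps_add[OF farr_linear] linear_maps_smult[OF farr_linear])

lemma farr_bilinear:
  assumes "x \<in> Obj C" "y \<in> Obj C"
  shows "farr X x y \<in> bilinear_maps K (Hom C x y) (fobj X x) (fobj X y)"
  using assms by (intro bilinear_mapsI) (auto simp: farr_map farr_linear_arrow)

lemma farr_Id_apply: "x \<in> Obj C \<Longrightarrow> v \<in> carrier (fobj X x) \<Longrightarrow> farr X x x (Id C x) v = v"
  by (simp add: farr_Id)

lemma farr_Comp_apply:
  "\<lbrakk>x \<in> Obj C; y \<in> Obj C; z \<in> Obj C; f \<in> carrier (Hom C x y); g \<in> carrier (Hom C y z);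
    v \<in> carrier (fobj X x)\<rbrakk> \<Longrightarrow>
    farr X x z (Comp C x y z g f) v = farr X y z g (farr X x y f v)"
  by (simp add: farr_Comp compose_def)

end

context linear_category
begin

lemma left_module_iff: "left_module K C X \<longleftrightarrow> X \<in> Obj (left_modules K C)"
  by (simp add: Obj_left_modules left_module_def linear_category_axioms)

text \<open>The functor is described through its action, bilinear in arrow and vector, with laws
  checked vector by vector. Extensionality is a separate condition: arrows of \<open>vect\<close>
  are restricted functions, and the functor laws are equalities between such functions.\<close>

lemma left_moduleI:
  assumes m: "\<And>x. x \<in> Obj C \<Longrightarrow> module K (fobj X x)"
    and b: "\<And>x y. \<lbrakk>x \<in> Obj C; y \<in> Obj C\<rbrakk> \<Longrightarrow> farr X x y \<in> bilinear_maps K (Hom C x y) (fobj X x) (fobj X y)"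
    and e: "\<And>x y f. \<lbrakk>x \<in> Obj C; y \<in> Obj C; f \<in> carrier (Hom C x y)\<rbrakk> \<Longrightarrow>
      farr X x y f \<in> extensional (carrier (fobj X x))"
    and i: "\<And>x v. \<lbrakk>x \<in> Obj C; v \<in> carrier (fobj X x)\<rbrakk> \<Longrightarrow> farr X x x (Id C x) v = v"
    and c: "\<And>x y z f g v. \<lbrakk>x \<in> Obj C; y \<in> Obj C; z \<in> Obj C; f \<in> carrier (Hom C x y);
      g \<in> carrier (Hom C y z); v \<in> carrier (fobj X x)\<rbrakk> \<Longrightarrow>
      farr X x z (Comp C x y z g f) v = farr X y z g (farr X x y f v)"
  shows "left_module K C X"
proof (intro left_module.intro linear_category_axioms linear_functor.intro)
  note H = module_add_closed[OF Hom_module] module_smult_closed[OF Hom_module]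
  fix x y assume xy: "x \<in> Obj C" "y \<in> Obj C"
  show "farr X x y \<in> linear_maps K (Hom C x y) (Hom (vect K) (fobj X x) (fobj X y))"
  proof (rule linear_mapsI)
    show "farr X x y f \<in> carrier (Hom (vect K) (fobj X x) (fobj X y))" if "f \<in> carrier (Hom C x y)" for f
      using that xy bilinear_mapsD(1)[OF b] e by simp
    show "farr X x y (f \<oplus>\<^bsub>Hom C x y\<^esub> f') =
        farr X x y f \<oplus>\<^bsub>Hom (vect K) (fobj X x) (fobj X y)\<^esub> farr X x y f'"
      if "f \<in> carrier (Hom C x y)" "f' \<in> carrier (Hom C x y)" for f f'
      by (rule extensionalityI[where A = "carrier (fobj X x)"])
        (use that xy e H bilinear_maps_simps[OF b] in auto)
    show "farr X x y (a \<odot>\<^bsub>Hom C x y\<^esub> f) = a \<odot>\<^bsub>Hom (vect K) (fobj X x) (fobj X y)\<^esub> farr X x y f"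
      if "a \<in> carrier K" "f \<in> carrier (Hom C x y)" for a f
      by (rule extensionalityI[where A = "carrier (fobj X x)"])
        (use that xy e H bilinear_maps_simps[OF b] in auto)
  qed
next
  fix x assume x: "x \<in> Obj C"
  show "fobj X x \<in> Obj (vect K)" using m x by simp
  show "farr X x x (Id C x) = Id (vect K) (fobj X x)"
    by (rule extensionalityI[where A = "carrier (fobj X x)"]) (use x e i Id_closed in auto)
next
  fix x y z f g
  assume *: "x \<in> Obj C" "y \<in> Obj C" "z \<in> Obj C" "f \<in> carrier (Hom C x y)" "g \<in> carrier (Hom C y z)"
  show "farr X x z (Comp C x y z g f) =
       Comp (vect K) (fobj X x) (fobj X y) (fobj X z) (farr X y z g) (farr X x y f)"
    by (rule extensionalityI[where A = "carrier (fobj X x)"]) (use * e c Comp_closed in \<open>auto simp: compose_def\<close>)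
qed

text \<open>Passes from a family of maps, of interest only on carriers, to the representative that
  counts as a morphism of \<open>left_modules\<close>: \<open>undefined\<close> off the objects and
  off the carriers.\<close>

definition restrict_map ::
  "('o, 'k, 'a, 'v) left_module \<Rightarrow> ('o \<Rightarrow> 'v \<Rightarrow> 'w) \<Rightarrow> 'o \<Rightarrow> 'v \<Rightarrow> 'w" where
  "restrict_map X \<eta> = (\<lambda>x\<in>Obj C. \<lambda>v\<in>carrier (fobj X x). \<eta> x v)"

lemma restrict_map_apply [simp]:
  "x \<in> Obj C \<Longrightarrow> v \<in> carrier (fobj X x) \<Longrightarrow> restrict_map X \<eta> x v = \<eta> x v"
  by (simp add: restrict_map_def)

lemma left_modules_simps [simp]:
  "carrier (Hom (left_modules K C) X Y) = natural_transformations C (vect K) X Y"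
  "\<zero>\<^bsub>Hom (left_modules K C) X Y\<^esub> = (\<lambda>x\<in>Obj C. \<lambda>v\<in>carrier (fobj X x). \<zero>\<^bsub>fobj Y x\<^esub>)"
  "\<eta> \<oplus>\<^bsub>Hom (left_modules K C) X Y\<^esub> \<theta> = (\<lambda>x\<in>Obj C. \<lambda>v\<in>carrier (fobj X x). \<eta> x v \<oplus>\<^bsub>fobj Y x\<^esub> \<theta> x v)"
  "Comp (left_modules K C) X Y Z \<theta>' \<eta>' = (\<lambda>x\<in>Obj C. compose (carrier (fobj X x)) (\<theta>' x) (\<eta>' x))"
  by (simp_all add: left_modules_def functor_category_def)

lemma Hom_left_modules:
  assumes "left_module K C X" "left_module K C Y"
  shows "\<eta> \<in> natural_transformations C (vect K) X Y \<longleftrightarrow>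
    \<eta> \<in> module_maps K C X Y \<and> restrict_map X \<eta> = \<eta>"
proof -
  interpret X: left_module K C X by fact
  interpret Y: left_module K C Y by fact
  have nat: "compose (carrier (fobj X x)) (\<eta> y) (farr X x y f) = compose (carrier (fobj X x)) (farr Y x y f) (\<eta> x)
    \<longleftrightarrow> (\<forall>v\<in>carrier (fobj X x). \<eta> y (farr X x y f v) = farr Y x y f (\<eta> x v))" for x y f
    by (auto simp: compose_def fun_eq_iff restrict_def)
  have ext: "restrict_map X \<eta> = \<eta> \<longleftrightarrow>
    \<eta> \<in> extensional (Obj C) \<and> (\<forall>x\<in>Obj C. \<eta> x \<in> extensional (carrier (fobj X x)))"
    by (auto simp: restrict_map_def extensional_def fun_eq_iff restrict_def)
  show ?thesis
    unfolding ext natural_transformations_def module_maps_def by (auto simp: nat PiE_def)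
qed

lemma restrict_map_Hom:
  assumes "left_module K C X" "left_module K C Y" "\<eta> \<in> module_maps K C X Y"
  shows "restrict_map X \<eta> \<in> natural_transformations C (vect K) X Y"
proof -
  interpret X: left_module K C X by fact
  have "restrict_map X \<eta> \<in> module_maps K C X Y"
  proof (rule module_mapsI)
    show "restrict_map X \<eta> x \<in> linear_maps K (fobj X x) (fobj Y x)" if "x \<in> Obj C" for x
      using linear_maps_restrict[OF X.module_fobj module_maps_linear[OF assms(3)]] that
      by (simp add: restrict_map_def)
  qed (simp add: X.farr_closed module_maps_natural[OF assms(3)])
  moreover have "restrict_map X (restrict_map X \<eta>) = restrict_map X \<eta>"
    by (auto simp: restrict_map_def fun_eq_iff restrict_def)
  ultimately show ?thesis using Hom_left_modules assms(1,2) by blast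
qed

lemma Hom_eqI:
  assumes "left_module K C X" "left_module K C Y" 
    and "\<eta> \<in> natural_transformations C (vect K) X Y" "\<theta> \<in> natural_transformations C (vect K) X Y"
    and "\<And>x v. x \<in> Obj C \<Longrightarrow> v \<in> carrier (fobj X x) \<Longrightarrow> \<eta> x v = \<theta> x v"
  shows "\<eta> = \<theta>"
proof -
  have "restrict_map X \<eta> = restrict_map X \<theta>"
    using assms(5) by (auto simp: restrict_map_def fun_eq_iff restrict_def)
  then show ?thesis using assms Hom_left_modules by metis
qed

section \<open>Epimorphisms and projective objects\<close>

lemma epimorphism_if_pointwise_surj:
  fixes X Y :: "('o, 'k, 'a, 'v) left_module"
  assumes X: "left_module K C X" and Y: "left_module K C Y"
    and e: "e \<in> natural_transformations C (vect K) X Y" and s: "pointwise_surj C X Y e"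
  shows "epimorphism (left_modules K C) X Y e"
  unfolding epimorphism_def
proof (intro conjI ballI impI)
  show "e \<in> carrier (Hom (left_modules K C) X Y)" using e by simp
  fix Z g h assume "Z \<in> Obj (left_modules K C)"
    and gh: "g \<in> carrier (Hom (left_modules K C) Y Z)" "h \<in> carrier (Hom (left_modules K C) Y Z)"
    and eq: "Comp (left_modules K C) X Y Z g e = Comp (left_modules K C) X Y Z h e"
  then have Z: "left_module K C Z" by (simp add: left_module_iff)
  have *: "g x (e x v) = h x (e x v)" if "x \<in> Obj C" "v \<in> carrier (fobj X x)" for x v
    using fun_cong[OF fun_cong[OF eq], of x v] that by (simp add: compose_def)
  show "g = h"
  proof (rule Hom_eqI[OF Y Z])
    fix x w assume "x \<in> Obj C" "w \<in> carrier (fobj Y x)"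
    moreover obtain v where "v \<in> carrier (fobj X x)" "w = e x v"
      using s calculation by (auto simp: pointwise_surj_def)
    ultimately show "g x w = h x w" using * by simp
  qed (use gh in auto)
qed

text \<open>The cokernel is formed inside \<open>Y\<close>, on a linear complement of the image of \<open>e\<close>.\<close>

lemma pointwise_surj_if_epimorphism:
  fixes X Y :: "('o, 'k, 'a, 'v) left_module"
  assumes K: "field K" and X: "left_module K C X" and Y: "left_module K C Y"
    and epi: "epimorphism (left_modules K C) X Y e"
  shows "pointwise_surj C X Y e"
proof -
  interpret X: left_module K C X by fact
  interpret Y: left_module K C Y by fact
  have e: "e \<in> natural_transformations C (vect K) X Y" using epi by (simp add: epimorphism_def)
  then have em: "e \<in> module_maps K C X Y" using Hom_left_modules X Y by blast
  have "\<exists>r. r \<in> linear_maps K (fobj Y x) (fobj Y x) \<and> (\<forall>v\<in>carrier (fobj Y x). r (r v) = r v) \<and>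
    (\<forall>v\<in>carrier (fobj Y x). r v = \<zero>\<^bsub>fobj Y x\<^esub> \<longleftrightarrow> v \<in> e x ` carrier (fobj X x))" if "x \<in> Obj C" for x
  proof -
    note m = X.module_fobj[OF that] Y.module_fobj[OF that]
    show ?thesis
      using linear_projection[OF K m(2) submodule_image[OF m module_maps_linear[OF em that]]] by metis
  qed
  then obtain r where "\<forall>x\<in>Obj C. r x \<in> linear_maps K (fobj Y x) (fobj Y x) \<and>
    (\<forall>v\<in>carrier (fobj Y x). r x (r x v) = r x v) \<and>
    (\<forall>v\<in>carrier (fobj Y x). r x v = \<zero>\<^bsub>fobj Y x\<^esub> \<longleftrightarrow> v \<in> e x ` carrier (fobj X x))"
    by metis
  then have r: "\<And>x. x \<in> Obj C \<Longrightarrow> r x \<in> linear_maps K (fobj Y x) (fobj Y x)"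
    and idem: "\<And>x v. x \<in> Obj C \<Longrightarrow> v \<in> carrier (fobj Y x) \<Longrightarrow> r x (r x v) = r x v"
    and ker: "\<And>x v. x \<in> Obj C \<Longrightarrow> v \<in> carrier (fobj Y x) \<Longrightarrow>
      r x v = \<zero>\<^bsub>fobj Y x\<^esub> \<longleftrightarrow> v \<in> e x ` carrier (fobj X x)"
    by blast+
  note rcl = linear_maps_closed[OF r]
  \<comment> \<open>Applying \<open>r\<close> before the action changes nothing after projection:
    \<open>v - r x v\<close> lies in the image of \<open>e x\<close>, naturality carries it into the
    image of \<open>e y\<close>, and \<open>r y\<close> kills that.\<close>
  have rr: "r y (farr Y x y f (r x v)) = r y (farr Y x y f v)"
    if xy: "x \<in> Obj C" "y \<in> Obj C" and f: "f \<in> carrier (Hom C x y)" and v: "v \<in> carrier (fobj Y x)" for x y f v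
  proof -
    note mx = Y.module_fobj[OF xy(1)] and my = Y.module_fobj[OF xy(2)]
    note rv = rcl[OF xy(1) v]
    have "r x (v \<ominus>\<^bsub>fobj Y x\<^esub> r x v) = \<zero>\<^bsub>fobj Y x\<^esub>"
      using v rv idem xy by (simp add: linear_maps_diff[OF mx mx r] module_diff_eq_zero[OF mx])
    then obtain u where u: "u \<in> carrier (fobj X x)" "v \<ominus>\<^bsub>fobj Y x\<^esub> r x v = e x u"
      using ker[of x "v \<ominus>\<^bsub>fobj Y x\<^esub> r x v"] xy v rv module_diff_closed[OF mx] by auto
    have "farr Y x y f v \<ominus>\<^bsub>fobj Y y\<^esub> farr Y x y f (r x v) = e y (farr X x y f u)"
      using linear_maps_diff[OF mx my Y.farr_map(1)[OF xy f] v rv]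
      by (simp add: u(2) module_maps_natural[OF em xy f u(1)])
    then have "r y (farr Y x y f v \<ominus>\<^bsub>fobj Y y\<^esub> farr Y x y f (r x v)) = \<zero>\<^bsub>fobj Y y\<^esub>"
      using ker[OF xy(2)] X.farr_closed[OF xy f u(1)] module_maps_closed[OF em xy(2)] by auto
    then show ?thesis
      using linear_maps_diff[OF my my r[OF xy(2)]] module_diff_eq_zero[OF my] Y.farr_closed[OF xy f] v rv rcl xy
      by simp
  qed
  \<comment> \<open>\<open>Z\<close> is the cokernel, with \<open>r\<close> as quotient map: an
    arrow acts as in \<open>Y\<close>, and the result is projected back onto the complement.\<close>
  define Z :: "('o, 'k, 'a, 'v) left_module" where
    "Z = \<lparr>fobj = (\<lambda>x. (fobj Y x)\<lparr>carrier := r x ` carrier (fobj Y x)\<rparr>),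
       farr = (\<lambda>x y f. \<lambda>v\<in>r x ` carrier (fobj Y x). r y (farr Y x y f v))\<rparr>"
  have Z_simps [simp]: "carrier (fobj Z x) = r x ` carrier (fobj Y x)" "\<zero>\<^bsub>fobj Z x\<^esub> = \<zero>\<^bsub>fobj Y x\<^esub>"
    "u \<oplus>\<^bsub>fobj Z x\<^esub> v = u \<oplus>\<^bsub>fobj Y x\<^esub> v" "a \<odot>\<^bsub>fobj Z x\<^esub> v = a \<odot>\<^bsub>fobj Y x\<^esub> v" for x u v a
    by (simp_all add: Z_def)
  have sub: "r x v \<in> carrier (fobj Y x)" if "x \<in> Obj C" "v \<in> carrier (fobj Y x)" for x v
    using rcl that .
  have farr_Z: "farr Z x y f (r x v) = r y (farr Y x y f v)"
    if "x \<in> Obj C" "y \<in> Obj C" "f \<in> carrier (Hom C x y)" "v \<in> carrier (fobj Y x)" for x y f v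
    using that rr by (simp add: Z_def)
  have rZ: "r x \<in> linear_maps K (fobj Y x) (fobj Z x)" if "x \<in> Obj C" for x
    using that by (intro linear_mapsI) (auto simp: linear_maps_add[OF r] linear_maps_smult[OF r])
  have modZ: "module K (fobj Z x)" if "x \<in> Obj C" for x
    by (rule module_image[OF Y.module_fobj rZ])
      (use that linear_maps_zero[OF Y.module_fobj Y.module_fobj r] in auto)
  have Z: "left_module K C Z"
  proof (rule left_moduleI)
    fix x y assume xy: "x \<in> Obj C" "y \<in> Obj C"
    note b = bilinear_maps_simps[OF Y.farr_bilinear[OF xy]] and cl = Y.farr_closed[OF xy]
    note ladd = linear_maps_add[OF r, symmetric, OF xy(1)] and lsm = linear_maps_smult[OF r, symmetric, OF xy(1)]
    note m = module_add_closed[OF Y.module_fobj] module_smult_closed[OF Y.module_fobj]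
       module_add_closed[OF Hom_module] module_smult_closed[OF Hom_module]
    show "farr Z x y \<in> bilinear_maps K (Hom C x y) (fobj Z x) (fobj Z y)"
      by (intro bilinear_mapsI linear_mapsI)
       (auto simp: farr_Z xy b cl ladd lsm m linear_maps_add[OF r[OF xy(2)]] linear_maps_smult[OF r[OF xy(2)]])
  next
    show "farr Z x y f \<in> extensional (carrier (fobj Z x))" for x y f
      by (simp add: Z_def)
  next
    show "farr Z x x (Id C x) v = v" if "x \<in> Obj C" "v \<in> carrier (fobj Z x)" for x v
      using that by (auto simp: farr_Z Id_closed Y.farr_Id_apply)
  next
    show "farr Z x z (Comp C x y z g f) v = farr Z y z g (farr Z x y f v)"
      if "x \<in> Obj C" "y \<in> Obj C" "z \<in> Obj C" "f \<in> carrier (Hom C x y)"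
      "g \<in> carrier (Hom C y z)" "v \<in> carrier (fobj Z x)" for x y z f g v
      using that by (auto simp: farr_Z Comp_closed Y.farr_Comp_apply Y.farr_closed)
  qed (use modZ in auto)
  have rmap: "r \<in> module_maps K C Y Z"
    by (rule module_mapsI) (auto simp: rZ farr_Z)
  have zmap: "(\<lambda>x v. \<zero>\<^bsub>fobj Y x\<^esub>) \<in> module_maps K C Y Z"
  proof (rule module_mapsI)
    fix x assume x: "x \<in> Obj C"
    interpret x: module K "fobj Y x" by (rule Y.module_fobj[OF x])
    have 0: "\<zero>\<^bsub>fobj Y x\<^esub> \<in> carrier (fobj Z x)" using module_zero_closed[OF modZ[OF x]] by simp
    show "(\<lambda>v. \<zero>\<^bsub>fobj Y x\<^esub>) \<in> linear_maps K (fobj Y x) (fobj Z x)"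
      by (rule linear_mapsI) (use 0 in auto)
  next
    fix x y f v assume xy: "x \<in> Obj C" "y \<in> Obj C" and f: "f \<in> carrier (Hom C x y)" and "v \<in> carrier (fobj Y x)"
    have "farr Z x y f \<in> linear_maps K (fobj Z x) (fobj Z y)"
      using left_module.farr_map(1)[OF Z xy f] .
    from linear_maps_zero[OF modZ modZ this] xy
    show "\<zero>\<^bsub>fobj Y y\<^esub> = farr Z x y f \<zero>\<^bsub>fobj Y x\<^esub>" by simp
  qed
  \<comment> \<open>\<open>r\<close> and the zero map both vanish on the image of \<open>e\<close>,
    so the epimorphism identifies them. Then \<open>r = 0\<close> says that the kernel of
    \<open>r x\<close>, which is the image of \<open>e x\<close>, is everything.\<close>
  have "Comp (left_modules K C) X Y Z (restrict_map Y r) e =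
      Comp (left_modules K C) X Y Z (restrict_map Y (\<lambda>x v. \<zero>\<^bsub>fobj Y x\<^esub>)) e"
    using ker module_maps_closed[OF em] by (auto simp: fun_eq_iff restrict_def compose_def)
  moreover have "Z \<in> Obj (left_modules K C)" using Z by (simp add: left_module_iff)
  ultimately have eq: "restrict_map Y r = restrict_map Y (\<lambda>x v. \<zero>\<^bsub>fobj Y x\<^esub>)"
    using epi restrict_map_Hom[OF Y Z rmap] restrict_map_Hom[OF Y Z zmap]
    unfolding epimorphism_def left_modules_simps(1) by blast
  have "r x v = \<zero>\<^bsub>fobj Y x\<^esub>" if "x \<in> Obj C" "v \<in> carrier (fobj Y x)" for x v
    using fun_cong[OF fun_cong[OF eq], of x v] that by simp
  then show ?thesis
    using ker module_maps_closed[OF em] by (auto simp: pointwise_surj_def)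
qed

text \<open>Over a field every epimorphism of left modules is surjective at each object, so lifting
  along such surjections is enough; \<open>restrict_map\<close> turns the lift into a morphism of
  the category.\<close>

lemma projective_objectI:
  fixes P :: "('o, 'k, 'a, 'v) left_module"
  assumes K: "field K" and P: "left_module K C P"
    and lift: "\<And>(X :: ('o, 'k, 'a, 'v) left_module) (Y :: ('o, 'k, 'a, 'v) left_module) e f. \<lbrakk>left_module K C X; left_module K C Y; e \<in> module_maps K C X Y;
      pointwise_surj C X Y e; f \<in> module_maps K C P Y\<rbrakk> \<Longrightarrow>
      \<exists>g\<in>module_maps K C P X. \<forall>x\<in>Obj C. \<forall>v\<in>carrier (fobj P x). e x (g x v) = f x v"
  shows "projective_object (left_modules K C) P"
  unfolding projective_object_def
proof (intro conjI ballI allI impI)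
  show "P \<in> Obj (left_modules K C)" using P by (simp add: left_module_iff)
next
  fix X Y e f assume "X \<in> Obj (left_modules K C)" "Y \<in> Obj (left_modules K C)"
    and epi: "epimorphism (left_modules K C) X Y e" and f: "f \<in> carrier (Hom (left_modules K C) P Y)"
  then have X: "left_module K C X" and Y: "left_module K C Y" by (simp_all add: left_module_iff)
  have "e \<in> module_maps K C X Y" "f \<in> module_maps K C P Y"
    using epi f Hom_left_modules X Y P by (auto simp: epimorphism_def)
  then obtain g where g: "g \<in> module_maps K C P X"
    "\<And>x v. x \<in> Obj C \<Longrightarrow> v \<in> carrier (fobj P x) \<Longrightarrow> e x (g x v) = f x v"
    using lift[OF X Y] pointwise_surj_if_epimorphism[OF K X Y epi] by metis
  show "\<exists>g\<in>carrier (Hom (left_modules K C) P X). Comp (left_modules K C) P X Y e g = f"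
  proof
    show "restrict_map P g \<in> carrier (Hom (left_modules K C) P X)"
      using restrict_map_Hom[OF P X g(1)] by simp
    have "Comp (left_modules K C) P X Y e (restrict_map P g) = restrict_map P f"
      using g(2) by (auto simp: fun_eq_iff restrict_def compose_def restrict_map_def)
    then show "Comp (left_modules K C) P X Y e (restrict_map P g) = f"
      using f Hom_left_modules[OF P Y] by simp
  qed
qed

lemma projective_lift:
  fixes P X Y :: "('o, 'k, 'a, 'v) left_module"
  assumes "projective_object (left_modules K C) P" and X: "left_module K C X" and Y: "left_module K C Y"
    and e: "e \<in> module_maps K C X Y" "pointwise_surj C X Y e" and f: "f \<in> module_maps K C P Y"
  obtains g where "g \<in> module_maps K C P X"
    "\<And>x v. x \<in> Obj C \<Longrightarrow> v \<in> carrier (fobj P x) \<Longrightarrow> e x (g x v) = f x v"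
proof -
  have P: "left_module K C P" using assms(1) by (simp add: projective_object_def left_module_iff)
  have "pointwise_surj C X Y (restrict_map X e)"
    using e(2) by (simp add: pointwise_surj_def cong: image_cong_simp)
  then have "epimorphism (left_modules K C) X Y (restrict_map X e)"
    by (intro epimorphism_if_pointwise_surj X Y restrict_map_Hom e)
  then obtain g where g: "g \<in> natural_transformations C (vect K) P X"
    "Comp (left_modules K C) P X Y (restrict_map X e) g = restrict_map P f"
    using assms(1) X Y restrict_map_Hom[OF P Y f] unfolding projective_object_def left_module_iff
      left_modules_simps(1) by blast
  then have gm: "g \<in> module_maps K C P X" using Hom_left_modules P X by blast
  show thesis
  proof (rule that[OF gm])
    fix x v assume "x \<in> Obj C" "v \<in> carrier (fobj P x)"
    then show "e x (g x v) = f x v"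
      using fun_cong[OF fun_cong[OF g(2)], of x v] module_maps_closed[OF gm] by (simp add: compose_def)
  qed
qed

section \<open>Kernels, differences and factorizations of module maps\<close>

definition kernel_module ::
  "('o, 'k, 'a, 'v) left_module \<Rightarrow> ('o, 'k, 'a, 'w) left_module \<Rightarrow> ('o \<Rightarrow> 'v \<Rightarrow> 'w) \<Rightarrow> ('o, 'k, 'a, 'v) left_module" where
  "kernel_module X Y \<eta> =
    \<lparr>fobj = (\<lambda>x. (fobj X x)\<lparr>carrier := {v \<in> carrier (fobj X x). \<eta> x v = \<zero>\<^bsub>fobj Y x\<^esub>}\<rparr>),
     farr = (\<lambda>x y f. \<lambda>v\<in>{v \<in> carrier (fobj X x). \<eta> x v = \<zero>\<^bsub>fobj Y x\<^esub>}. farr X x y f v)\<rparr>"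

lemma kernel_module_simps [simp]:
  "carrier (fobj (kernel_module X Y \<eta>) x) = {v \<in> carrier (fobj X x). \<eta> x v = \<zero>\<^bsub>fobj Y x\<^esub>}"
  "\<zero>\<^bsub>fobj (kernel_module X Y \<eta>) x\<^esub> = \<zero>\<^bsub>fobj X x\<^esub>"
  "u \<oplus>\<^bsub>fobj (kernel_module X Y \<eta>) x\<^esub> v = u \<oplus>\<^bsub>fobj X x\<^esub> v"
  "a \<odot>\<^bsub>fobj (kernel_module X Y \<eta>) x\<^esub> v = a \<odot>\<^bsub>fobj X x\<^esub> v"
  "v \<in> carrier (fobj X x) \<Longrightarrow> \<eta> x v = \<zero>\<^bsub>fobj Y x\<^esub> \<Longrightarrow> farr (kernel_module X Y \<eta>) x y f v = farr X x y f v"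
  by (simp_all add: kernel_module_def)

lemma left_module_kernel_module:
  assumes X: "left_module K C X" and Y: "left_module K C Y" and e: "\<eta> \<in> module_maps K C X Y"
  shows "left_module K C (kernel_module X Y \<eta>)"
proof -
  interpret X: left_module K C X by fact
  interpret Y: left_module K C Y by fact
  have zero: "farr Y x y f \<zero>\<^bsub>fobj Y x\<^esub> = \<zero>\<^bsub>fobj Y y\<^esub>"
    if "x \<in> Obj C" "y \<in> Obj C" "f \<in> carrier (Hom C x y)" for x y f
    using linear_maps_zero[OF Y.module_fobj Y.module_fobj Y.farr_map(1)] that by blast
  have m: "module K (fobj (kernel_module X Y \<eta>) x)" if x: "x \<in> Obj C" for x
    using submodule.submodule_is_module[OF submodule_kernel[OF X.module_fobj Y.module_fobj module_maps_linear[OF e]]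
      X.module_fobj, OF x x x x]
    by (simp add: kernel_module_def)
  show ?thesis
  proof (rule left_moduleI)
    show "farr (kernel_module X Y \<eta>) x y
      \<in> bilinear_maps K (Hom C x y) (fobj (kernel_module X Y \<eta>) x) (fobj (kernel_module X Y \<eta>) y)"
      if xy: "x \<in> Obj C" "y \<in> Obj C" for x y
    proof -
      note cl = module_add_closed[OF m[OF xy(1)]] module_smult_closed[OF m[OF xy(1)]]
      show ?thesis
      by (intro bilinear_mapsI linear_mapsI)
        (use xy cl in \<open>auto simp: bilinear_maps_simps[OF X.farr_bilinear] X.farr_closed module_maps_natural[OF e] zero\<close>)
    qed
    show "farr (kernel_module X Y \<eta>) x y f \<in> extensional (carrier (fobj (kernel_module X Y \<eta>) x))" for x y f
      by (simp add: kernel_module_def)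
  qed (auto simp: m Id_closed X.farr_Id_apply X.farr_Comp_apply X.farr_closed module_maps_natural[OF e] zero)
qed

lemma kernel_module_inclusion: "(\<lambda>x v. v) \<in> module_maps K C (kernel_module X Y \<eta>) X"
  by (auto intro!: module_mapsI linear_mapsI)

lemma module_maps_into_kernel:
  assumes "\<theta> \<in> module_maps K C W X"
    and "\<And>x v. x \<in> Obj C \<Longrightarrow> v \<in> carrier (fobj W x) \<Longrightarrow> \<eta> x (\<theta> x v) = \<zero>\<^bsub>fobj Y x\<^esub>"
  shows "\<theta> \<in> module_maps K C W (kernel_module X Y \<eta>)"
  using assms by (auto intro!: module_mapsI linear_mapsI simp: module_maps_closed module_maps_natural
      linear_maps_add[OF module_maps_linear] linear_maps_smult[OF module_maps_linear])

lemma module_maps_diff: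
  assumes X: "left_module K C X" and Y: "left_module K C Y"
    and h: "\<eta> \<in> module_maps K C X Y" and t: "\<theta> \<in> module_maps K C X Y"
  shows "(\<lambda>x v. \<eta> x v \<ominus>\<^bsub>fobj Y x\<^esub> \<theta> x v) \<in> module_maps K C X Y"
proof -
  interpret X: left_module K C X by fact
  interpret Y: left_module K C Y by fact
  show ?thesis
  proof (rule module_mapsI)
    show "(\<lambda>v. \<eta> x v \<ominus>\<^bsub>fobj Y x\<^esub> \<theta> x v) \<in> linear_maps K (fobj X x) (fobj Y x)" if "x \<in> Obj C" for x
      using that h t by (intro linear_maps_diff_fun Y.module_fobj module_maps_linear)
  qed (use h t in \<open>auto simp: module_maps_natural module_maps_closed
    linear_maps_diff[OF Y.module_fobj Y.module_fobj Y.farr_map(1)]\<close>)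
qed

text \<open>The factorization is made at each object separately. It is natural nevertheless: every
  element of \<open>X\<close> has the form \<open>e x p\<close>, and on such elements naturality
  follows from that of \<open>e\<close> and \<open>m\<close>.\<close>

lemma module_maps_factor:
  assumes P: "left_module K C P" and X: "left_module K C X" and Q: "left_module K C Q"
    and e: "e \<in> module_maps K C P X" "pointwise_surj C P X e" and m: "m \<in> module_maps K C P Q"
    and ker: "\<And>x p. \<lbrakk>x \<in> Obj C; p \<in> carrier (fobj P x); e x p = \<zero>\<^bsub>fobj X x\<^esub>\<rbrakk> \<Longrightarrow> m x p = \<zero>\<^bsub>fobj Q x\<^esub>"
  obtains s where "s \<in> module_maps K C X Q"
    "\<And>x p. x \<in> Obj C \<Longrightarrow> p \<in> carrier (fobj P x) \<Longrightarrow> s x (e x p) = m x p"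
proof -
  interpret P: left_module K C P by fact
  interpret X: left_module K C X by fact
  interpret Q: left_module K C Q by fact
  have "\<exists>s. s \<in> linear_maps K (fobj X x) (fobj Q x) \<and> (\<forall>p\<in>carrier (fobj P x). s (e x p) = m x p)"
    if "x \<in> Obj C" for x
    using linear_factor[OF P.module_fobj X.module_fobj Q.module_fobj module_maps_linear[OF e(1)] _
      module_maps_linear[OF m] ker] that e(2) unfolding pointwise_surj_def by metis
  then obtain s where s: "\<And>x. x \<in> Obj C \<Longrightarrow> s x \<in> linear_maps K (fobj X x) (fobj Q x)"
    "\<And>x p. x \<in> Obj C \<Longrightarrow> p \<in> carrier (fobj P x) \<Longrightarrow> s x (e x p) = m x p"
    by metis
  have "s \<in> module_maps K C X Q"
  proof (rule module_mapsI)
    fix x y f v assume *: "x \<in> Obj C" "y \<in> Obj C" "f \<in> carrier (Hom C x y)" "v \<in> carrier (fobj X x)"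
    then obtain p where "p \<in> carrier (fobj P x)" "v = e x p"
      using e(2) by (auto simp: pointwise_surj_def)
    then show "s y (farr X x y f v) = farr Q x y f (s x v)"
      using * s(2) by (simp add: module_maps_natural[OF e(1), symmetric] P.farr_closed module_maps_natural[OF m])
  qed (fact s)
  then show thesis using s(2) by (rule that)
qed

text \<open>
  In the chosen resolution, \<open>d 0\<close> is a cocycle with values in the kernel of the augmentation; writing
  it as a coboundary retracts \<open>P 0\<close> onto that kernel.
\<close>

lemma section_if_trivial_Ext:
  fixes X Q :: "('o, 'k, 'a, 'v) left_module"
  assumes X: "left_module K C X" and Q: "left_module K C Q"
    and e: "e \<in> module_maps K C Q X" "pointwise_surj C Q X e"
    and res: "\<exists>P d \<epsilon>. projective_resolution K C X P d \<epsilon>"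
    and triv: "\<And>Y :: ('o, 'k, 'a, 'v) left_module. left_module K C Y \<Longrightarrow> trivial_group (Ext K C 1 X Y)"
  obtains s where "s \<in> module_maps K C X Q"
    "\<And>x v. x \<in> Obj C \<Longrightarrow> v \<in> carrier (fobj X x) \<Longrightarrow> e x (s x v) = v"
proof -
  let ?A = "left_modules K C"
  \<comment> \<open>\<open>Ext\<close> is evaluated on this arbitrary pair; \<open>res\<close>
    guarantees that it belongs to a resolution.\<close>
  define Pd where "Pd = (SOME (P, d). \<exists>\<epsilon>. projective_resolution K C X P d \<epsilon>)"
  obtain P d where Pd: "Pd = (P, d)" by (cases Pd)
  have "case Pd of (P, d) \<Rightarrow> \<exists>\<epsilon>. projective_resolution K C X P d \<epsilon>"
    unfolding Pd_def by (rule someI_ex) (use res in auto)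
  then obtain \<epsilon> where "projective_resolution K C X P d \<epsilon>" unfolding Pd by auto
  then have proj: "\<And>n. projective_object ?A (P n)"
    and d: "\<And>n. d n \<in> natural_transformations C (vect K) (P (Suc n)) (P n)"
    and \<epsilon>: "\<epsilon> \<in> natural_transformations C (vect K) (P 0) X" and surj: "pointwise_surj C (P 0) X \<epsilon>"
    and im0: "\<And>x. x \<in> Obj C \<Longrightarrow> d 0 x ` carrier (fobj (P 1) x) =
      {v \<in> carrier (fobj (P 0) x). \<epsilon> x v = \<zero>\<^bsub>fobj X x\<^esub>}"
    and im1: "\<And>x. x \<in> Obj C \<Longrightarrow> d 1 x ` carrier (fobj (P 2) x) =
      {v \<in> carrier (fobj (P 1) x). d 0 x v = \<zero>\<^bsub>fobj (P 0) x\<^esub>}"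
    unfolding projective_resolution_def left_modules_simps pointwise_surj_def
    by (auto simp: numeral_2_eq_2)
  have P: "left_module K C (P n)" for n
    using proj[of n] by (simp add: projective_object_def left_module_iff)
  have \<epsilon>m: "\<epsilon> \<in> module_maps K C (P 0) X" using \<epsilon> Hom_left_modules[OF P X] by blast
  have dm: "d n \<in> module_maps K C (P (Suc n)) (P n)" for n using d Hom_left_modules[OF P P] by blast
  define Y where "Y = kernel_module (P 0) X \<epsilon>"
  have Y: "left_module K C Y" unfolding Y_def by (rule left_module_kernel_module[OF P X \<epsilon>m])
  have YP: "(\<lambda>x v. v) \<in> module_maps K C Y (P 0)"
    unfolding Y_def by (rule kernel_module_inclusion)
  interpret P0: left_module K C "P 0" by (rule P)
  interpret X: left_module K C X by (rule X)
  interpret Y: left_module K C Y by (rule Y)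
  \<comment> \<open>The zero morphism provides an explicit coboundary, from which a member of the
    coset of \<open>d 0\<close> is built below.\<close>
  have zero: "restrict_map (P 0) (\<lambda>x v. \<zero>\<^bsub>fobj Y x\<^esub>) \<in> natural_transformations C (vect K) (P 0) Y"
  proof (rule restrict_map_Hom[OF P Y], rule module_mapsI)
    fix x assume x: "x \<in> Obj C"
    interpret x: module K "fobj Y x" by (rule Y.module_fobj[OF x])
    show "(\<lambda>v. \<zero>\<^bsub>fobj Y x\<^esub>) \<in> linear_maps K (fobj (P 0) x) (fobj Y x)"
      by (rule linear_mapsI) auto
  next
    show "\<zero>\<^bsub>fobj Y y\<^esub> = farr Y x y f \<zero>\<^bsub>fobj Y x\<^esub>"
      if "x \<in> Obj C" "y \<in> Obj C" "f \<in> carrier (Hom C x y)" for x y f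
      using linear_maps_zero[OF Y.module_fobj Y.module_fobj Y.farr_map(1)] that by metis
  qed
  let ?Z = "Hom_cocycles ?A P d Y 1" and ?B = "Hom_coboundaries ?A P d Y 1"
  have "d 0 \<in> module_maps K C (P 1) Y"
    unfolding Y_def by (rule module_maps_into_kernel) (use dm[of 0] im0 in auto)
  moreover have "restrict_map (P 1) (d 0) = d 0" using d[of 0] Hom_left_modules[OF P P] by auto
  ultimately have "d 0 \<in> natural_transformations C (vect K) (P 1) Y"
    using Hom_left_modules[OF P Y] by auto
  moreover have "Comp ?A (P (Suc 1)) (P 1) Y (d 0) (d 1) = \<zero>\<^bsub>Hom ?A (P (Suc 1)) Y\<^esub>"
    using im1 by (auto simp: fun_eq_iff restrict_def compose_def Y_def numeral_2_eq_2)
  ultimately have "d 0 \<in> ?Z"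
    by (simp add: Hom_cocycles_def)
  then have "?B +>\<^bsub>(Hom ?A (P 1) Y)\<lparr>carrier := ?Z\<rparr>\<^esub> d 0
      \<in> carrier ((Hom ?A (P 1) Y)\<lparr>carrier := ?Z\<rparr> A_Mod ?B)"
    by (auto simp: A_FactGroup_def' A_RCOSETS_def')
  also have "\<dots> = {?B}"
    using triv[OF Y] unfolding Ext_def Let_def Pd_def[symmetric] Pd
    by (simp add: trivial_group_def A_FactGroup_def')
  finally have B: "?B +>\<^bsub>(Hom ?A (P 1) Y)\<lparr>carrier := ?Z\<rparr>\<^esub> d 0 = ?B" by simp
  \<comment> \<open>The coset of \<open>d 0\<close> equals \<open>?B\<close>. Adding
    \<open>d 0\<close> to the zero coboundary gives a member of that coset, hence a coboundary, and
    the resulting \<open>\<theta>\<close> satisfies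
    \<open>\<theta> \<circ> d 0 = d 0\<close>.\<close>
  have "Comp ?A (P 1) (P 0) Y (restrict_map (P 0) (\<lambda>x v. \<zero>\<^bsub>fobj Y x\<^esub>)) (d 0) \<in> ?B"
    using zero by (auto simp: Hom_coboundaries_def simp del: left_modules_simps(4))
  then have "Comp ?A (P 1) (P 0) Y (restrict_map (P 0) (\<lambda>x v. \<zero>\<^bsub>fobj Y x\<^esub>)) (d 0) \<oplus>\<^bsub>Hom ?A (P 1) Y\<^esub> d 0 \<in> ?B"
    by (subst B[symmetric]) (force simp: a_r_coset_def' simp del: left_modules_simps)
  then obtain \<theta> where \<theta>: "\<theta> \<in> natural_transformations C (vect K) (P 0) Y"
    and "Comp ?A (P 1) (P 0) Y (restrict_map (P 0) (\<lambda>x v. \<zero>\<^bsub>fobj Y x\<^esub>)) (d 0) \<oplus>\<^bsub>Hom ?A (P 1) Y\<^esub> d 0 =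
      Comp ?A (P 1) (P 0) Y \<theta> (d 0)"
    by (auto simp: Hom_coboundaries_def simp del: left_modules_simps(2-4))
  note eq = fun_cong[OF fun_cong[OF this(2)]]
  have \<theta>m: "\<theta> \<in> module_maps K C (P 0) Y" using \<theta> Hom_left_modules[OF P Y] by blast
  have fix_ker: "\<theta> x v = v" if x: "x \<in> Obj C" and v: "v \<in> carrier (fobj (P 0) x)" "\<epsilon> x v = \<zero>\<^bsub>fobj X x\<^esub>" for x v
  proof -
    interpret x: module K "fobj (P 0) x" by (rule P0.module_fobj[OF x])
    obtain w where w: "w \<in> carrier (fobj (P 1) x)" "v = d 0 x w" using im0[OF x] v by blast
    have "\<zero>\<^bsub>fobj (P 0) x\<^esub> \<oplus>\<^bsub>fobj (P 0) x\<^esub> d 0 x w = \<theta> x (d 0 x w)"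
      using eq[of x w] x w v by (simp add: compose_def Y_def)
    then show ?thesis using v w by simp
  qed
  \<comment> \<open>The chosen \<open>P 0\<close> need not be related to \<open>Q\<close>, but being
    projective it maps to \<open>Q\<close> over \<open>X\<close>.\<close>
  obtain l where l: "l \<in> module_maps K C (P 0) Q"
    "\<And>x v. x \<in> Obj C \<Longrightarrow> v \<in> carrier (fobj (P 0) x) \<Longrightarrow> e x (l x v) = \<epsilon> x v"
    using projective_lift[OF proj Q X e \<epsilon>m] by blast
  \<comment> \<open>The endomorphism \<open>t = 1 - \<theta>\<close> vanishes on the kernel of
    \<open>\<epsilon>\<close>, which \<open>\<theta>\<close> fixes, and satisfies
    \<open>\<epsilon> \<circ> t = \<epsilon>\<close>, as \<open>\<theta>\<close> takes values in
    that kernel. Hence \<open>l \<circ> t\<close> factors through \<open>\<epsilon>\<close>, and the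
    factor is the section.\<close>
  define t where "t x v = v \<ominus>\<^bsub>fobj (P 0) x\<^esub> \<theta> x v" for x v
  have \<theta>P: "\<theta> \<in> module_maps K C (P 0) (P 0)" using module_maps_comp[OF \<theta>m YP] .
  have id: "(\<lambda>x v. v) \<in> module_maps K C (P 0) (P 0)" by (auto intro!: module_mapsI linear_mapsI)
  have t: "t \<in> module_maps K C (P 0) (P 0)"
    using module_maps_diff[OF P P id \<theta>P] by (simp add: t_def[abs_def])
  have \<epsilon>t: "\<epsilon> x (t x v) = \<epsilon> x v" if x: "x \<in> Obj C" and v: "v \<in> carrier (fobj (P 0) x)" for x v
  proof -
    interpret x: module K "fobj X x" by (rule X.module_fobj[OF x])
    have "\<epsilon> x (\<theta> x v) = \<zero>\<^bsub>fobj X x\<^esub>" using module_maps_closed[OF \<theta>m x v] by (simp add: Y_def)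
    moreover have "\<epsilon> x (t x v) = \<epsilon> x v \<ominus>\<^bsub>fobj X x\<^esub> \<epsilon> x (\<theta> x v)"
      unfolding t_def using v module_maps_closed[OF \<theta>P x v]
      by (rule linear_maps_diff[OF P0.module_fobj[OF x] X.module_fobj[OF x] module_maps_linear[OF \<epsilon>m x]])
    ultimately show ?thesis using module_maps_closed[OF \<epsilon>m x v] by (simp add: x.M.minus_eq)
  qed
  have "l x (t x p) = \<zero>\<^bsub>fobj Q x\<^esub>"
    if x: "x \<in> Obj C" and p: "p \<in> carrier (fobj (P 0) x)" "\<epsilon> x p = \<zero>\<^bsub>fobj X x\<^esub>" for x p
  proof -
    have "t x p = \<zero>\<^bsub>fobj (P 0) x\<^esub>"
      using fix_ker[OF x p] p(1) by (simp add: t_def module_diff_eq_zero[OF P0.module_fobj[OF x]])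
    then show ?thesis
      using linear_maps_zero[OF P0.module_fobj[OF x] left_module.module_fobj[OF Q x] module_maps_linear[OF l(1) x]] by simp
  qed
  then obtain s where s: "s \<in> module_maps K C X Q"
    "\<And>x p. x \<in> Obj C \<Longrightarrow> p \<in> carrier (fobj (P 0) x) \<Longrightarrow> s x (\<epsilon> x p) = l x (t x p)"
    using module_maps_factor[OF P X Q \<epsilon>m surj module_maps_comp[OF t l(1)]] by blast
  show thesis
  proof (rule that[OF s(1)])
    fix x v assume x: "x \<in> Obj C" and "v \<in> carrier (fobj X x)"
    then obtain p where p: "p \<in> carrier (fobj (P 0) x)" "v = \<epsilon> x p"
      using surj by (auto simp: pointwise_surj_def)
    then show "e x (s x v) = v"
      using x s(2) l(2) \<epsilon>t module_maps_closed[OF t x] by simp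
  qed
qed

end

section \<open>Cardinality\<close>

lemma times_self_eqpoll_infinite:
  "infinite (UNIV :: 'u set) \<Longrightarrow> (UNIV :: ('u \<times> 'u) set) \<approx> (UNIV :: 'u set)"
  using card_of_Times_same_infinite[of "UNIV :: 'u set"] by (simp add: eqpoll_iff_card_of_ordIso)

text \<open>A list is coded by its length together with its entries folded by an injective pairing
  \<open>p\<close>. The length is recorded because the fold, started at the arbitrary seed
  \<open>i 0\<close>, is compared only among lists of equal length.\<close>

lemma lists_lepoll_infinite:
  assumes "infinite (UNIV :: 'u set)" "A \<lesssim> (UNIV :: 'u set)"
  shows "lists A \<lesssim> (UNIV :: 'u set)"
proof -
  obtain p :: "'u \<times> 'u \<Rightarrow> 'u" where p: "inj p"
    using times_self_eqpoll_infinite[OF assms(1)] by (auto simp: eqpoll_def bij_betw_def)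
  obtain i :: "nat \<Rightarrow> 'u" where i: "inj i"
    using assms(1) infinite_countable_subset by blast
  define e where "e xs = foldr (\<lambda>x y. p (x, y)) xs (i 0)" for xs
  have e: "xs = ys" if "length xs = length ys" "e xs = e ys" for xs ys
    using that by (induction xs ys rule: list_induct2) (auto simp: e_def dest: injD[OF p])
  have "inj_on (\<lambda>xs. p (i (length xs), e xs)) (lists UNIV)"
    using e by (auto intro!: inj_onI dest!: injD[OF p] injD[OF i])
  then have "lists (UNIV :: 'u set) \<lesssim> (UNIV :: 'u set)"
    by (auto simp: lepoll_def)
  then show ?thesis using lists_lepoll_mono[OF assms(2)] lepoll_trans by blast
qed

lemma times_lepoll_infinite:
  assumes "infinite (UNIV :: 'u set)" "A \<lesssim> (UNIV :: 'u set)" "B \<lesssim> (UNIV :: 'u set)"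
  shows "A \<times> B \<lesssim> (UNIV :: 'u set)"
proof -
  have "(UNIV :: 'u set) \<times> (UNIV :: 'u set) \<lesssim> (UNIV :: 'u set)"
    using eqpoll_imp_lepoll[OF times_self_eqpoll_infinite[OF assms(1)]] by simp
  then show ?thesis using times_lepoll_mono[OF assms(2,3)] lepoll_trans by blast
qed

lemma Sigma_lepoll_infinite:
  assumes "infinite (UNIV :: 'u set)" "A \<lesssim> (UNIV :: 'u set)" "\<And>a. a \<in> A \<Longrightarrow> B a \<lesssim> (UNIV :: 'u set)"
  shows "Sigma A B \<lesssim> (UNIV :: 'u set)"
proof -
  have "Sigma A B \<lesssim> A \<times> (UNIV :: 'u set)"
    by (rule Sigma_lepoll_mono) (use assms(3) in auto)
  also have "\<dots> \<lesssim> (UNIV :: 'u set)"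
    by (rule times_lepoll_infinite) (use assms in auto)
  finally show ?thesis .
qed

text \<open>An element is a finite sum of singles, so lists of pairs of an index and a vector map
  onto the direct sum. Finite support is essential here: all functions on \<open>S\<close> could be
  too many.\<close>

lemma (in module_family) direct_sum_lepoll:
  assumes "infinite (UNIV :: 'u set)" "S \<lesssim> (UNIV :: 'u set)"
    and "\<And>s. s \<in> S \<Longrightarrow> carrier (V s) \<lesssim> (UNIV :: 'u set)"
  shows "carrier (direct_sum K S V) \<lesssim> (UNIV :: 'u set)"
proof -
  define g where "g = (\<lambda>l. foldr (\<lambda>p \<phi>. single V (fst p) (snd p) \<oplus>\<^bsub>direct_sum K S V\<^esub> \<phi>) l \<zero>\<^bsub>direct_sum K S V\<^esub>)"
  have "\<phi> \<in> g ` lists (SIGMA s:S. carrier (V s))" if "\<phi> \<in> carrier (direct_sum K S V)" for \<phi>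
    using that
  proof (induction \<phi> rule: direct_sum_induct)
    case zero
    show ?case by (rule image_eqI[of _ _ "[]"]) (auto simp: g_def)
  next
    case (add s v \<psi>)
    then obtain l where "l \<in> lists (SIGMA s:S. carrier (V s))" "\<psi> = g l" by auto
    with add show ?case by (intro image_eqI[of _ _ "(s, v) # l"]) (auto simp: g_def)
  qed
  then have "carrier (direct_sum K S V) \<lesssim> lists (SIGMA s:S. carrier (V s))"
    by (intro subset_image_lepoll[of _ g]) auto
  also have "\<dots> \<lesssim> (UNIV :: 'u set)"
    by (intro lists_lepoll_infinite Sigma_lepoll_infinite assms)
  finally show ?thesis .
qed

text \<open>By type a tensor is a set of functions, yet lists of pairs of vectors already map onto
  the tensors. This bounds the Hom spaces of the enveloping category, for which typing gives no
  bound by \<open>'u\<close>.\<close>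

lemma (in tensor) tensor_lepoll:
  assumes "infinite (UNIV :: 'u set)" "carrier V \<lesssim> (UNIV :: 'u set)" "carrier W \<lesssim> (UNIV :: 'u set)"
  shows "carrier T \<lesssim> (UNIV :: 'u set)"
proof -
  define g where "g = (\<lambda>l. foldr (\<lambda>p t. (fst p \<otimes>\<^sub>T snd p) \<oplus>\<^bsub>T\<^esub> t) l \<zero>\<^bsub>T\<^esub>)"
  have "t \<in> g ` lists (carrier V \<times> carrier W)" if "t \<in> carrier T" for t
    using that
  proof (induction t rule: tensor_induct)
    case zero
    show ?case by (rule image_eqI[of _ _ "[]"]) (auto simp: g_def)
  next
    case (add v w t)
    then obtain l where "l \<in> lists (carrier V \<times> carrier W)" "t = g l" by auto
    with add show ?case by (intro image_eqI[of _ _ "(v, w) # l"]) (auto simp: g_def)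
  qed
  then have "carrier T \<lesssim> lists (carrier V \<times> carrier W)"
    by (intro subset_image_lepoll[of _ g]) auto
  also have "\<dots> \<lesssim> (UNIV :: 'u set)"
    by (intro lists_lepoll_infinite times_lepoll_infinite assms)
  finally show ?thesis .
qed

section \<open>Free modules and projective resolutions\<close>

lemma (in module_family) direct_sum_linear_eq:
  assumes "module K U" "f \<in> linear_maps K (direct_sum K S V) U" "g \<in> linear_maps K (direct_sum K S V) U"
    and "\<And>s v. s \<in> S \<Longrightarrow> v \<in> carrier (V s) \<Longrightarrow> f (single V s v) = g (single V s v)"
    and "\<phi> \<in> carrier (direct_sum K S V)"
  shows "f \<phi> = g \<phi>"
  using assms(5)
proof (induction \<phi> rule: direct_sum_induct)
  case zero
  show ?case using linear_maps_zero[OF module_direct_sum assms(1)] assms(2,3) by metis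
next
  case (add s v \<psi>)
  then show ?case
    using assms(4) single_closed by (simp add: linear_maps_add[OF assms(2)] linear_maps_add[OF assms(3)] del: direct_sum_simps)
qed

section \<open>Copies of modules along injections into another type\<close>

definition transport_module :: "('w \<Rightarrow> 'v) \<Rightarrow> ('k, 'w) module \<Rightarrow> ('k, 'v) module" where
  "transport_module \<iota> V =
    (let \<kappa> = inv_into (carrier V) \<iota> in
    \<lparr>carrier = \<iota> ` carrier V, monoid.mult = undefined, one = undefined, ring.zero = \<iota> \<zero>\<^bsub>V\<^esub>,
     ring.add = (\<lambda>a b. \<iota> (\<kappa> a \<oplus>\<^bsub>V\<^esub> \<kappa> b)), module.smult = (\<lambda>c a. \<iota> (c \<odot>\<^bsub>V\<^esub> \<kappa> a))\<rparr>)"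

text \<open>Free modules have functions as elements, but in \<open>projective_resolution\<close> all
  modules share the element type of \<open>X\<close>. An injection \<open>\<iota> x\<close> on each
  carrier moves them into that type.\<close>

definition transport ::
  "('o \<Rightarrow> 'w \<Rightarrow> 'v) \<Rightarrow> ('o, 'k, 'a, 'w) left_module \<Rightarrow> ('o, 'k, 'a, 'v) left_module" where
  "transport \<iota> X =
    \<lparr>fobj = (\<lambda>x. transport_module (\<iota> x) (fobj X x)),
     farr = (\<lambda>x y f. \<lambda>a\<in>\<iota> x ` carrier (fobj X x).
       \<iota> y (farr X x y f (inv_into (carrier (fobj X x)) (\<iota> x) a)))\<rparr>"

definition transport_back :: "('o \<Rightarrow> 'w \<Rightarrow> 'v) \<Rightarrow> ('o, 'k, 'a, 'w) left_module \<Rightarrow> 'o \<Rightarrow> 'v \<Rightarrow> 'w" where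
  "transport_back \<iota> X x = inv_into (carrier (fobj X x)) (\<iota> x)"

lemma carrier_transport [simp]: "carrier (fobj (transport \<iota> X) x) = \<iota> x ` carrier (fobj X x)"
  by (simp add: transport_def transport_module_def Let_def)

lemma transport_module_linear:
  assumes "inj_on \<iota> (carrier V)"
  shows "\<iota> \<in> linear_maps K V (transport_module \<iota> V)"
  using assms by (intro linear_mapsI) (auto simp: transport_module_def Let_def)

lemma module_transport_module:
  assumes "module K V" "inj_on \<iota> (carrier V)"
  shows "module K (transport_module \<iota> V)"
  by (rule module_image[OF assms(1) transport_module_linear[OF assms(2)]])
    (simp_all add: transport_module_def Let_def)

context linear_category
begin

context
  fixes X :: "('o, 'k, 'a, 'w) left_module" and \<iota> :: "'o \<Rightarrow> 'w \<Rightarrow> 'v"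
  assumes X: "left_module K C X" and inj: "\<And>x. x \<in> Obj C \<Longrightarrow> inj_on (\<iota> x) (carrier (fobj X x))"
begin

interpretation X: left_module K C X by (rule X)

lemma transport_back_transport: "x \<in> Obj C \<Longrightarrow> v \<in> carrier (fobj X x) \<Longrightarrow> transport_back \<iota> X x (\<iota> x v) = v"
  using inj by (simp add: transport_back_def)

lemma transport_linear: "x \<in> Obj C \<Longrightarrow> \<iota> x \<in> linear_maps K (fobj X x) (fobj (transport \<iota> X) x)"
  using transport_module_linear[OF inj] by (simp add: transport_def)

lemma farr_transport:
  "x \<in> Obj C \<Longrightarrow> v \<in> carrier (fobj X x) \<Longrightarrow> farr (transport \<iota> X) x y f (\<iota> x v) = \<iota> y (farr X x y f v)"
  using inj by (simp add: transport_def)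

lemma left_module_transport: "left_module K C (transport \<iota> X)"
proof (rule left_moduleI)
  show "module K (fobj (transport \<iota> X) x)" if "x \<in> Obj C" for x
    using module_transport_module[OF X.module_fobj inj] that by (simp add: transport_def)
next
  fix x y assume xy: "x \<in> Obj C" "y \<in> Obj C"
  note l = transport_linear
  note cl = module_add_closed[OF X.module_fobj] module_smult_closed[OF X.module_fobj]
    module_add_closed[OF Hom_module] module_smult_closed[OF Hom_module]
  show "farr (transport \<iota> X) x y \<in> bilinear_maps K (Hom C x y) (fobj (transport \<iota> X) x) (fobj (transport \<iota> X) y)"
    by (intro bilinear_mapsI linear_mapsI)
      (auto simp: farr_transport xy X.farr_closed cl bilinear_maps_simps[OF X.farr_bilinear]
        linear_maps_add[OF l, symmetric] linear_maps_smult[OF l, symmetric])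
next
  show "farr (transport \<iota> X) x y f \<in> extensional (carrier (fobj (transport \<iota> X) x))" for x y f
    by (simp add: transport_def transport_module_def Let_def)
qed (auto simp: farr_transport X.farr_Id_apply X.farr_Comp_apply X.farr_closed)

lemma transport_map: "\<iota> \<in> module_maps K C X (transport \<iota> X)"
  by (rule module_mapsI) (auto simp: transport_linear farr_transport)

lemma transport_back_map: "transport_back \<iota> X \<in> module_maps K C (transport \<iota> X) X"
  by (intro module_mapsI linear_mapsI)
    (auto simp: transport_back_transport farr_transport X.farr_closed linear_maps_add[OF transport_linear, symmetric]
      linear_maps_smult[OF transport_linear, symmetric] module_add_closed[OF X.module_fobj] module_smult_closed[OF X.module_fobj])

end

section \<open>Free modules, their lifting property and free covers\<close>

definition generators :: "('o, 'k, 'a, 'v) left_module \<Rightarrow> ('o \<times> 'v) set" where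
  "generators X = (SIGMA y:Obj C. carrier (fobj X y))"

text \<open>The value for \<open>fst p \<notin> Obj C\<close> is irrelevant, but has to be a module for \<^locale>\<open>module_family\<close>.\<close>

definition summand :: "'o \<Rightarrow> 'o \<times> 'v \<Rightarrow> ('k, 'a) module" where
  "summand x p = Hom C (if fst p \<in> Obj C then fst p else x) x"

text \<open>The direct sum of representable functors \<open>C(y, -)\<close>, with one copy for every
  element of \<open>X\<close> at \<open>y\<close>; arrows act by postcomposition in each
  coordinate.\<close>

definition free_functor :: "('o, 'k, 'a, 'v) left_module \<Rightarrow> ('o, 'k, 'a, 'o \<times> 'v \<Rightarrow> 'a) left_module" where
  "free_functor X =
    \<lparr>fobj = (\<lambda>x. direct_sum K (generators X) (summand x)),
     farr = (\<lambda>x y f. \<lambda>\<phi>\<in>carrier (direct_sum K (generators X) (summand x)).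
       (\<lambda>p. if p \<in> generators X then Comp C (fst p) x y f (\<phi> p) else \<zero>\<^bsub>summand y p\<^esub>))\<rparr>"

text \<open>Yoneda: a map from \<open>C(y, -)\<close> to \<open>Y\<close> is fixed by the image
  \<open>c p\<close> of the identity and sends \<open>h\<close> to the action of \<open>h\<close> on
  \<open>c p\<close>.\<close>

definition free_lift ::
  "('o, 'k, 'a, 'w) left_module \<Rightarrow> ('o \<times> 'v \<Rightarrow> 'w) \<Rightarrow> 'o \<Rightarrow> ('o \<times> 'v \<Rightarrow> 'a) \<Rightarrow> 'w" where
  "free_lift Y c x = sum_map (summand x) (fobj Y x) (\<lambda>p h. farr Y (fst p) x h (c p))"

lemma summand_family: "x \<in> Obj C \<Longrightarrow> module_family K (summand x)"
  by (auto simp: module_family_def summand_def Hom_module intro: module_cring[OF Hom_module])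

lemma summand_generator: "p \<in> generators X \<Longrightarrow> fst p \<in> Obj C \<and> summand x p = Hom C (fst p) x"
  by (auto simp: generators_def summand_def)

lemma fobj_free_functor [simp]: "fobj (free_functor X) x = direct_sum K (generators X) (summand x)"
  by (simp add: free_functor_def)

lemma farr_free_functor:
  "\<phi> \<in> carrier (direct_sum K (generators X) (summand x)) \<Longrightarrow> farr (free_functor X) x y f \<phi> =
     (\<lambda>p. if p \<in> generators X then Comp C (fst p) x y f (\<phi> p) else \<zero>\<^bsub>summand y p\<^esub>)"
  by (simp add: free_functor_def)

lemma farr_free_closed:
  assumes "x \<in> Obj C" "y \<in> Obj C" "f \<in> carrier (Hom C x y)" "\<phi> \<in> carrier (direct_sum K (generators X) (summand x))"
  shows "farr (free_functor X) x y f \<phi> \<in> carrier (direct_sum K (generators X) (summand y))"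
proof -
  interpret x: module_family K "generators X" "summand x" by (rule summand_family) fact
  interpret y: module_family K "generators X" "summand y" by (rule summand_family) fact
  note p = summand_generator[of _ X]
  have zero: "Comp C (fst q) x y f \<zero>\<^bsub>Hom C (fst q) x\<^esub> = \<zero>\<^bsub>Hom C (fst q) y\<^esub>" if "q \<in> generators X" for q
    using linear_maps_zero[OF Hom_module Hom_module Comp_linear_right] assms p[OF that] by auto
  have "finite {q. \<phi> q \<noteq> \<zero>\<^bsub>summand x q\<^esub>}" using assms(4) by (simp add: x.mem_direct_sum)
  then have "finite {q. farr (free_functor X) x y f \<phi> q \<noteq> \<zero>\<^bsub>summand y q\<^esub>}"
    by (rule rev_finite_subset) (use assms(4) zero p in \<open>auto simp: farr_free_functor\<close>)
  moreover have "\<phi> q \<in> carrier (Hom C (fst q) x)" if "q \<in> generators X" for q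
    using assms(4) p[OF that] unfolding x.mem_direct_sum by metis
  ultimately show ?thesis
    using assms p module_zero_closed[OF y.module_V]
    by (auto simp: y.mem_direct_sum farr_free_functor Comp_closed)
qed

lemma left_module_free_functor: "left_module K C (free_functor X)"
proof (rule left_moduleI)
  show "module K (fobj (free_functor X) x)" if "x \<in> Obj C" for x
    using module_family.module_direct_sum[OF summand_family[OF that]] by simp
next
  fix x y assume xy: "x \<in> Obj C" "y \<in> Obj C"
  interpret x: module_family K "generators X" "summand x" by (rule summand_family) fact
  interpret y: module_family K "generators X" "summand y" by (rule summand_family) fact
  note p = summand_generator[of _ X]
  have val: "\<phi> q \<in> carrier (Hom C (fst q) x)"
    if "\<phi> \<in> carrier (direct_sum K (generators X) (summand x))" "q \<in> generators X" for \<phi> q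
    using that p[OF that(2)] unfolding x.mem_direct_sum by metis
  note cl = module_add_closed[OF x.module_direct_sum] module_smult_closed[OF x.module_direct_sum]
    module_add_closed[OF Hom_module] module_smult_closed[OF Hom_module]
  show "farr (free_functor X) x y \<in> bilinear_maps K (Hom C x y) (fobj (free_functor X) x) (fobj (free_functor X) y)"
    unfolding fobj_free_functor
  proof (intro bilinear_mapsI linear_mapsI)
    fix f \<phi> \<psi> assume *: "f \<in> carrier (Hom C x y)" "\<phi> \<in> carrier (direct_sum K (generators X) (summand x))" "\<psi> \<in> carrier (direct_sum K (generators X) (summand x))"
    show "farr (free_functor X) x y f (\<phi> \<oplus>\<^bsub>direct_sum K (generators X) (summand x)\<^esub> \<psi>) =
        farr (free_functor X) x y f \<phi> \<oplus>\<^bsub>direct_sum K (generators X) (summand y)\<^esub> farr (free_functor X) x y f \<psi>"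
      using * cl(1)[OF *(2,3)] xy p val bilinear_maps_simps(3)[OF Comp_bilinear]
      by (auto simp: farr_free_functor fun_eq_iff)
  next
    fix f a \<phi> assume *: "f \<in> carrier (Hom C x y)" "a \<in> carrier K" "\<phi> \<in> carrier (direct_sum K (generators X) (summand x))"
    show "farr (free_functor X) x y f (a \<odot>\<^bsub>direct_sum K (generators X) (summand x)\<^esub> \<phi>) =
        a \<odot>\<^bsub>direct_sum K (generators X) (summand y)\<^esub> farr (free_functor X) x y f \<phi>"
      using * cl(2)[OF *(2,3)] xy p val bilinear_maps_simps(5)[OF Comp_bilinear]
      by (auto simp: farr_free_functor fun_eq_iff)
  next
    fix f g \<phi> assume *: "f \<in> carrier (Hom C x y)" "g \<in> carrier (Hom C x y)" "\<phi> \<in> carrier (direct_sum K (generators X) (summand x))"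
    show "farr (free_functor X) x y (f \<oplus>\<^bsub>Hom C x y\<^esub> g) \<phi> =
        farr (free_functor X) x y f \<phi> \<oplus>\<^bsub>direct_sum K (generators X) (summand y)\<^esub> farr (free_functor X) x y g \<phi>"
      using * xy p val bilinear_maps_simps(2)[OF Comp_bilinear]
      by (auto simp: farr_free_functor fun_eq_iff)
  next
    fix f a \<phi> assume *: "f \<in> carrier (Hom C x y)" "a \<in> carrier K" "\<phi> \<in> carrier (direct_sum K (generators X) (summand x))"
    show "farr (free_functor X) x y (a \<odot>\<^bsub>Hom C x y\<^esub> f) \<phi> =
        a \<odot>\<^bsub>direct_sum K (generators X) (summand y)\<^esub> farr (free_functor X) x y f \<phi>"
      using * xy p val bilinear_maps_simps(4)[OF Comp_bilinear]
      by (auto simp: farr_free_functor fun_eq_iff)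
  qed (simp_all add: farr_free_closed xy)
next
  show "farr (free_functor X) x y f \<in> extensional (carrier (fobj (free_functor X) x))" for x y f
    by (simp add: free_functor_def)
next
  fix x v assume x: "x \<in> Obj C" and v: "v \<in> carrier (fobj (free_functor X) x)"
  interpret x: module_family K "generators X" "summand x" by (rule summand_family) fact
  show "farr (free_functor X) x x (Id C x) v = v"
    using x v summand_generator[of _ X] Comp_Id_left
    by (auto simp: farr_free_functor fun_eq_iff x.mem_direct_sum) metis
next
  fix x y z f g v
  assume *: "x \<in> Obj C" "y \<in> Obj C" "z \<in> Obj C" "f \<in> carrier (Hom C x y)"
      "g \<in> carrier (Hom C y z)" "v \<in> carrier (fobj (free_functor X) x)"
  interpret x: module_family K "generators X" "summand x" by (rule summand_family) fact
  have "v q \<in> carrier (Hom C (fst q) x) \<and> fst q \<in> Obj C" if "q \<in> generators X" for q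
    using *(6) summand_generator[OF that] unfolding fobj_free_functor x.mem_direct_sum by metis
  then show "farr (free_functor X) x z (Comp C x y z g f) v = farr (free_functor X) y z g (farr (free_functor X) x y f v)"
    using * farr_free_functor[OF farr_free_closed[OF *(1,2,4) *(6)[unfolded fobj_free_functor]]]
    by (auto simp: farr_free_functor[of v X x] fun_eq_iff Comp_assoc)
qed

lemma farr_free_single:
  assumes "x \<in> Obj C" "y \<in> Obj C" "f \<in> carrier (Hom C x y)" "p \<in> generators X" "h \<in> carrier (Hom C (fst p) x)"
  shows "farr (free_functor X) x y f (single (summand x) p h) = single (summand y) p (Comp C (fst p) x y f h)"
proof -
  interpret x: module_family K "generators X" "summand x" by (rule summand_family) fact
  have "single (summand x) p h \<in> carrier (direct_sum K (generators X) (summand x))"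
    using assms summand_generator[OF assms(4)] by (intro x.single_closed) auto
  moreover have "Comp C (fst q) x y f \<zero>\<^bsub>summand x q\<^esub> = \<zero>\<^bsub>summand y q\<^esub>" if "q \<in> generators X" for q
    using linear_maps_zero[OF Hom_module Hom_module Comp_linear_right] assms summand_generator[OF that] by auto
  ultimately show ?thesis
    using assms by (auto simp: farr_free_functor single_def fun_eq_iff)
qed

context
  fixes X :: "('o, 'k, 'a, 'v) left_module" and Y :: "('o, 'k, 'a, 'w) left_module" and c :: "'o \<times> 'v \<Rightarrow> 'w"
  assumes Y: "left_module K C Y" and c: "\<And>p. p \<in> generators X \<Longrightarrow> c p \<in> carrier (fobj Y (fst p))"
begin

interpretation Y: left_module K C Y by (rule Y)

lemma free_lift_linear:
  "x \<in> Obj C \<Longrightarrow> free_lift Y c x \<in> linear_maps K (fobj (free_functor X) x) (fobj Y x)"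
  unfolding free_lift_def fobj_free_functor
  by (rule module_family.sum_map_linear[OF summand_family])
    (use c Y.farr_linear_arrow summand_generator[of _ X] in \<open>auto simp: Y.module_fobj\<close>)

lemma free_lift_single:
  "x \<in> Obj C \<Longrightarrow> p \<in> generators X \<Longrightarrow> h \<in> carrier (Hom C (fst p) x) \<Longrightarrow>
    free_lift Y c x (single (summand x) p h) = farr Y (fst p) x h (c p)"
  unfolding free_lift_def
  by (rule module_family.sum_map_single[OF summand_family])
    (use c Y.farr_linear_arrow summand_generator[of _ X] in \<open>auto simp: Y.module_fobj\<close>)

lemma free_lift_map: "free_lift Y c \<in> module_maps K C (free_functor X) Y"
proof (rule module_mapsI)
  fix x y f \<phi> assume *: "x \<in> Obj C" "y \<in> Obj C" "f \<in> carrier (Hom C x y)" "\<phi> \<in> carrier (fobj (free_functor X) x)"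
  interpret F: left_module K C "free_functor X" by (rule left_module_free_functor)
  interpret x: module_family K "generators X" "summand x" by (rule summand_family) fact
  show "free_lift Y c y (farr (free_functor X) x y f \<phi>) = farr Y x y f (free_lift Y c x \<phi>)"
  proof (rule x.direct_sum_linear_eq)
    show "module K (fobj Y y)" using * by (simp add: Y.module_fobj)
    show "(\<lambda>\<phi>. free_lift Y c y (farr (free_functor X) x y f \<phi>)) \<in> linear_maps K (direct_sum K (generators X) (summand x)) (fobj Y y)"
      using linear_maps_comp[OF F.farr_map(1)[OF *(1-3)] free_lift_linear[OF *(2)]] by simp
    show "(\<lambda>\<phi>. farr Y x y f (free_lift Y c x \<phi>)) \<in> linear_maps K (direct_sum K (generators X) (summand x)) (fobj Y y)"
      using linear_maps_comp[OF free_lift_linear[OF *(1)] Y.farr_map(1)[OF *(1-3)]] by simp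
    show "\<phi> \<in> carrier (direct_sum K (generators X) (summand x))" using * by simp
  next
    fix p h assume p: "p \<in> generators X" and "h \<in> carrier (summand x p)"
    then have "h \<in> carrier (Hom C (fst p) x)" "fst p \<in> Obj C" using summand_generator[OF p] by auto
    then show "free_lift Y c y (farr (free_functor X) x y f (single (summand x) p h)) =
        farr Y x y f (free_lift Y c x (single (summand x) p h))"
      using * p c by (simp add: farr_free_single free_lift_single Comp_closed Y.farr_Comp_apply)
  qed
qed (rule free_lift_linear)

end

text \<open>Preimages under \<open>e\<close> have to be chosen only for the generators, and
  \<open>free_lift\<close> extends the choice. Every \<open>single\<close> at \<open>p\<close>
  arises by an arrow acting on the generator \<open>p\<close>, so the two maps agree on singles. The
  element type of \<open>Y\<close> and \<open>Z\<close> is independent of that of the free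
  module.\<close>

lemma free_functor_lift:
  fixes Y Z :: "('o, 'k, 'a, 'w) left_module"
  assumes Y: "left_module K C Y" and Z: "left_module K C Z"
    and e: "e \<in> module_maps K C Y Z" "pointwise_surj C Y Z e" and f: "f \<in> module_maps K C (free_functor X) Z"
  obtains g where "g \<in> module_maps K C (free_functor X) Y"
    "\<And>x v. x \<in> Obj C \<Longrightarrow> v \<in> carrier (fobj (free_functor X) x) \<Longrightarrow> e x (g x v) = f x v"
proof -
  interpret Z: left_module K C Z by fact
  \<comment> \<open>The universal element of the summand \<open>p\<close>: the identity of its
    representing object.\<close>
  let ?s = "\<lambda>p. single (summand (fst p)) p (Id C (fst p))"
  have s: "?s p \<in> carrier (fobj (free_functor X) (fst p))" if "p \<in> generators X" for p
    using summand_generator[OF that] Id_closed that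
    by (auto intro!: module_family.single_closed[OF summand_family])
  have "\<exists>w. w \<in> carrier (fobj Y (fst p)) \<and> e (fst p) w = f (fst p) (?s p)" if "p \<in> generators X" for p
  proof -
    have "f (fst p) (?s p) \<in> carrier (fobj Z (fst p))"
      using module_maps_closed[OF f _ s[OF that]] summand_generator[OF that] by blast
    then show ?thesis using e(2) summand_generator[OF that] unfolding pointwise_surj_def by (metis imageE)
  qed
  then obtain c where c: "\<And>p. p \<in> generators X \<Longrightarrow> c p \<in> carrier (fobj Y (fst p))"
    "\<And>p. p \<in> generators X \<Longrightarrow> e (fst p) (c p) = f (fst p) (?s p)" by metis
  show thesis
  proof (rule that[OF free_lift_map[OF Y c(1)]])
    fix x \<phi> assume x: "x \<in> Obj C" and \<phi>: "\<phi> \<in> carrier (fobj (free_functor X) x)"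
    interpret x: module_family K "generators X" "summand x" by (rule summand_family) fact
    have 1: "(\<lambda>\<phi>. e x (free_lift Y c x \<phi>)) \<in> linear_maps K (direct_sum K (generators X) (summand x)) (fobj Z x)"
      using linear_maps_comp[OF free_lift_linear[OF Y c(1) x] module_maps_linear[OF e(1) x]] by simp
    have 2: "f x \<in> linear_maps K (direct_sum K (generators X) (summand x)) (fobj Z x)"
      using module_maps_linear[OF f x] by simp
    show "e x (free_lift Y c x \<phi>) = f x \<phi>"
    proof (rule x.direct_sum_linear_eq[OF Z.module_fobj[OF x] 1 2])
      fix p h assume p: "p \<in> generators X" and "h \<in> carrier (summand x p)"
      then have h: "h \<in> carrier (Hom C (fst p) x)" and o: "fst p \<in> Obj C" using summand_generator[OF p] by auto
      have "e x (free_lift Y c x (single (summand x) p h)) = farr Z (fst p) x h (f (fst p) (?s p))"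
        using p h o x c by (simp add: free_lift_single[OF Y c(1)] module_maps_natural[OF e(1)])
      also have "\<dots> = f x (farr (free_functor X) (fst p) x h (?s p))"
        by (rule module_maps_natural[OF f o x h s[OF p], symmetric])
      also have "\<dots> = f x (single (summand x) p h)"
        using p h o x by (simp add: farr_free_single Id_closed Comp_Id_right)
      finally show "e x (free_lift Y c x (single (summand x) p h)) = f x (single (summand x) p h)" .
    qed (use \<phi> in simp)
  qed
qed

text \<open>The sizes under which a free module can be coded in \<open>U\<close>. Hom spaces are
  bounded explicitly, since for the enveloping category their elements are cosets and belong to a
  type other than that of \<open>U\<close>.\<close>

definition fits_universe :: "'v set \<Rightarrow> bool" where
  "fits_universe U \<longleftrightarrow> infinite U \<and> Obj C \<lesssim> U \<and> (\<forall>x\<in>Obj C. \<forall>y\<in>Obj C. carrier (Hom C x y) \<lesssim> U)"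

definition cover_code :: "('o, 'k, 'a, 'v) left_module \<Rightarrow> 'o \<Rightarrow> ('o \<times> 'v \<Rightarrow> 'a) \<Rightarrow> 'v" where
  "cover_code X x = (SOME \<iota>. inj_on \<iota> (carrier (fobj (free_functor X) x)))"

definition cover :: "('o, 'k, 'a, 'v) left_module \<Rightarrow> ('o, 'k, 'a, 'v) left_module" where
  "cover X = transport (cover_code X) (free_functor X)"

text \<open>The generator \<open>(y, v)\<close> goes to \<open>v\<close>, whence \<open>snd\<close>.
  An element \<open>v\<close> of \<open>X\<close> at \<open>x\<close> is therefore reached from the
  identity in the summand \<open>(x, v)\<close>.\<close>

definition cover_map :: "('o, 'k, 'a, 'v) left_module \<Rightarrow> 'o \<Rightarrow> 'v \<Rightarrow> 'v" where
  "cover_map X x v = free_lift X snd x (transport_back (cover_code X) (free_functor X) x v)"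

context
  fixes X :: "('o, 'k, 'a, 'v) left_module"
  assumes fits: "fits_universe (UNIV :: 'v set)"
begin

lemma inj_cover_code:
  assumes x: "x \<in> Obj C"
  shows "inj_on (cover_code X x) (carrier (fobj (free_functor X) x))"
proof -
  have gen: "generators X \<lesssim> (UNIV :: 'v set)"
    unfolding generators_def
    by (rule Sigma_lepoll_infinite) (use fits in \<open>auto simp: fits_universe_def subset_imp_lepoll\<close>)
  have "carrier (direct_sum K (generators X) (summand x)) \<lesssim> (UNIV :: 'v set)"
    by (rule module_family.direct_sum_lepoll[OF summand_family[OF x] _ gen])
      (use fits x summand_generator[of _ X] in \<open>auto simp: fits_universe_def\<close>)
  then have "\<exists>\<iota> :: ('o \<times> 'v \<Rightarrow> 'a) \<Rightarrow> 'v. inj_on \<iota> (carrier (fobj (free_functor X) x))"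
    by (auto simp: lepoll_def)
  then show ?thesis unfolding cover_code_def by (rule someI_ex)
qed

lemma left_module_cover: "left_module K C (cover X)"
  unfolding cover_def by (rule left_module_transport[OF left_module_free_functor inj_cover_code])

text \<open>The coding is an isomorphism with the free module, so a lift made there serves for the
  cover. \<open>Y\<close> and \<open>Z\<close> may have any element type \<open>'w\<close>; this
  freedom is what reaches the bimodules \<open>Hom K (M, N)\<close>, whose elements are
  functions.\<close>

lemma cover_lift:
  fixes Y Z :: "('o, 'k, 'a, 'w) left_module"
  assumes Y: "left_module K C Y" and Z: "left_module K C Z"
    and e: "e \<in> module_maps K C Y Z" "pointwise_surj C Y Z e" and f: "f \<in> module_maps K C (cover X) Z"
  obtains g where "g \<in> module_maps K C (cover X) Y"
    "\<And>x v. x \<in> Obj C \<Longrightarrow> v \<in> carrier (fobj (cover X) x) \<Longrightarrow> e x (g x v) = f x v"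
proof -
  note T = left_module_free_functor inj_cover_code
  note forward = transport_map[OF T, folded cover_def] and backward = transport_back_map[OF T, folded cover_def]
  obtain g where g: "g \<in> module_maps K C (free_functor X) Y"
    "\<And>x v. x \<in> Obj C \<Longrightarrow> v \<in> carrier (fobj (free_functor X) x) \<Longrightarrow> e x (g x v) = f x (cover_code X x v)"
    using free_functor_lift[OF Y Z e module_maps_comp[OF forward f]] by blast
  show thesis
  proof (rule that[OF module_maps_comp[OF backward g(1)]])
    fix x v assume "x \<in> Obj C" "v \<in> carrier (fobj (cover X) x)"
    then show "e x (g x (transport_back (cover_code X) (free_functor X) x v)) = f x v"
      using g(2) by (auto simp: cover_def transport_back_transport[OF T] simp del: fobj_free_functor)
  qed
qed

lemma projective_cover: "field K \<Longrightarrow> projective_object (left_modules K C) (cover X)"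
proof (rule projective_objectI[OF _ left_module_cover])
  fix Y Z :: "('o, 'k, 'a, 'v) left_module" and e f
  assume "left_module K C Y" "left_module K C Z" "e \<in> module_maps K C Y Z" "pointwise_surj C Y Z e"
    "f \<in> module_maps K C (cover X) Z"
  from cover_lift[OF this]
  show "\<exists>g\<in>module_maps K C (cover X) Y. \<forall>x\<in>Obj C. \<forall>v\<in>carrier (fobj (cover X) x). e x (g x v) = f x v"
    by metis
qed

context
  assumes X: "left_module K C X"
begin

lemma snd_generator: "p \<in> generators X \<Longrightarrow> snd p \<in> carrier (fobj X (fst p))"
  by (auto simp: generators_def)

lemma cover_map_map: "cover_map X \<in> module_maps K C (cover X) X"
  using module_maps_comp[OF transport_back_map[OF left_module_free_functor inj_cover_code]
    free_lift_map[OF X snd_generator]]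
  by (simp add: cover_map_def[abs_def] cover_def)

lemma cover_map_surj: "pointwise_surj C (cover X) X (cover_map X)"
  unfolding pointwise_surj_def
proof
  fix x assume x: "x \<in> Obj C"
  have "v \<in> cover_map X x ` carrier (fobj (cover X) x)" if v: "v \<in> carrier (fobj X x)" for v
  proof -
    have p: "(x, v) \<in> generators X" using x v by (simp add: generators_def)
    define \<phi> :: "'o \<times> 'v \<Rightarrow> 'a" where "\<phi> = single (summand x) (x, v) (Id C x)"
    have \<phi>: "\<phi> \<in> carrier (fobj (free_functor X) x)"
      using summand_generator[OF p, of x] p Id_closed[OF x]
      by (auto simp: \<phi>_def intro!: module_family.single_closed[OF summand_family[OF x]])
    have "transport_back (cover_code X) (free_functor X) x (cover_code X x \<phi>) = \<phi>"
      by (rule transport_back_transport[OF left_module_free_functor inj_cover_code x \<phi>])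
    moreover have "free_lift X snd x \<phi> = v"
      using free_lift_single[OF X snd_generator x p] Id_closed[OF x] left_module.farr_Id_apply[OF X x v] x
      by (simp add: \<phi>_def)
    ultimately have "cover_map X x (cover_code X x \<phi>) = v"
      by (simp add: cover_map_def)
    then show ?thesis using \<phi> by (force simp: cover_def simp del: fobj_free_functor)
  qed
  then show "cover_map X x ` carrier (fobj (cover X) x) = carrier (fobj X x)"
    using module_maps_closed[OF cover_map_map x] by blast
qed

end

end

section \<open>Resolutions by iterated free covers\<close>

definition syzygy :: "('o, 'k, 'a, 'v) left_module \<Rightarrow> ('o, 'k, 'a, 'v) left_module" where
  "syzygy X = kernel_module (cover X) X (cover_map X)"

text \<open>Each kernel is covered anew: with \<open>S n\<close> the iterated kernels,
  \<open>d n\<close> is the cover map of \<open>S (Suc n)\<close>, read in the cover of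
  \<open>S n\<close> through the inclusion. Its image is all of \<open>S (Suc n)\<close>, the kernel
  of the preceding map, and this is exactness.\<close>

lemma projective_resolution_cover:
  fixes X :: "('o, 'k, 'a, 'v) left_module"
  assumes K: "field K" and fits: "fits_universe (UNIV :: 'v set)" and X: "left_module K C X"
  shows "projective_resolution K C X (\<lambda>n. cover ((syzygy ^^ n) X))
    (\<lambda>n. restrict_map (cover ((syzygy ^^ Suc n) X)) (cover_map ((syzygy ^^ Suc n) X)))
    (restrict_map (cover X) (cover_map X))"
proof -
  define S where "S n = (syzygy ^^ n) X" for n
  have S_Suc: "S (Suc n) = kernel_module (cover (S n)) (S n) (cover_map (S n))" for n
    by (simp add: S_def syzygy_def)
  have S: "left_module K C (S n)" for n
  proof (induction n)
    case (Suc n)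
    show ?case unfolding S_Suc
      by (rule left_module_kernel_module[OF left_module_cover[OF fits] Suc cover_map_map[OF fits Suc]])
  qed (simp add: S_def X)
  have d: "cover_map (S (Suc n)) \<in> module_maps K C (cover (S (Suc n))) (cover (S n))" for n
    using module_maps_comp[OF cover_map_map[OF fits S[of "Suc n"], unfolded S_Suc[of n]] kernel_module_inclusion]
    by (simp add: S_Suc)
  have im: "cover_map (S n) x ` carrier (fobj (cover (S n)) x) = carrier (fobj (S n) x)" if "x \<in> Obj C" for n x
    using cover_map_surj[OF fits S] that by (simp add: pointwise_surj_def)
  have im_Suc: "cover_map (S (Suc n)) x ` carrier (fobj (cover (S (Suc n))) x) =
      {v \<in> carrier (fobj (cover (S n)) x). cover_map (S n) x v = \<zero>\<^bsub>fobj (S n) x\<^esub>}" if "x \<in> Obj C" for n x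
    using im[OF that, of "Suc n"] by (simp add: S_Suc)
  \<comment> \<open>Exactness refers to the zero of the cover \<open>P n\<close>, the next kernel to
    the zero of \<open>S (Suc n)\<close>; they are the same element.\<close>
  have zero: "\<zero>\<^bsub>fobj (S (Suc n)) x\<^esub> = \<zero>\<^bsub>fobj (cover (S n)) x\<^esub>" for n x
    by (simp add: S_Suc)
  have [simp]: "(syzygy ^^ Suc n) X = S (Suc n)" "(syzygy ^^ n) X = S n" "S 0 = X" for n
    by (simp_all add: S_def)
  show ?thesis
    unfolding projective_resolution_def left_modules_simps
    using S projective_cover[OF fits K] restrict_map_Hom[OF left_module_cover[OF fits] left_module_cover[OF fits] d]
      restrict_map_Hom[OF left_module_cover[OF fits] X cover_map_map[OF fits X]] im[of _ 0] im_Suc zero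
    by (auto simp: simp del: funpow.simps cong: image_cong_simp conj_cong)
qed

end

section \<open>Bimodules\<close>

lemma module_Hom_vect:
  assumes V: "module K V" and W: "module K W"
  shows "module K (Hom (vect K) V W)"
proof -
  interpret V: module K V by fact
  interpret W: module K W by fact
  note cl = linear_maps_closed[of _ K V W]
  have lin: "restrict h (carrier V) \<in> linear_maps K V W \<inter> extensional (carrier V)" if "h \<in> linear_maps K V W" for h
    using linear_maps_restrict[OF V that] by simp
  have zero: "(\<lambda>v. \<zero>\<^bsub>W\<^esub>) \<in> linear_maps K V W" by (rule linear_mapsI) auto
  show ?thesis
    by (rule module_if_smult_zero)
      (auto simp: V.R.is_cring lin linear_maps_plus[OF W] linear_maps_scale[OF W] zero cl
        W.M.a_assoc W.smult_l_distr W.smult_r_distr W.smult_assoc1 fun_eq_iff restrict_def extensional_def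
        simp del: restrict_apply intro!: linear_maps_plus[OF W] W.M.a_comm
        intro: linear_maps_cong[OF V] linear_maps_restrict[OF V, unfolded restrict_def])
qed

text \<open>Turns an action of pairs \<open>(f, g)\<close> into a functor on the enveloping category
  by extending it linearly over tensors. The arrow \<open>g\<close> runs from \<open>y'\<close> to
  \<open>y\<close>, because the second factor is the opposite category. The regular bimodule and
  \<open>Hom K (M, N)\<close> both have this form, so functoriality is proved once.\<close>

definition bimodule_of ::
  "('k, 'r) ring_scheme \<Rightarrow> ('o \<Rightarrow> 'o \<Rightarrow> ('k, 'v) module) \<Rightarrow> ('o \<Rightarrow> 'o \<Rightarrow> 'o \<Rightarrow> 'o \<Rightarrow> 'a \<Rightarrow> 'a \<Rightarrow> 'v \<Rightarrow> 'v)
    \<Rightarrow> ('o, 'k, 'a, 'v) bimodule" where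
  "bimodule_of K H act =
    \<lparr>fobj = (\<lambda>(x, y). H x y),
     farr = (\<lambda>(x, y) (x', y') t. \<lambda>h\<in>carrier (H x y). tensor_lift K (H x' y') (\<lambda>f g. act x y x' y' f g h) t)\<rparr>"

lemma fobj_bimodule_of [simp]: "fobj (bimodule_of K H act) (x, y) = H x y"
  by (simp add: bimodule_of_def)

context linear_category
begin

abbreviation "Env \<equiv> enveloping_category K C"

lemma two_linear_categories: "two_linear_categories K C (opposite C)"
  by (simp add: two_linear_categories_def linear_category_axioms linear_category_opposite)

interpretation CC: two_linear_categories K C "opposite C"
  by (rule two_linear_categories)

lemma linear_category_Env: "linear_category K Env"
  unfolding enveloping_category_def by (rule CC.E_linear_category)

lemma Env_simps [simp]:
  "Obj Env = Obj C \<times> Obj C"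
  "Hom Env (x, y) (x', y') = tensor_product K (Hom C x x') (Hom C y' y)"
  "Id Env (x, y) = pure_tensor K (Hom C x x) (Hom C y y) (Id C x) (Id C y)"
  unfolding enveloping_category_def by simp_all

lemma Env_tensor: "\<lbrakk>x \<in> Obj C; x' \<in> Obj C; y \<in> Obj C; y' \<in> Obj C\<rbrakk> \<Longrightarrow> tensor K (Hom C x x') (Hom C y' y)"
  by (simp add: tensor_def Hom_module)

lemma Env_maps_eq_on_pure:
  assumes "x \<in> Obj C" "x' \<in> Obj C" "y \<in> Obj C" "y' \<in> Obj C" "module K U"
    and "F \<in> linear_maps K (Hom Env (x, y) (x', y')) U" "G \<in> linear_maps K (Hom Env (x, y) (x', y')) U"
    and "\<And>f g. f \<in> carrier (Hom C x x') \<Longrightarrow> g \<in> carrier (Hom C y' y) \<Longrightarrow>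
      F (pure_tensor K (Hom C x x') (Hom C y' y) f g) = G (pure_tensor K (Hom C x x') (Hom C y' y) f g)"
    and "t \<in> carrier (Hom Env (x, y) (x', y'))"
  shows "F t = G t"
  using tensor.linear_maps_eq_on_pure[OF Env_tensor[OF assms(1-4)] assms(5)] assms(6-9) by simp

text \<open>Both sides of the naturality square are linear in the arrow of the enveloping category,
  and these arrows are sums of pure tensors.\<close>

lemma Env_module_mapsI:
  assumes X: "left_module K Env X" and Y: "left_module K Env Y"
    and lin: "\<And>x y. x \<in> Obj C \<Longrightarrow> y \<in> Obj C \<Longrightarrow> \<eta> (x, y) \<in> linear_maps K (fobj X (x, y)) (fobj Y (x, y))"
    and nat: "\<And>x y x' y' f g v. \<lbrakk>x \<in> Obj C; y \<in> Obj C; x' \<in> Obj C; y' \<in> Obj C; f \<in> carrier (Hom C x x');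
      g \<in> carrier (Hom C y' y); v \<in> carrier (fobj X (x, y))\<rbrakk> \<Longrightarrow>
      \<eta> (x', y') (farr X (x, y) (x', y') (pure_tensor K (Hom C x x') (Hom C y' y) f g) v) =
      farr Y (x, y) (x', y') (pure_tensor K (Hom C x x') (Hom C y' y) f g) (\<eta> (x, y) v)"
  shows "\<eta> \<in> module_maps K Env X Y"
proof (rule module_mapsI)
  interpret X: left_module K Env X by fact
  interpret Y: left_module K Env Y by fact
  show "\<eta> p \<in> linear_maps K (fobj X p) (fobj Y p)" if "p \<in> Obj Env" for p
    using that lin by (cases p) auto
  fix p q t v assume *: "p \<in> Obj Env" "q \<in> Obj Env" "t \<in> carrier (Hom Env p q)" "v \<in> carrier (fobj X p)"
  obtain x y x' y' where [simp]: "p = (x, y)" "q = (x', y')" by (cases p; cases q) auto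
  have obj: "x \<in> Obj C" "x' \<in> Obj C" "y \<in> Obj C" "y' \<in> Obj C" using *(1,2) by auto
  show "\<eta> q (farr X p q t v) = farr Y p q t (\<eta> p v)"
  proof (rule Env_maps_eq_on_pure[OF obj Y.module_fobj])
    show "(\<lambda>t. \<eta> q (farr X p q t v)) \<in> linear_maps K (Hom Env (x, y) (x', y')) (fobj Y q)"
      using linear_maps_comp[OF X.farr_linear_arrow[OF *(1,2,4)]] lin[OF obj(2,4)] by (simp del: Env_simps(2))
    show "(\<lambda>t. farr Y p q t (\<eta> p v)) \<in> linear_maps K (Hom Env (x, y) (x', y')) (fobj Y q)"
      using Y.farr_linear_arrow[OF *(1,2)] linear_maps_closed[OF lin[OF obj(1,3)]] *(4) by (simp del: Env_simps(2))
  qed (use * obj nat in \<open>simp_all del: Env_simps(2)\<close>)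
qed

context
  fixes H :: "'o \<Rightarrow> 'o \<Rightarrow> ('k, 'v) module" and act :: "'o \<Rightarrow> 'o \<Rightarrow> 'o \<Rightarrow> 'o \<Rightarrow> 'a \<Rightarrow> 'a \<Rightarrow> 'v \<Rightarrow> 'v"
  assumes mod: "\<And>x y. x \<in> Obj C \<Longrightarrow> y \<in> Obj C \<Longrightarrow> module K (H x y)"
    and bilin: "\<And>x y x' y' h. \<lbrakk>x \<in> Obj C; y \<in> Obj C; x' \<in> Obj C; y' \<in> Obj C; h \<in> carrier (H x y)\<rbrakk> \<Longrightarrow>
      (\<lambda>f g. act x y x' y' f g h) \<in> bilinear_maps K (Hom C x x') (Hom C y' y) (H x' y')"
    and lin: "\<And>x y x' y' f g. \<lbrakk>x \<in> Obj C; y \<in> Obj C; x' \<in> Obj C; y' \<in> Obj C; f \<in> carrier (Hom C x x');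
      g \<in> carrier (Hom C y' y)\<rbrakk> \<Longrightarrow> act x y x' y' f g \<in> linear_maps K (H x y) (H x' y')"
    and act_Id: "\<And>x y h. \<lbrakk>x \<in> Obj C; y \<in> Obj C; h \<in> carrier (H x y)\<rbrakk> \<Longrightarrow> act x y x y (Id C x) (Id C y) h = h"
    and act_Comp: "\<And>x y x' y' x'' y'' f g f' g' h. \<lbrakk>x \<in> Obj C; y \<in> Obj C; x' \<in> Obj C; y' \<in> Obj C;
      x'' \<in> Obj C; y'' \<in> Obj C; f \<in> carrier (Hom C x x'); g \<in> carrier (Hom C y' y);
      f' \<in> carrier (Hom C x' x''); g' \<in> carrier (Hom C y'' y'); h \<in> carrier (H x y)\<rbrakk> \<Longrightarrow>
      act x y x'' y'' (Comp C x x' x'' f' f) (Comp C y'' y' y g g') h =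
      act x' y' x'' y'' f' g' (act x y x' y' f g h)"
begin

abbreviation "B \<equiv> bimodule_of K H act"

lemma farr_bimodule_of_pure:
  "\<lbrakk>x \<in> Obj C; y \<in> Obj C; x' \<in> Obj C; y' \<in> Obj C; f \<in> carrier (Hom C x x');
      g \<in> carrier (Hom C y' y); h \<in> carrier (H x y)\<rbrakk> \<Longrightarrow>
    farr B (x, y) (x', y') (pure_tensor K (Hom C x x') (Hom C y' y) f g) h = act x y x' y' f g h"
  by (simp add: bimodule_of_def tensor.tensor_lift_pure[OF Env_tensor mod bilin])

lemma farr_bimodule_of_bilinear:
  assumes obj: "x \<in> Obj C" "y \<in> Obj C" "x' \<in> Obj C" "y' \<in> Obj C"
  shows "farr B (x, y) (x', y') \<in> bilinear_maps K (Hom Env (x, y) (x', y')) (H x y) (H x' y')"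
proof -
  note T = Env_tensor[OF obj(1,3,2,4)]
  have 1: "(\<lambda>h. tensor_lift K (H x' y') (\<lambda>f g. act x y x' y' f g h) t) \<in> linear_maps K (H x y) (H x' y')"
    if "t \<in> carrier (Hom Env (x, y) (x', y'))" for t
    using that by (intro tensor.tensor_lift_linear_parameter[OF T mod[OF obj(3,4)] mod[OF obj(1,2)]])
      (simp_all add: obj bilin lin)
  have 2: "tensor_lift K (H x' y') (\<lambda>f g. act x y x' y' f g h) \<in> linear_maps K (Hom Env (x, y) (x', y')) (H x' y')"
    if "h \<in> carrier (H x y)" for h
    using tensor.tensor_lift_linear[OF T mod[OF obj(3,4)] bilin[OF obj that]] by simp
  show ?thesis
  proof (rule bilinear_mapsI)
    show "farr B (x, y) (x', y') t \<in> linear_maps K (H x y) (H x' y')" if "t \<in> carrier (Hom Env (x, y) (x', y'))" for t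
      using linear_maps_restrict[OF mod[OF obj(1,2)] 1[OF that]] by (simp add: bimodule_of_def)
    show "(\<lambda>t. farr B (x, y) (x', y') t h) \<in> linear_maps K (Hom Env (x, y) (x', y')) (H x' y')"
      if "h \<in> carrier (H x y)" for h
      using 2[OF that] that by (simp add: bimodule_of_def)
  qed
qed

text \<open>The law for composites takes the work. It holds for pure \<open>s\<close> and
  \<open>t\<close> by \<open>act_Comp\<close>, then for all \<open>s\<close> with \<open>t\<close>
  pure, then for all \<open>t\<close>, since both sides are linear in each of the two.\<close>

lemma left_module_bimodule_of: "left_module K Env B"
proof -
  interpret Env: linear_category K Env by (rule linear_category_Env)
  show ?thesis
  proof (rule Env.left_moduleI)
    show "module K (fobj B p)" if "p \<in> Obj Env" for p
      using that mod by (cases p) auto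
    show "farr B p q \<in> bilinear_maps K (Hom Env p q) (fobj B p) (fobj B q)" if "p \<in> Obj Env" "q \<in> Obj Env" for p q
      using that farr_bimodule_of_bilinear by (cases p; cases q) (simp del: Env_simps(2))
    show "farr B p q t \<in> extensional (carrier (fobj B p))" for p q t
      by (cases p; cases q) (simp add: bimodule_of_def)
    show "farr B p p (Id Env p) v = v" if "p \<in> Obj Env" "v \<in> carrier (fobj B p)" for p v
      using that by (cases p) (simp add: farr_bimodule_of_pure Id_closed act_Id)
  next
    fix p q r s t h
    assume *: "p \<in> Obj Env" "q \<in> Obj Env" "r \<in> Obj Env" "s \<in> carrier (Hom Env p q)" "t \<in> carrier (Hom Env q r)"
      "h \<in> carrier (fobj B p)"
    obtain x y x' y' x'' y'' where [simp]: "p = (x, y)" "q = (x', y')" "r = (x'', y'')" by (cases p; cases q; cases r) auto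
    have obj: "x \<in> Obj C" "y \<in> Obj C" "x' \<in> Obj C" "y' \<in> Obj C" "x'' \<in> Obj C" "y'' \<in> Obj C" using *(1-3) by auto
    have h: "h \<in> carrier (H x y)" using * by simp
    note b = farr_bimodule_of_bilinear
    note bx = bilinear_mapsD[OF b[OF obj(1-4)]] bilinear_mapsD[OF b[OF obj(3-6)]] bilinear_mapsD[OF b[OF obj(1,2,5,6)]]
    have cl: "farr B p q s h \<in> carrier (H x' y')" if "s \<in> carrier (Hom Env p q)" for s
      using bilinear_maps_simps(1)[OF b[OF obj(1-4)] _ h] that by (simp del: Env_simps(2))
    note pc = tensor.pure_closed[OF Env_tensor]
    have pure: "farr B p r (Comp Env p q r t s) h = farr B q r t (farr B p q s h)"
      if t: "f' \<in> carrier (Hom C x' x'')" "g' \<in> carrier (Hom C y'' y')" "t = pure_tensor K (Hom C x' x'') (Hom C y'' y') f' g'"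
        and s: "f \<in> carrier (Hom C x x')" "g \<in> carrier (Hom C y' y)" "s = pure_tensor K (Hom C x x') (Hom C y' y) f g"
      for f' g' t f g s
    proof -
      have "Comp Env p q r t s = pure_tensor K (Hom C x x'') (Hom C y'' y) (Comp C x x' x'' f' f) (Comp C y'' y' y g g')"
        using CC.Comp_E_pure[of x x' x'' y y' y'' f' f g' g] obj s t by (simp add: enveloping_category_def)
      moreover have "act x y x' y' f g h \<in> carrier (H x' y')"
        using linear_maps_closed[OF lin h] obj s by simp
      ultimately show ?thesis
        using obj s t h by (simp add: farr_bimodule_of_pure Comp_closed act_Comp)
    qed
    have half: "farr B p r (Comp Env p q r t s) h = farr B q r t (farr B p q s h)"
      if t: "f' \<in> carrier (Hom C x' x'')" "g' \<in> carrier (Hom C y'' y')" "t = pure_tensor K (Hom C x' x'') (Hom C y'' y') f' g'"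
        and s: "s \<in> carrier (Hom Env p q)" for f' g' t s
    proof (rule Env_maps_eq_on_pure[OF obj(1,3,2,4) mod[OF obj(5,6)], where t = s])
      have tc: "t \<in> carrier (Hom Env q r)" using t obj by (simp add: pc)
      show "(\<lambda>s. farr B p r (Comp Env p q r t s) h) \<in> linear_maps K (Hom Env (x, y) (x', y')) (H x'' y'')"
        using linear_maps_comp[OF Env.Comp_linear_right[OF *(1-3) tc]] bx(6)[OF h] by (simp del: Env_simps(2))
      show "(\<lambda>s. farr B q r t (farr B p q s h)) \<in> linear_maps K (Hom Env (x, y) (x', y')) (H x'' y'')"
        using linear_maps_comp[OF bx(2)[OF h] bx(3)] tc by (simp del: Env_simps(2))
    qed (use s pure[OF t] in simp_all)
    show "farr B p r (Comp Env p q r t s) h = farr B q r t (farr B p q s h)"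
    proof (rule Env_maps_eq_on_pure[OF obj(3,5,4,6) mod[OF obj(5,6)], where t = t])
      show "(\<lambda>t. farr B p r (Comp Env p q r t s) h) \<in> linear_maps K (Hom Env (x', y') (x'', y'')) (H x'' y'')"
        using linear_maps_comp[OF Env.Comp_linear_left[OF *(1-4)]] bx(6)[OF h] by (simp del: Env_simps(2))
      show "(\<lambda>t. farr B q r t (farr B p q s h)) \<in> linear_maps K (Hom Env (x', y') (x'', y'')) (H x'' y'')"
        using bx(4)[OF cl[OF *(4)]] by (simp del: Env_simps(2))
    qed (use * half in simp_all)
  qed
qed

end

section \<open>The regular bimodule and bimodules of linear maps\<close>

lemma regular_bimodule_eq:
  "regular_bimodule K C = bimodule_of K (\<lambda>x y. Hom C y x)
     (\<lambda>x y x' y' f g h. Comp C y' x x' f (Comp C y' y x h g))"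
  by (simp add: regular_bimodule_def bimodule_of_def)

lemma
  shows left_module_regular_bimodule: "left_module K Env (regular_bimodule K C)"
    and farr_regular_pure: "\<lbrakk>x \<in> Obj C; y \<in> Obj C; x' \<in> Obj C; y' \<in> Obj C; f \<in> carrier (Hom C x x');
      g \<in> carrier (Hom C y' y); h \<in> carrier (Hom C y x)\<rbrakk> \<Longrightarrow>
    farr (regular_bimodule K C) (x, y) (x', y') (pure_tensor K (Hom C x x') (Hom C y' y) f g) h =
      Comp C y' x x' f (Comp C y' y x h g)"
proof -
  have 1: "(\<lambda>f g. Comp C y' x x' f (Comp C y' y x h g)) \<in> bilinear_maps K (Hom C x x') (Hom C y' y) (Hom C y' x')"
    if "x \<in> Obj C" "y \<in> Obj C" "x' \<in> Obj C" "y' \<in> Obj C" "h \<in> carrier (Hom C y x)" for x y x' y' h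
    using that by (intro bilinear_mapsI Comp_linear_left linear_maps_comp[OF Comp_linear_right Comp_linear_right])
      (auto intro: Comp_closed)
  have 2: "(\<lambda>h. Comp C y' x x' f (Comp C y' y x h g)) \<in> linear_maps K (Hom C y x) (Hom C y' x')"
    if "x \<in> Obj C" "y \<in> Obj C" "x' \<in> Obj C" "y' \<in> Obj C" "f \<in> carrier (Hom C x x')" "g \<in> carrier (Hom C y' y)"
    for x y x' y' f g
    using that by (intro linear_maps_comp[OF Comp_linear_left Comp_linear_right])
  show "left_module K Env (regular_bimodule K C)"
    unfolding regular_bimodule_eq
    by (rule left_module_bimodule_of)
      (simp_all add: Hom_module 1 2 Comp_Id_left Comp_Id_right Comp_assoc Comp_closed)
  show "\<lbrakk>x \<in> Obj C; y \<in> Obj C; x' \<in> Obj C; y' \<in> Obj C; f \<in> carrier (Hom C x x');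
      g \<in> carrier (Hom C y' y); h \<in> carrier (Hom C y x)\<rbrakk> \<Longrightarrow>
    farr (regular_bimodule K C) (x, y) (x', y') (pure_tensor K (Hom C x x') (Hom C y' y) f g) h =
      Comp C y' x x' f (Comp C y' y x h g)"
    unfolding regular_bimodule_eq
    by (rule farr_bimodule_of_pure)
      (simp_all add: Hom_module 1 2 Comp_Id_left Comp_Id_right Comp_assoc Comp_closed)
qed

text \<open>Covariant in \<open>N\<close> and contravariant in \<open>M\<close>: a pair of arrows
  sends \<open>h\<close> to \<open>N f \<circ> h \<circ> M g\<close>. Restricting to the carrier
  keeps the result an arrow of \<open>vect\<close>.\<close>

definition hom_bimodule ::
  "('o, 'k, 'a, 'v) left_module \<Rightarrow> ('o, 'k, 'a, 'v) left_module \<Rightarrow> ('o, 'k, 'a, 'v \<Rightarrow> 'v) bimodule" where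
  "hom_bimodule M N = bimodule_of K (\<lambda>x y. Hom (vect K) (fobj M y) (fobj N x))
     (\<lambda>x y x' y' f g h. \<lambda>m\<in>carrier (fobj M y'). farr N x x' f (h (farr M y' y g m)))"

lemma fobj_hom_bimodule [simp]: "fobj (hom_bimodule M N) (x, y) = Hom (vect K) (fobj M y) (fobj N x)"
  by (simp add: hom_bimodule_def)

lemma
  assumes M: "left_module K C M" and N: "left_module K C N"
  shows left_module_hom_bimodule: "left_module K Env (hom_bimodule M N)"
    and farr_hom_pure: "\<lbrakk>x \<in> Obj C; y \<in> Obj C; x' \<in> Obj C; y' \<in> Obj C; f \<in> carrier (Hom C x x');
      g \<in> carrier (Hom C y' y); h \<in> carrier (Hom (vect K) (fobj M y) (fobj N x))\<rbrakk> \<Longrightarrow>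
    farr (hom_bimodule M N) (x, y) (x', y') (pure_tensor K (Hom C x x') (Hom C y' y) f g) h =
      (\<lambda>m\<in>carrier (fobj M y'). farr N x x' f (h (farr M y' y g m)))"
proof -
  interpret M: left_module K C M by fact
  interpret N: left_module K C N by fact
  let ?a = "\<lambda>x y x' y' f g h. \<lambda>m\<in>carrier (fobj M y'). farr N x x' f (h (farr M y' y g m))"
  let ?H = "\<lambda>x y. Hom (vect K) (fobj M y) (fobj N x)"
  have mod: "module K (?H x y)" if "x \<in> Obj C" "y \<in> Obj C" for x y
    using that by (intro module_Hom_vect M.module_fobj N.module_fobj)
  have cl: "?a x y x' y' f g h \<in> carrier (?H x' y')"
    if "x \<in> Obj C" "y \<in> Obj C" "x' \<in> Obj C" "y' \<in> Obj C" "h \<in> carrier (?H x y)" "f \<in> carrier (Hom C x x')"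
      "g \<in> carrier (Hom C y' y)" for x y x' y' f g h
    using that linear_maps_restrict[OF M.module_fobj[OF that(4)]
      linear_maps_comp[OF linear_maps_comp[OF M.farr_map(1)[OF that(4,2,7)]] N.farr_map(1)[OF that(1,3,6)]]]
    by simp
  have val: "h m \<in> carrier (fobj N x)" if "h \<in> linear_maps K (fobj M y) (fobj N x)" "m \<in> carrier (fobj M y)" for h m x y
    using linear_maps_closed that .
  note s = bilinear_maps_simps[OF M.farr_bilinear] bilinear_maps_simps[OF N.farr_bilinear]
    linear_maps_add[of _ K "fobj M _" "fobj N _"] linear_maps_smult[of _ K "fobj M _" "fobj N _"] val
  have 1: "(\<lambda>f g. ?a x y x' y' f g h) \<in> bilinear_maps K (Hom C x x') (Hom C y' y) (?H x' y')"
    if "x \<in> Obj C" "y \<in> Obj C" "x' \<in> Obj C" "y' \<in> Obj C" "h \<in> carrier (?H x y)" for x y x' y' h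
    using that cl[OF that]
    by (intro bilinear_mapsI linear_mapsI) (auto simp: s fun_eq_iff restrict_def)
  have 2: "?a x y x' y' f g \<in> linear_maps K (?H x y) (?H x' y')"
    if "x \<in> Obj C" "y \<in> Obj C" "x' \<in> Obj C" "y' \<in> Obj C" "f \<in> carrier (Hom C x x')" "g \<in> carrier (Hom C y' y)"
    for x y x' y' f g
    using that cl[OF that(1-4) _ that(5,6)]
    by (intro linear_mapsI) (auto simp: s fun_eq_iff restrict_def)
  have 3: "?a x y x y (Id C x) (Id C y) h = h" if "x \<in> Obj C" "y \<in> Obj C" "h \<in> carrier (?H x y)" for x y h
    using that by (auto simp: fun_eq_iff restrict_def extensional_def M.farr_Id_apply N.farr_Id_apply val)
  have 4: "?a x y x'' y'' (Comp C x x' x'' f' f) (Comp C y'' y' y g g') h = ?a x' y' x'' y'' f' g' (?a x y x' y' f g h)"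
    if "x \<in> Obj C" "y \<in> Obj C" "x' \<in> Obj C" "y' \<in> Obj C"
      "x'' \<in> Obj C" "y'' \<in> Obj C" "f \<in> carrier (Hom C x x')" "g \<in> carrier (Hom C y' y)"
      "f' \<in> carrier (Hom C x' x'')" "g' \<in> carrier (Hom C y'' y')" "h \<in> carrier (?H x y)" for x y x' y' x'' y'' f g f' g' h
    using that by (auto simp: fun_eq_iff restrict_def M.farr_Comp_apply N.farr_Comp_apply val M.farr_closed)
  show "left_module K Env (hom_bimodule M N)"
    unfolding hom_bimodule_def by (rule left_module_bimodule_of) (fact mod 1 2 3 4)+
  show "\<lbrakk>x \<in> Obj C; y \<in> Obj C; x' \<in> Obj C; y' \<in> Obj C; f \<in> carrier (Hom C x x');
      g \<in> carrier (Hom C y' y); h \<in> carrier (Hom (vect K) (fobj M y) (fobj N x))\<rbrakk> \<Longrightarrow>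
    farr (hom_bimodule M N) (x, y) (x', y') (pure_tensor K (Hom C x x') (Hom C y' y) f g) h =
      (\<lambda>m\<in>carrier (fobj M y'). farr N x x' f (h (farr M y' y g m)))"
    unfolding hom_bimodule_def by (rule farr_bimodule_of_pure) (assumption | (rule mod 1 2 3 4; assumption))+
qed

lemma hom_bimodule_push:
  assumes M: "left_module K C M" and N: "left_module K C N" and L: "left_module K C L"
    and e: "e \<in> module_maps K C N L"
  shows "(\<lambda>(x, y) h. \<lambda>m\<in>carrier (fobj M y). e x (h m)) \<in> module_maps K Env (hom_bimodule M N) (hom_bimodule M L)"
proof -
  interpret M: left_module K C M by fact
  interpret N: left_module K C N by fact
  have val: "h m \<in> carrier (fobj N x)" if "h \<in> linear_maps K (fobj M y) (fobj N x)" "m \<in> carrier (fobj M y)" for h m x y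
    using linear_maps_closed that .
  have cl: "(\<lambda>m\<in>carrier (fobj M y). e x (h m)) \<in> linear_maps K (fobj M y) (fobj L x)"
    if "x \<in> Obj C" "y \<in> Obj C" "h \<in> linear_maps K (fobj M y) (fobj N x)" for x y h
    using linear_maps_restrict[OF M.module_fobj linear_maps_comp[OF that(3) module_maps_linear[OF e that(1)]]] that by simp
  have cl': "(\<lambda>m\<in>carrier (fobj M y'). farr N x x' f (h (farr M y' y g m))) \<in> linear_maps K (fobj M y') (fobj N x')"
    if "x \<in> Obj C" "y \<in> Obj C" "x' \<in> Obj C" "y' \<in> Obj C" "h \<in> linear_maps K (fobj M y) (fobj N x)"
      "f \<in> carrier (Hom C x x')" "g \<in> carrier (Hom C y' y)" for x y x' y' f g h
    using linear_maps_restrict[OF M.module_fobj[OF that(4)]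
      linear_maps_comp[OF linear_maps_comp[OF M.farr_map(1)[OF that(4,2,7)] that(5)] N.farr_map(1)[OF that(1,3,6)]]] .
  show ?thesis
  proof (rule Env_module_mapsI[OF left_module_hom_bimodule[OF M N] left_module_hom_bimodule[OF M L]])
    fix x y assume "x \<in> Obj C" "y \<in> Obj C"
    then show "(case (x, y) of (x, y) \<Rightarrow> \<lambda>h. \<lambda>m\<in>carrier (fobj M y). e x (h m))
        \<in> linear_maps K (fobj (hom_bimodule M N) (x, y)) (fobj (hom_bimodule M L) (x, y))"
      by (intro linear_mapsI) (auto intro!: restrict_ext simp: cl val linear_maps_add[OF module_maps_linear[OF e]]
        linear_maps_smult[OF module_maps_linear[OF e]])
  next
    fix x y x' y' f g h
    assume "x \<in> Obj C" "y \<in> Obj C" "x' \<in> Obj C" "y' \<in> Obj C" "f \<in> carrier (Hom C x x')"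
      "g \<in> carrier (Hom C y' y)" "h \<in> carrier (fobj (hom_bimodule M N) (x, y))"
    then show "(case (x', y') of (x, y) \<Rightarrow> \<lambda>h. \<lambda>m\<in>carrier (fobj M y). e x (h m))
        (farr (hom_bimodule M N) (x, y) (x', y') (pure_tensor K (Hom C x x') (Hom C y' y) f g) h) =
      farr (hom_bimodule M L) (x, y) (x', y') (pure_tensor K (Hom C x x') (Hom C y' y) f g)
        ((case (x, y) of (x, y) \<Rightarrow> \<lambda>h. \<lambda>m\<in>carrier (fobj M y). e x (h m)) h)"
      by (auto simp: farr_hom_pure[OF M N] farr_hom_pure[OF M L] cl cl' val M.farr_closed
        module_maps_natural[OF e] intro!: restrict_ext)
  qed
qed

text \<open>A linear map into \<open>L\<close> at \<open>x\<close> lifts through the surjection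
  \<open>e x\<close>, which splits over the field. The lift is made for one pair
  \<open>(x, y)\<close> at a time, without regard to arrows; compatibility with arrows is gained
  only by lifting out of a free bimodule.\<close>

lemma hom_bimodule_push_surj:
  assumes K: "field K" and M: "left_module K C M" and N: "left_module K C N" and L: "left_module K C L"
    and e: "e \<in> module_maps K C N L" "pointwise_surj C N L e"
  shows "pointwise_surj Env (hom_bimodule M N) (hom_bimodule M L) (\<lambda>(x, y) h. \<lambda>m\<in>carrier (fobj M y). e x (h m))"
proof -
  interpret M: left_module K C M by fact
  interpret N: left_module K C N by fact
  interpret L: left_module K C L by fact
  let ?p = "\<lambda>x y h. \<lambda>m\<in>carrier (fobj M y). e x (h m)"
  have "?p x y ` carrier (fobj (hom_bimodule M N) (x, y)) = carrier (fobj (hom_bimodule M L) (x, y))"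
    if xy: "x \<in> Obj C" "y \<in> Obj C" for x y
  proof
    show "?p x y ` carrier (fobj (hom_bimodule M N) (x, y)) \<subseteq> carrier (fobj (hom_bimodule M L) (x, y))"
      using module_maps_closed[OF hom_bimodule_push[OF M N L e(1)], of "(x, y)"] xy by auto
    show "carrier (fobj (hom_bimodule M L) (x, y)) \<subseteq> ?p x y ` carrier (fobj (hom_bimodule M N) (x, y))"
    proof
      fix h assume h: "h \<in> carrier (fobj (hom_bimodule M L) (x, y))"
      then obtain g where g: "g \<in> linear_maps K (fobj M y) (fobj N x)"
        "\<And>m. m \<in> carrier (fobj M y) \<Longrightarrow> e x (g m) = h m"
        using linear_lift[OF K N.module_fobj L.module_fobj module_maps_linear[OF e(1)], OF xy(1) xy(1) xy(1)] e(2) xy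
        unfolding pointwise_surj_def by (metis Int_iff fobj_hom_bimodule vect_simps(2))
      have "h = ?p x y (restrict g (carrier (fobj M y)))"
        using g(2) h by (auto simp: fun_eq_iff restrict_def extensional_def)
      moreover have "restrict g (carrier (fobj M y)) \<in> carrier (fobj (hom_bimodule M N) (x, y))"
        using linear_maps_restrict[OF M.module_fobj[OF xy(2)] g(1)] by simp
      ultimately show "h \<in> ?p x y ` carrier (fobj (hom_bimodule M N) (x, y))" by blast
    qed
  qed
  then show ?thesis by (auto simp: pointwise_surj_def)
qed

text \<open>An arrow \<open>c\<close> from \<open>y\<close> to \<open>x\<close> goes to
  \<open>f x \<circ> M c\<close>. Compatibility with the two-sided action is functoriality of
  \<open>M\<close> on \<open>a \<circ> c \<circ> b\<close>, followed by naturality of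
  \<open>f\<close> to move \<open>a\<close> outside.\<close>

lemma regular_to_hom_bimodule:
  assumes M: "left_module K C M" and L: "left_module K C L" and f: "f \<in> module_maps K C M L"
  shows "(\<lambda>(x, y) c. \<lambda>m\<in>carrier (fobj M y). f x (farr M y x c m))
    \<in> module_maps K Env (regular_bimodule K C) (hom_bimodule M L)"
proof -
  interpret M: left_module K C M by fact
  interpret L: left_module K C L by fact
  have cl: "(\<lambda>m\<in>carrier (fobj M y). f x (farr M y x c m)) \<in> linear_maps K (fobj M y) (fobj L x)"
    if "x \<in> Obj C" "y \<in> Obj C" "c \<in> carrier (Hom C y x)" for x y c
    using linear_maps_restrict[OF M.module_fobj linear_maps_comp[OF M.farr_map(1) module_maps_linear[OF f]]] that by blast
  have reg: "fobj (regular_bimodule K C) (x, y) = Hom C y x" for x y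
    by (simp add: regular_bimodule_def)
  show ?thesis
  proof (rule Env_module_mapsI[OF left_module_regular_bimodule left_module_hom_bimodule[OF M L]])
    fix x y assume "x \<in> Obj C" "y \<in> Obj C"
    then show "(case (x, y) of (x, y) \<Rightarrow> \<lambda>c. \<lambda>m\<in>carrier (fobj M y). f x (farr M y x c m))
        \<in> linear_maps K (fobj (regular_bimodule K C) (x, y)) (fobj (hom_bimodule M L) (x, y))"
      by (intro linear_mapsI) (auto intro!: restrict_ext simp: reg cl M.farr_closed bilinear_maps_simps[OF M.farr_bilinear]
        linear_maps_add[OF module_maps_linear[OF f]] linear_maps_smult[OF module_maps_linear[OF f]])
  next
    fix x y x' y' a b c
    assume *: "x \<in> Obj C" "y \<in> Obj C" "x' \<in> Obj C" "y' \<in> Obj C" "a \<in> carrier (Hom C x x')"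
      "b \<in> carrier (Hom C y' y)" "c \<in> carrier (fobj (regular_bimodule K C) (x, y))"
    then have c: "c \<in> carrier (Hom C y x)" by (simp add: reg)
    show "(case (x', y') of (x, y) \<Rightarrow> \<lambda>c. \<lambda>m\<in>carrier (fobj M y). f x (farr M y x c m))
        (farr (regular_bimodule K C) (x, y) (x', y') (pure_tensor K (Hom C x x') (Hom C y' y) a b) c) =
      farr (hom_bimodule M L) (x, y) (x', y') (pure_tensor K (Hom C x x') (Hom C y' y) a b)
        ((case (x, y) of (x, y) \<Rightarrow> \<lambda>c. \<lambda>m\<in>carrier (fobj M y). f x (farr M y x c m)) c)"
      using * c by (auto simp: farr_hom_pure[OF M L] farr_regular_pure cl
        M.farr_closed M.farr_Comp_apply Comp_closed module_maps_natural[OF f] intro!: restrict_ext)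
  qed
qed

text \<open>A map of bimodules from \<open>C\<close> to \<open>Hom K (M, N)\<close> is determined by the images of the identities,
  and these form a map of left modules.\<close>

lemma module_map_if_regular_to_hom:
  assumes M: "left_module K C M" and N: "left_module K C N"
    and \<gamma>: "\<gamma> \<in> module_maps K Env (regular_bimodule K C) (hom_bimodule M N)"
  shows "(\<lambda>x. \<gamma> (x, x) (Id C x)) \<in> module_maps K C M N"
proof (rule module_mapsI)
  interpret M: left_module K C M by fact
  interpret N: left_module K C N by fact
  have reg: "fobj (regular_bimodule K C) (x, y) = Hom C y x" for x y
    by (simp add: regular_bimodule_def)
  have id: "\<gamma> (x, x) (Id C x) \<in> carrier (Hom (vect K) (fobj M x) (fobj N x))" if "x \<in> Obj C" for x
    using module_maps_closed[OF \<gamma>, of "(x, x)" "Id C x"] that by (simp add: reg Id_closed)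
  show "\<gamma> (x, x) (Id C x) \<in> linear_maps K (fobj M x) (fobj N x)" if "x \<in> Obj C" for x
    using id[OF that] by simp
  fix x y u v assume *: "x \<in> Obj C" "y \<in> Obj C" "u \<in> carrier (Hom C x y)" "v \<in> carrier (fobj M x)"
  note pc = tensor.pure_closed[OF Env_tensor]
  \<comment> \<open>The arrow \<open>u\<close> arises from \<open>Id C x\<close> by the left action
    and from \<open>Id C y\<close> by the right action. The two resulting values of
    \<open>\<gamma> (y, x) u\<close> are the two sides of the naturality square.\<close>
  have "\<gamma> (y, x) u = farr (hom_bimodule M N) (x, x) (y, x)
      (pure_tensor K (Hom C x y) (Hom C x x) u (Id C x)) (\<gamma> (x, x) (Id C x))"
    using module_maps_natural[OF \<gamma>, of "(x, x)" "(y, x)" "pure_tensor K (Hom C x y) (Hom C x x) u (Id C x)" "Id C x"]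
      * by (simp add: reg pc Id_closed farr_regular_pure Comp_Id_right)
  then have 1: "\<gamma> (y, x) u v = farr N x y u (\<gamma> (x, x) (Id C x) v)"
    using * id by (simp add: farr_hom_pure[OF M N] Id_closed M.farr_Id_apply)
  have "\<gamma> (y, x) u = farr (hom_bimodule M N) (y, y) (y, x)
      (pure_tensor K (Hom C y y) (Hom C x y) (Id C y) u) (\<gamma> (y, y) (Id C y))"
    using module_maps_natural[OF \<gamma>, of "(y, y)" "(y, x)" "pure_tensor K (Hom C y y) (Hom C x y) (Id C y) u" "Id C y"]
      * by (simp add: reg pc Id_closed farr_regular_pure Comp_Id_left)
  moreover have "\<gamma> (y, y) (Id C y) (farr M x y u v) \<in> carrier (fobj N y)"
    using id[OF *(2)] linear_maps_closed M.farr_closed[OF *] by (metis Int_iff vect_simps(2))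
  ultimately have "\<gamma> (y, x) u v = \<gamma> (y, y) (Id C y) (farr M x y u v)"
    using * id by (simp add: farr_hom_pure[OF M N] Id_closed N.farr_Id_apply)
  with 1 show "\<gamma> (y, y) (Id C y) (farr M x y u v) = farr N x y u (\<gamma> (x, x) (Id C x) v)" by simp
qed

end

section \<open>Lifting maps of left modules by a splitting of bimodules\<close>

theorem proposition2p9:
  fixes K :: "('k, 'r) ring_scheme"
    and C :: "('o, 'k, 'u) lincat"
    and M :: "('o, 'k, 'u, 'v) left_module"
  assumes "field K"
    and "linear_category K C"
    and "small_category C"
    and "separable_category K C"
    and "M \<in> Obj (left_modules K C)"
  shows "projective_object (left_modules K C) M"
proof -
  interpret C: linear_category K C by fact
  let ?E = "enveloping_category K C" and ?R = "regular_bimodule K C"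
  interpret E: linear_category K ?E by (rule C.linear_category_Env)
  have M: "left_module K C M" using assms(5) by (simp add: C.left_module_iff)
  have R: "left_module K ?E ?R" by (rule C.left_module_regular_bimodule)
  have hom: "carrier (Hom C x y) \<lesssim> (UNIV :: 'u set)" for x y
    by (simp add: subset_imp_lepoll)
  \<comment> \<open>Objects of the enveloping category are pairs and its Hom spaces tensor products;
    the infinite type \<open>'u\<close> absorbs both.\<close>
  have fits: "E.fits_universe (UNIV :: 'u set)"
    using assms(3) tensor.tensor_lepoll[OF C.Env_tensor _ hom hom]
    by (auto simp: E.fits_universe_def small_category_def intro: times_lepoll_infinite)
  note cov = E.left_module_cover[OF fits, of ?R] E.cover_map_map[OF fits R] E.cover_map_surj[OF fits R]
  have res: "\<exists>P d \<epsilon>. projective_resolution K ?E ?R P d \<epsilon>"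
    by (intro exI) (rule E.projective_resolution_cover[OF assms(1) fits R])
  have triv: "trivial_group (Ext K ?E 1 ?R Y)" if "left_module K ?E Y" for Y
    using assms(4) that unfolding separable_category_def bimodules_def Hochschild_Mitchell_def
      E.left_module_iff by blast
  obtain s where s: "s \<in> module_maps K ?E ?R (E.cover ?R)"
    "\<And>p c. p \<in> Obj ?E \<Longrightarrow> c \<in> carrier (fobj ?R p) \<Longrightarrow> E.cover_map ?R p (s p c) = c"
    using E.section_if_trivial_Ext[OF R cov res triv] by blast
  show ?thesis
  proof (rule C.projective_objectI[OF assms(1) M])
    fix N L :: "('o, 'k, 'u, 'v) left_module" and e f
    assume N: "left_module K C N" and L: "left_module K C L" and e: "e \<in> module_maps K C N L" "pointwise_surj C N L e"
      and f: "f \<in> module_maps K C M L"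
    let ?p = "\<lambda>(x, y) h. \<lambda>m\<in>carrier (fobj M y). e x (h m)"
    let ?f = "\<lambda>(x, y) c. \<lambda>m\<in>carrier (fobj M y). f x (farr M y x c m)"
    \<comment> \<open>\<open>?f\<close> starts at the regular bimodule; pulled back to the free
      cover, it can be lifted through \<open>?p\<close> although the targets have another element
      type.\<close>
    note f' = module_maps_comp[OF cov(2) C.regular_to_hom_bimodule[OF M L f]]
    obtain \<psi> where \<psi>: "\<psi> \<in> module_maps K ?E (E.cover ?R) (C.hom_bimodule M N)"
      "\<And>p v. p \<in> Obj ?E \<Longrightarrow> v \<in> carrier (fobj (E.cover ?R) p) \<Longrightarrow> ?p p (\<psi> p v) = ?f p (E.cover_map ?R p v)"
      using E.cover_lift[OF fits C.left_module_hom_bimodule[OF M N] C.left_module_hom_bimodule[OF M L]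
        C.hom_bimodule_push[OF M N L e(1)] C.hom_bimodule_push_surj[OF assms(1) M N L e] f'] by blast
    \<comment> \<open>\<open>\<psi>\<close> lifts only the pullback of \<open>?f\<close>.
      Precomposing with the section \<open>s\<close> gives a lift of \<open>?f\<close> itself,
      because the cover map undoes \<open>s\<close>.\<close>
    define g where "g x = \<psi> (x, x) (s (x, x) (Id C x))" for x
    have "g \<in> module_maps K C M N"
      using C.module_map_if_regular_to_hom[OF M N module_maps_comp[OF s(1) \<psi>(1)]] by (simp add: g_def[abs_def])
    moreover have "e x (g x v) = f x v" if x: "x \<in> Obj C" and v: "v \<in> carrier (fobj M x)" for x v
    proof -
      have id: "Id C x \<in> carrier (fobj ?R (x, x))" using C.Id_closed[OF x] by (simp add: regular_bimodule_def)
      have p: "(x, x) \<in> Obj ?E" using x by simp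
      \<comment> \<open>Both sides are restricted functions on \<open>M\<close> at \<open>x\<close>.
        As \<open>M\<close> preserves identities, the right-hand one is \<open>f x\<close>.\<close>
      have "?p (x, x) (g x) = ?f (x, x) (Id C x)"
        using \<psi>(2)[OF p module_maps_closed[OF s(1) p id]] s(2)[OF p id] unfolding g_def by simp
      from fun_cong[OF this, of v] show ?thesis
        using v x by (simp add: left_module.farr_Id_apply[OF M])
    qed
    ultimately show "\<exists>g\<in>module_maps K C M N. \<forall>x\<in>Obj C. \<forall>v\<in>carrier (fobj M x). e x (g x v) = f x v" by blast
  qed
qed

end
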